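(* Suppose that $\mathbb E_{\boldsymbol\Delta}[Q_\ell(\lambda_\ell-\lambda_{\ell-1})]=\mathbb E_{\boldsymbol y}[\lambda_\ell-\lambda_{\ell-1}]$ for all $\ell=0,\dots,L$, and that there exist positive constants $\alpha_\lambda,\alpha',\beta_\lambda,\beta',\eta$ such that M1. $|\mathbb E_{\boldsymbol y}[\lambda-\lambda_L]|\lesssim h_L^{\alpha_\lambda}+s_L^{-\alpha'}$, and M2. $\mathbb V_{\boldsymbol\Delta}[Q_\ell(\lambda_\ell-\lambda_{\ell-1})]\lesssim R^{-1}N_\ell^{-\eta}\big(h_{\ell-1}^{\beta_\lambda}+s_{\ell-1}^{-\beta'}\big)$ for all $\ell=0,1,\dots,L$. Then $$\mathbb E_{\boldsymbol\Delta}\Big[\big|\mathbb E_{\boldsymbol y}[\lambda]-\widehat Q^{\mathrm{ML}}_{L,R}(\lambda)\big|^2\Big]\lesssim h_L^{2\alpha_\lambda}+s_L^{-2\alpha'}+\frac1R\sum_{\ell=0}^L\frac1{N_\ell^{\eta}}\Big(h_{\ell-1}^{\beta_\lambda}+s_{\ell-1}^{-\beta'}\Big).$$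
   Context: Let $D\subset\mathbb R^d$, $d\in\{1,2,3\}$, be a bounded convex domain and $\Omega=[-\frac12,\frac12]^{\mathbb N}$ with the product uniform measure; $\mathbb E_{\boldsymbol y}[f]=\int_\Omega f(\boldsymbol y)\,d\boldsymbol y$. Coefficients: $a(\boldsymbol x,\boldsymbol y)=a_0(\boldsymbol x)+\sum_{j\ge1}y_ja_j(\boldsymbol x)$, $b(\boldsymbol x,\boldsymbol y)=b_0(\boldsymbol x)+\sum_{j\ge1}y_jb_j(\boldsymbol x)$, $c=c(\boldsymbol x)$, all in $L^\infty(D)$, with $a\ge a_{\min}>0$, $b\ge0$, $c\ge a_{\min}$ for all $\boldsymbol x,\boldsymbol y$; $\sum_j\max(\|a_j\|_{L^\infty},\|b_j\|_{L^\infty})^p<\infty$ and $\sum_j\|\nabla a_j\|_{L^\infty}^q<\infty$ for some $p,q\in(0,1)$; and $\|a(\boldsymbol y)\|_{L^\infty},\|\nabla a(\boldsymbol y)\|_{L^\infty},\|b(\boldsymbol y)\|_{L^\infty},\|c\|_{L^\infty}\le a_{\max}<\infty$ uniformly in $\boldsymbol y$. Eigenproblem: $V=H^1_0(D)$; $\lambda(\boldsymbol y)$ is the smallest eigenvalue, with eigenfunction $u(\boldsymbol y)\in V$, of $\int_D a\nabla u\cdot\nabla v+\int_D b\,uv=\lambda\int_D c\,uv$ for all $v\in V$, $\int_Dc\,u^2=1$. For $s\in\mathbb N$ and a conforming piecewise linear FE space $V_h\subset V$ of meshwidth $h$, $(\lambda_{h,s}(\boldsymbol y),u_{h,s}(\boldsymbol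 y))$ is the smallest eigenpair of the same problem posed on $V_h$ with $y_j$ set to $0$ for all $j>s$. Levels: $L\in\mathbb N$; meshwidths $h_0>h_1>\dots>h_L>0$, truncation dimensions $s_0\le s_1\le\dots\le s_L$, and by convention $h_{-1}=1$, $s_{-1}=1$; $\lambda_\ell=\lambda_{h_\ell,s_\ell}$ for $\ell\ge0$ and $\lambda_{-1}=0$. Quadrature: an $N$-point randomly shifted lattice rule in $s$ dimensions with generating vector $\boldsymbol z\in\mathbb N^s$ and shift $\boldsymbol\Delta\in[0,1)^s$ is $Q_{s,N}(\boldsymbol\Delta)f=\frac1N\sum_{k=0}^{N-1}f\big(\{k\boldsymbol z/N+\boldsymbol\Delta\}-(\frac12,\dots,\frac12)\big)$, where $\{\cdot\}$ is the componentwise fractional part. For $R\in\mathbb N$, let $\boldsymbol\Delta_\ell^{(r)}$ ($0\le\ell\le L$, $1\le r\le R$) be independent random shifts, uniform on $[0,1)^{s_\ell}$, and set $Q_\ell f:=\frac1R\sum_{r=1}^RQ_{s_\ell,N_\ell}(\boldsymbol\Delta_\ell^{(r)})f$. The multilevel estimator is $\widehat Q^{\mathrm{ML}}_{L,R}(\lambda)=\sum_{\ell=0}^LQ_\ell(\lambda_\ell-\lambda_{\ell-1})$. $\mathbb E_{\boldsymbol\Delta}$ is expectation over all shifts, and $\mathbb V_{\boldsymbol\Delta}[Q_\ell f]:=\mathbb E_{\boldsymbol\Delta}[|\mathbb E_{\boldsymbol y}[f]-Q_\ell f|^2]$. $A\lesssim B$ means $A\le CB$ with $C$ independent of $L,R$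 and of all $h_\ell,s_\ell,N_\ell$. *)

theory Defs
  imports "HOL-Probability.Probability"
begin

section \<open>Function spaces on a domain\<close>

text \<open>\<open>cont_diff k f\<close>: the function \<open>f\<close> is of class \<open>C\<^sup>k\<close> on the whole space.\<close>

primrec cont_diff :: "nat \<Rightarrow> ('a::euclidean_space \<Rightarrow> real) \<Rightarrow> bool" where
  "cont_diff 0 f \<longleftrightarrow> continuous_on UNIV f"
| "cont_diff (Suc k) f \<longleftrightarrow>
     (\<exists>g. (\<forall>x. GDERIV f x :> g x) \<and> (\<forall>i\<in>Basis. cont_diff k (\<lambda>x. g x \<bullet> i)))"

definition test_function :: "'a::euclidean_space set \<Rightarrow> ('a \<Rightarrow> real) \<Rightarrow> bool" where
  "test_function D \<phi> \<longleftrightarrow>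
     (\<forall>k. cont_diff k \<phi>) \<and> compact (closure {x. \<phi> x \<noteq> 0}) \<and> closure {x. \<phi> x \<noteq> 0} \<subseteq> D"

definition L2 :: "'a::euclidean_space set \<Rightarrow> ('a \<Rightarrow> 'b::euclidean_space) \<Rightarrow> bool" where
  "L2 D f \<longleftrightarrow> f \<in> borel_measurable (lebesgue_on D) \<and>
              integrable (lebesgue_on D) (\<lambda>x. (norm (f x))\<^sup>2)"

definition Linf :: "'a::euclidean_space set \<Rightarrow> ('a \<Rightarrow> 'b::euclidean_space) \<Rightarrow> bool" where
  "Linf D f \<longleftrightarrow> f \<in> borel_measurable (lebesgue_on D) \<and>
                esssup (lebesgue_on D) (\<lambda>x. ereal (norm (f x))) < \<infinity>"

definition Linf_norm :: "'a::euclidean_space set \<Rightarrow> ('a \<Rightarrow> 'b::euclidean_space) \<Rightarrow> real" where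
  "Linf_norm D f = real_of_ereal (esssup (lebesgue_on D) (\<lambda>x. ereal (norm (f x))))"

definition weak_gradient ::
    "'a::euclidean_space set \<Rightarrow> ('a \<Rightarrow> real) \<Rightarrow> ('a \<Rightarrow> 'a) \<Rightarrow> bool" where
  "weak_gradient D f g \<longleftrightarrow>
     (\<forall>K. compact K \<and> K \<subseteq> D \<longrightarrow> set_integrable lebesgue K f \<and> set_integrable lebesgue K g) \<and>
     (\<forall>\<phi> d\<phi>. test_function D \<phi> \<and> (\<forall>x. GDERIV \<phi> x :> d\<phi> x) \<longrightarrow>
        (\<forall>i\<in>Basis. (LINT x|lebesgue_on D. f x * (d\<phi> x \<bullet> i)) =
                   - (LINT x|lebesgue_on D. (g x \<bullet> i) * \<phi> x)))"

text \<open>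
  \<open>H\<^sup>1\<^sub>0(D)\<close> is the closure of the test functions in the \<open>H\<^sup>1\<close> norm. The relation
  \<open>H10_grad D u g\<close> says that \<open>u\<close> belongs to it and that \<open>g\<close> is the gradient of \<open>u\<close>: the pair
  \<open>(u, g)\<close> is an \<open>L\<^sup>2\<close>-limit of pairs \<open>(\<phi>, \<nabla>\<phi>)\<close> of test functions with their gradients.
  The function \<open>g\<close> is the weak gradient of \<open>u\<close>, hence determined by \<open>u\<close> up to null sets.\<close>

definition H10_grad ::
    "'a::euclidean_space set \<Rightarrow> ('a \<Rightarrow> real) \<Rightarrow> ('a \<Rightarrow> 'a) \<Rightarrow> bool" where
  "H10_grad D u g \<longleftrightarrow> L2 D u \<and> L2 D g \<and>
     (\<exists>\<phi> d\<phi>. (\<forall>n. test_function D (\<phi> n) \<and> (\<forall>x. GDERIV (\<phi> n) x :> d\<phi> n x)) \<and>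
        (\<lambda>n. LINT x|lebesgue_on D. (\<phi> n x - u x)\<^sup>2) \<longlonglongrightarrow> 0 \<and>
        (\<lambda>n::nat. LINT x|lebesgue_on D. (norm (d\<phi> n x - g x))\<^sup>2) \<longlonglongrightarrow> 0)"

definition H10 :: "'a::euclidean_space set \<Rightarrow> ('a \<Rightarrow> real) set" where
  "H10 D = {u. \<exists>g. H10_grad D u g}"

text \<open>
  Continuous piecewise linear finite elements with zero boundary values. A convex domain need not
  be a polytope, in which case the simplices only fill a part of it; the elements of the space are
  extended by zero to the whole of the ambient space (so that, being continuous, they vanish on
  the boundary of the meshed region).\<close>

definition fe_space ::
    "'a::euclidean_space set \<Rightarrow> real \<Rightarrow> ('a \<Rightarrow> real) set \<Rightarrow> bool" where
  "fe_space D h V \<longleftrightarrow>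
     (\<exists>\<T>. triangulation \<T> \<and> \<T> \<noteq> {} \<and> (\<forall>T\<in>\<T>. int DIM('a) simplex T) \<and>
        \<Union>\<T> \<subseteq> closure D \<and> (polytope (closure D) \<longrightarrow> \<Union>\<T> = closure D) \<and>
        h = Max (diameter ` \<T>) \<and>
        V = {v. continuous_on UNIV v \<and> (\<forall>x. x \<notin> \<Union>\<T> \<longrightarrow> v x = 0) \<and>
                (\<forall>T\<in>\<T>. \<exists>p q. \<forall>x\<in>T. v x = p \<bullet> x + q)}) \<and>
     V \<subseteq> H10 D"


section \<open>The parametric eigenvalue problem\<close>

text \<open>
  The parameter domain \<open>[-1/2, 1/2]\<^sup>\<nat>\<close> with coordinates numbered from 1; its points are the
  elements of the space of the product measure. An unrestricted uniform measure on the line would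
  have a larger space, on which integrands given only on the parameter domain need not be
  measurable.\<close>

definition param_measure :: "(nat \<Rightarrow> real) measure" where
  "param_measure = PiM {1..} (\<lambda>_. restrict_space lborel {-1/2..1/2})"

definition E_param :: "((nat \<Rightarrow> real) \<Rightarrow> real) \<Rightarrow> real" where
  "E_param f = (LINT y|param_measure. f y)"

definition coefficient ::
    "(nat \<Rightarrow> 'a \<Rightarrow> real) \<Rightarrow> (nat \<Rightarrow> real) \<Rightarrow> 'a \<Rightarrow> real" where
  "coefficient a y x = a 0 x + (\<Sum>j. y (Suc j) * a (Suc j) x)"

definition truncate_param :: "nat \<Rightarrow> (nat \<Rightarrow> real) \<Rightarrow> nat \<Rightarrow> real" where
  "truncate_param s y = (\<lambda>j\<in>{1..}. if j \<le> s then y j else 0)"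

definition eigenpair ::
    "'a::euclidean_space set \<Rightarrow> ('a \<Rightarrow> real) set \<Rightarrow> ('a \<Rightarrow> real) \<Rightarrow> ('a \<Rightarrow> real) \<Rightarrow> ('a \<Rightarrow> real) \<Rightarrow>
     real \<Rightarrow> ('a \<Rightarrow> real) \<Rightarrow> bool" where
  "eigenpair D V A B c \<mu> u \<longleftrightarrow>
     u \<in> V \<and> (LINT x|lebesgue_on D. c x * (u x)\<^sup>2) = 1 \<and>
     (\<exists>g. H10_grad D u g \<and>
        (\<forall>v\<in>V. \<forall>w. H10_grad D v w \<longrightarrow>
           (LINT x|lebesgue_on D. A x * (g x \<bullet> w x)) + (LINT x|lebesgue_on D. B x * u x * v x) =
           \<mu> * (LINT x|lebesgue_on D. c x * u x * v x)))"

definition smallest_eigenpair ::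
    "'a::euclidean_space set \<Rightarrow> ('a \<Rightarrow> real) set \<Rightarrow> ('a \<Rightarrow> real) \<Rightarrow> ('a \<Rightarrow> real) \<Rightarrow> ('a \<Rightarrow> real) \<Rightarrow>
     real \<Rightarrow> ('a \<Rightarrow> real) \<Rightarrow> bool" where
  "smallest_eigenpair D V A B c \<mu> u \<longleftrightarrow>
     eigenpair D V A B c \<mu> u \<and> (\<forall>\<nu> w. eigenpair D V A B c \<nu> w \<longrightarrow> \<mu> \<le> \<nu>)"

text \<open>The standing assumptions on the domain and on the coefficients. The coefficient family
  \<open>a\<close> consists of the mean \<open>a 0\<close> and the fluctuations \<open>a j\<close> with \<open>j \<ge> 1\<close>.\<close>

definition problem_data ::
    "'a::euclidean_space set \<Rightarrow> (nat \<Rightarrow> 'a \<Rightarrow> real) \<Rightarrow> (nat \<Rightarrow> 'a \<Rightarrow> real) \<Rightarrow> ('a \<Rightarrow> real) \<Rightarrow>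
     real \<Rightarrow> real \<Rightarrow> bool" where
  "problem_data D a b c amin amax \<longleftrightarrow>
     DIM('a) \<in> {1, 2, 3} \<and> open D \<and> D \<noteq> {} \<and> bounded D \<and> convex D \<and> 0 < amin \<and>
     (\<forall>j. Linf D (a j)) \<and> (\<forall>j. Linf D (b j)) \<and> Linf D c \<and>
     (\<forall>y\<in>space param_measure. AE x in lebesgue_on D.
        amin \<le> coefficient a y x \<and> 0 \<le> coefficient b y x) \<and>
     (AE x in lebesgue_on D. amin \<le> c x) \<and>
     (\<exists>p. 0 < p \<and> p < 1 \<and>
        summable (\<lambda>j. max (Linf_norm D (a (Suc j))) (Linf_norm D (b (Suc j))) powr p)) \<and>
     (\<exists>q da. 0 < q \<and> q < 1 \<and> (\<forall>j. weak_gradient D (a (Suc j)) (da j) \<and> Linf D (da j)) \<and>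
        summable (\<lambda>j. Linf_norm D (da j) powr q)) \<and>
     (\<forall>y\<in>space param_measure.
        Linf D (coefficient a y) \<and> Linf_norm D (coefficient a y) \<le> amax \<and>
        (\<exists>g. weak_gradient D (coefficient a y) g \<and> Linf D g \<and> Linf_norm D g \<le> amax) \<and>
        Linf D (coefficient b y) \<and> Linf_norm D (coefficient b y) \<le> amax) \<and>
     Linf_norm D c \<le> amax"


section \<open>Multilevel randomly shifted lattice rules\<close>

text \<open>
  The discretisation parameters of one multilevel estimator: \<open>L\<close>, \<open>R\<close> and, for each level, the
  meshwidth, the truncation dimension, the number of lattice points and the generating vector
  (with components numbered from 1). Values at levels above \<open>L\<close> are irrelevant.\<close>

record ml_config =
  levels :: nat
  reps :: nat
  mesh :: "nat \<Rightarrow> real"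
  trunc :: "nat \<Rightarrow> nat"
  points :: "nat \<Rightarrow> nat"
  genvec :: "nat \<Rightarrow> nat \<Rightarrow> nat"

text \<open>\<open>H\<close> is the set of meshwidths for which a finite element space with an eigenpair is given (on
  very coarse meshes the space may be trivial). A bound with a constant independent of all
  discretisation parameters is a bound with one constant for all members of a set of admissible
  configurations.\<close>

definition admissible :: "real set \<Rightarrow> ml_config \<Rightarrow> bool" where
  "admissible H m \<longleftrightarrow> 1 \<le> reps m \<and>
     (\<forall>l\<le>levels m. mesh m l \<in> H \<and> 0 < mesh m l \<and> 1 \<le> trunc m l \<and> 1 \<le> points m l) \<and>
     (\<forall>l<levels m. mesh m (Suc l) < mesh m l \<and> trunc m l \<le> trunc m (Suc l))"

definition prev_mesh :: "ml_config \<Rightarrow> nat \<Rightarrow> real" where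
  "prev_mesh m l = (case l of 0 \<Rightarrow> 1 | Suc k \<Rightarrow> mesh m k)"

definition prev_trunc :: "ml_config \<Rightarrow> nat \<Rightarrow> nat" where
  "prev_trunc m l = (case l of 0 \<Rightarrow> 1 | Suc k \<Rightarrow> trunc m k)"

text \<open>In the following, \<open>lamh h s y\<close> stands for the discrete eigenvalue \<open>\<lambda>\<^sub>h\<^sub>,\<^sub>s(y)\<close>.\<close>

definition level_diff ::
    "(real \<Rightarrow> nat \<Rightarrow> (nat \<Rightarrow> real) \<Rightarrow> real) \<Rightarrow> ml_config \<Rightarrow> nat \<Rightarrow> (nat \<Rightarrow> real) \<Rightarrow> real" where
  "level_diff lamh m l y = lamh (mesh m l) (trunc m l) y -
     (case l of 0 \<Rightarrow> 0 | Suc k \<Rightarrow> lamh (mesh m k) (trunc m k) y)"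

text \<open>A rule in \<open>s\<close> dimensions is applied to functions on the full parameter domain by setting
  the remaining coordinates to zero.\<close>

definition lattice_rule ::
    "nat \<Rightarrow> nat \<Rightarrow> (nat \<Rightarrow> nat) \<Rightarrow> (nat \<Rightarrow> real) \<Rightarrow> ((nat \<Rightarrow> real) \<Rightarrow> real) \<Rightarrow> real" where
  "lattice_rule s N z \<Delta> f =
     (1 / real N) * (\<Sum>k<N. f (\<lambda>j\<in>{1..}.
        if j \<le> s then frac (real k * real (z j) / real N + \<Delta> j) - 1/2 else 0))"

text \<open>The joint law of the independent uniform shifts \<open>\<Delta> (l, r)\<close>, \<open>l \<le> L\<close>, \<open>1 \<le> r \<le> R\<close>.\<close>

definition shift_measure :: "ml_config \<Rightarrow> (nat \<times> nat \<Rightarrow> nat \<Rightarrow> real) measure" where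
  "shift_measure m = PiM ({0..levels m} \<times> {1..reps m})
     (\<lambda>(l, r). PiM {1..trunc m l} (\<lambda>_. restrict_space lborel {0..<1}))"

definition E_shift :: "ml_config \<Rightarrow> ((nat \<times> nat \<Rightarrow> nat \<Rightarrow> real) \<Rightarrow> real) \<Rightarrow> real" where
  "E_shift m F = (LINT \<Delta>|shift_measure m. F \<Delta>)"

definition Q_level ::
    "ml_config \<Rightarrow> nat \<Rightarrow> (nat \<times> nat \<Rightarrow> nat \<Rightarrow> real) \<Rightarrow> ((nat \<Rightarrow> real) \<Rightarrow> real) \<Rightarrow> real" where
  "Q_level m l \<Delta> f = (1 / real (reps m)) *
     (\<Sum>r=1..reps m. lattice_rule (trunc m l) (points m l) (genvec m l) (\<Delta> (l, r)) f)"

definition V_shift :: "ml_config \<Rightarrow> nat \<Rightarrow> ((nat \<Rightarrow> real) \<Rightarrow> real) \<Rightarrow> real" where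
  "V_shift m l f = E_shift m (\<lambda>\<Delta>. \<bar>E_param f - Q_level m l \<Delta> f\<bar>\<^sup>2)"

definition Q_ML ::
    "(real \<Rightarrow> nat \<Rightarrow> (nat \<Rightarrow> real) \<Rightarrow> real) \<Rightarrow> ml_config \<Rightarrow> (nat \<times> nat \<Rightarrow> nat \<Rightarrow> real) \<Rightarrow> real" where
  "Q_ML lamh m \<Delta> = (\<Sum>l=0..levels m. Q_level m l \<Delta> (level_diff lamh m l))"

end

(*
  The error E[lam] - Q splits into the deterministic bias E[lam - lam_L], a telescoping sum over the
  levels, and the sum of the level errors E[f_l] - Q_l f_l with f_l = lam_l - lam_(l-1). The level
  errors are centred, and they are uncorrelated because different levels use independent shifts.
  Hence the mean square error is the squared bias plus the sum of the level variances, and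
  (x + z)^2 <= 2 (x^2 + z^2) turns M1 into the bias term.

  All of this needs the eigenvalues to be integrable functions of the parameters (the expectation of
  a non-integrable function is 0 by convention). The smallest eigenvalue is the infimum of the Rayleigh quotient: a minimising sequence has an L^2-convergent
  subsequence by Rellich's theorem, the parallelogram identity upgrades this to convergence of the
  gradients, and the minimiser is an eigenfunction. As an infimum of energies that are Lipschitz in
  the coefficients, the eigenvalue is bounded and continuous in the parameters with respect to a
  weighted l^1 distance, and therefore measurable. Rellich's theorem follows from the translation
  estimate |f(. + h) - f| <= |h| |grad f| in L^2 by averaging over the cells of a grid.
*)

theory Submission
  imports Defs "HOL-Library.Diagonal_Subsequence"
begin

section \<open>Square integrable functions\<close>

text \<open>Compactness is forced by the form of the hypotheses: they give an eigenvalue for each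
  parameter separately, with no regularity in the parameter, and \<open>smallest_eigenpair\<close>
  compares it only with other eigenvalues. It can be identified with the infimum of the quotient
  only if that infimum is attained and thus is itself an eigenvalue. This is wanted on
  \<open>H10 D\<close> and on every finite element space; \<open>trial_space\<close> isolates what
  both share, so that the variational argument is carried out once. Gradients are determined only up
  to null sets, so functions travel as pairs with a chosen gradient. The weights of the parameter
  distance are the sup norms of the fluctuations; summability of their p-th powers with p < 1 makes
  them summable, so the distance is finite and the tail of the coordinates contributes little. On
  the infinite product, continuity yields measurability through approximants that see only finitely
  many rounded coordinates.\<close>

definition square_integrable :: "'a measure \<Rightarrow> ('a \<Rightarrow> 'b::euclidean_space) \<Rightarrow> bool" where
  "square_integrable M f \<longleftrightarrow> f \<in> borel_measurable M \<and> integrable M (\<lambda>x. (norm (f x))\<^sup>2)"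

text \<open>The squared norm replaces the norm throughout: all later estimates are quadratic, and
  the elementary factor 2 of \<open>sqnorm_add_le\<close> takes the place of Minkowski's
  inequality.\<close>

definition sqnorm :: "'a measure \<Rightarrow> ('a \<Rightarrow> 'b::euclidean_space) \<Rightarrow> real" where
  "sqnorm M f = (LINT x|M. (norm (f x))\<^sup>2)"

lemma sqnorm_nonneg [simp]: "0 \<le> sqnorm M f"
  unfolding sqnorm_def by (intro integral_nonneg_AE) auto

lemma norm_add_square_le: "(norm (a + b))\<^sup>2 \<le> 2 * (norm a)\<^sup>2 + 2 * (norm (b::'b::real_normed_vector))\<^sup>2"
proof -
  have "(norm (a + b))\<^sup>2 \<le> (norm a + norm b)\<^sup>2"
    by (intro power_mono norm_triangle_ineq) auto
  also have "\<dots> \<le> 2 * (norm a)\<^sup>2 + 2 * (norm b)\<^sup>2"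
    using sum_squares_bound[of "norm a" "norm b"] by (simp add: power2_sum)
  finally show ?thesis .
qed

lemma square_integrable_scale:
  "square_integrable M f \<Longrightarrow> square_integrable M (\<lambda>x. c *\<^sub>R f x)"
  unfolding square_integrable_def by (auto simp: power_mult_distrib)

lemma square_integrable_add:
  assumes "square_integrable M f" "square_integrable M g"
  shows "square_integrable M (\<lambda>x. f x + g x)"
proof -
  have [measurable]: "f \<in> borel_measurable M" "g \<in> borel_measurable M"
    using assms by (auto simp: square_integrable_def)
  have "integrable M (\<lambda>x. 2 * (norm (f x))\<^sup>2 + 2 * (norm (g x))\<^sup>2)"
    using assms by (auto simp: square_integrable_def)
  then have "integrable M (\<lambda>x. (norm (f x + g x))\<^sup>2)"
    by (rule Bochner_Integration.integrable_bound) (auto intro!: norm_add_square_le)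
  then show ?thesis unfolding square_integrable_def by simp
qed

lemma square_integrable_diff:
  assumes "square_integrable M f" "square_integrable M g"
  shows "square_integrable M (\<lambda>x. f x - g x)"
  using square_integrable_add[OF assms(1) square_integrable_scale[OF assms(2), of "-1"]] by simp

lemma sqnorm_add_le:
  assumes "square_integrable M f" "square_integrable M g"
  shows "sqnorm M (\<lambda>x. f x + g x) \<le> 2 * sqnorm M f + 2 * sqnorm M g"
proof -
  have "sqnorm M (\<lambda>x. f x + g x) \<le> (LINT x|M. 2 * (norm (f x))\<^sup>2 + 2 * (norm (g x))\<^sup>2)"
    unfolding sqnorm_def using assms square_integrable_add[OF assms]
    by (intro integral_mono) (auto simp: square_integrable_def intro!: norm_add_square_le)
  also have "\<dots> = 2 * sqnorm M f + 2 * sqnorm M g"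
    using assms unfolding sqnorm_def by (simp add: square_integrable_def)
  finally show ?thesis .
qed

lemma sqnorm_minus_commute: "sqnorm M (\<lambda>x. f x - g x) = sqnorm M (\<lambda>x. g x - f x)"
  unfolding sqnorm_def by (simp add: norm_minus_commute)

lemma sqnorm_triangle:
  assumes "square_integrable M f" "square_integrable M g" "square_integrable M h"
  shows "sqnorm M (\<lambda>x. f x - h x) \<le> 2 * sqnorm M (\<lambda>x. f x - g x) + 2 * sqnorm M (\<lambda>x. g x - h x)"
  using sqnorm_add_le[OF square_integrable_diff[OF assms(1,2)] square_integrable_diff[OF assms(2,3)]]
  by simp

lemma sqnorm_scale: "sqnorm M (\<lambda>x. c *\<^sub>R f x) = c\<^sup>2 * sqnorm M f"
  unfolding sqnorm_def by (simp add: power_mult_distrib)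

text \<open>By Cauchy-Schwarz, and since a product of two norms is at most the sum of their squares,
  the integrand has the integrable majorant \<open>K * (|f|^2 + |g|^2)\<close>.\<close>

lemma integrable_weighted_inner:
  fixes f g :: "'a \<Rightarrow> 'b::euclidean_space"
  assumes f: "square_integrable M f" and g: "square_integrable M g"
    and A: "A \<in> borel_measurable M" "AE x in M. \<bar>A x\<bar> \<le> (K::real)"
  shows "integrable M (\<lambda>x. A x * (f x \<bullet> g x))"
proof -
  have [measurable]: "f \<in> borel_measurable M" "g \<in> borel_measurable M" "A \<in> borel_measurable M"
    using assms by (auto simp: square_integrable_def)
  have i: "integrable M (\<lambda>x. K * ((norm (f x))\<^sup>2 + (norm (g x))\<^sup>2))"
    using assms by (auto simp: square_integrable_def)
  have "AE x in M. norm (A x * (f x \<bullet> g x)) \<le> norm (K * ((norm (f x))\<^sup>2 + (norm (g x))\<^sup>2))"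
    using A(2)
  proof eventually_elim
    case (elim x)
    have "\<bar>f x \<bullet> g x\<bar> \<le> norm (f x) * norm (g x)" by (rule Cauchy_Schwarz_ineq2)
    also have "\<dots> \<le> (norm (f x))\<^sup>2 + (norm (g x))\<^sup>2"
      using sum_squares_bound[of "norm (f x)" "norm (g x)"] zero_le_power2[of "norm (f x)"]
        zero_le_power2[of "norm (g x)"] mult_nonneg_nonneg[OF norm_ge_zero[of "f x"] norm_ge_zero[of "g x"]]
      by linarith
    finally have "\<bar>f x \<bullet> g x\<bar> \<le> (norm (f x))\<^sup>2 + (norm (g x))\<^sup>2" .
    then have "\<bar>A x\<bar> * \<bar>f x \<bullet> g x\<bar> \<le> K * ((norm (f x))\<^sup>2 + (norm (g x))\<^sup>2)"
      using elim by (intro mult_mono) auto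
    also have "\<dots> \<le> \<bar>K * ((norm (f x))\<^sup>2 + (norm (g x))\<^sup>2)\<bar>" by (rule abs_ge_self)
    finally show ?case by (simp only: real_norm_def abs_mult[symmetric])
  qed
  then show ?thesis by (intro Bochner_Integration.integrable_bound[OF i]) auto
qed

lemma integrable_weighted_square:
  fixes f :: "'a \<Rightarrow> 'b::euclidean_space"
  assumes f: "square_integrable M f"
    and A: "A \<in> borel_measurable M" "AE x in M. \<bar>A x\<bar> \<le> (K::real)"
  shows "integrable M (\<lambda>x. A x * (norm (f x))\<^sup>2)"
  using integrable_weighted_inner[OF f f A] by (simp add: power2_norm_eq_inner)

lemma weighted_square_le:
  fixes f :: "'a \<Rightarrow> 'b::euclidean_space"
  assumes f: "square_integrable M f"
    and A: "A \<in> borel_measurable M" "AE x in M. \<bar>A x\<bar> \<le> (K::real)"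
  shows "\<bar>LINT x|M. A x * (norm (f x))\<^sup>2\<bar> \<le> K * sqnorm M f"
proof -
  have "\<bar>LINT x|M. A x * (norm (f x))\<^sup>2\<bar> \<le> (LINT x|M. \<bar>A x * (norm (f x))\<^sup>2\<bar>)"
    by (rule integral_abs_bound)
  also have "\<dots> \<le> (LINT x|M. K * (norm (f x))\<^sup>2)"
  proof (rule integral_mono_AE)
    show "integrable M (\<lambda>x. \<bar>A x * (norm (f x))\<^sup>2\<bar>)"
      using integrable_weighted_square[OF assms] by simp
    show "integrable M (\<lambda>x. K * (norm (f x))\<^sup>2)" using f by (simp add: square_integrable_def)
    show "AE x in M. \<bar>A x * (norm (f x))\<^sup>2\<bar> \<le> K * (norm (f x))\<^sup>2"
      using A(2) by eventually_elim (auto simp: abs_mult intro: mult_right_mono)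
  qed
  also have "\<dots> = K * sqnorm M f" by (simp add: sqnorm_def)
  finally show ?thesis .
qed

lemma weighted_square_ge:
  fixes f :: "'a \<Rightarrow> 'b::euclidean_space"
  assumes f: "square_integrable M f"
    and A: "A \<in> borel_measurable M" "AE x in M. \<bar>A x\<bar> \<le> (K::real)" and k: "AE x in M. k \<le> A x"
  shows "k * sqnorm M f \<le> (LINT x|M. A x * (norm (f x))\<^sup>2)"
proof -
  have "(LINT x|M. k * (norm (f x))\<^sup>2) \<le> (LINT x|M. A x * (norm (f x))\<^sup>2)"
  proof (rule integral_mono_AE)
    show "integrable M (\<lambda>x. A x * (norm (f x))\<^sup>2)"
      using integrable_weighted_square[OF f A] .
    show "integrable M (\<lambda>x. k * (norm (f x))\<^sup>2)" using f by (simp add: square_integrable_def)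
    show "AE x in M. k * (norm (f x))\<^sup>2 \<le> A x * (norm (f x))\<^sup>2"
      using k by eventually_elim (auto intro: mult_right_mono)
  qed
  then show ?thesis by (simp add: sqnorm_def)
qed

text \<open>The difference of squares is factored and the cross term \<open>2 * d * norm b\<close>
  is split by Young's inequality with weight \<open>e\<close>. The part that does not involve
  \<open>a - b\<close> thus gets an arbitrarily small factor, as limit arguments require.\<close>

lemma square_norm_diff_le:
  fixes a b :: "'b::real_normed_vector"
  assumes "e > 0"
  shows "\<bar>(norm a)\<^sup>2 - (norm b)\<^sup>2\<bar> \<le> (1 + 1 / e) * (norm (a - b))\<^sup>2 + e * (norm b)\<^sup>2"
proof -
  define d where "d = norm (a - b)"
  have "\<bar>norm a - norm b\<bar> \<le> d" unfolding d_def by (rule norm_triangle_ineq3)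
  moreover have "norm a + norm b \<le> d + 2 * norm b"
    unfolding d_def using norm_triangle_sub[of a b] by simp
  ultimately have "\<bar>norm a - norm b\<bar> * (norm a + norm b) \<le> d * (d + 2 * norm b)"
    by (intro mult_mono) (auto simp: d_def)
  moreover have "\<bar>(norm a)\<^sup>2 - (norm b)\<^sup>2\<bar> = \<bar>norm a - norm b\<bar> * (norm a + norm b)"
    by (simp add: power2_eq_square square_diff_square_factored abs_mult)
  moreover have "2 * d * norm b \<le> (1 / e) * d\<^sup>2 + e * (norm b)\<^sup>2"
  proof -
    have "0 \<le> (1 / e) * (d - e * norm b)\<^sup>2" using assms by simp
    also have "\<dots> = (1 / e) * d\<^sup>2 + e * (norm b)\<^sup>2 - 2 * d * norm b"
      using assms by (simp add: power2_eq_square field_simps)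
    finally show ?thesis by simp
  qed
  ultimately show ?thesis unfolding d_def[symmetric] by (simp add: power2_eq_square algebra_simps)
qed

lemma weighted_square_tendsto:
  fixes f :: "'a \<Rightarrow> 'b::euclidean_space"
  assumes fn: "\<And>n. square_integrable M (fn n)" and f: "square_integrable M f"
    and A: "A \<in> borel_measurable M" "AE x in M. \<bar>A x\<bar> \<le> (K::real)"
    and lim: "(\<lambda>n. sqnorm M (\<lambda>x. fn n x - f x)) \<longlonglongrightarrow> 0"
  shows "(\<lambda>n. LINT x|M. A x * (norm (fn n x))\<^sup>2) \<longlonglongrightarrow> (LINT x|M. A x * (norm (f x))\<^sup>2)"
proof (rule LIMSEQ_I)
  fix \<epsilon> :: real assume \<epsilon>: "\<epsilon> > 0"
  \<comment> \<open>A strictly positive bound, so that it can stand in a denominator.\<close>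
  define L where "L = \<bar>K\<bar> + 1"
  have L: "L > 0" "AE x in M. \<bar>A x\<bar> \<le> L" using A(2) unfolding L_def by auto
  define t where "t = sqnorm M f + 1"
  \<comment> \<open>The weight in Young's inequality is fixed before \<open>n\<close>: its term
    contributes at most \<open>\<epsilon> / 2\<close>, and the large factor \<open>1 + 1 / e\<close>
    of the other term is then beaten by the convergence.\<close>
  define e where "e = \<epsilon> / (2 * L * (sqnorm M f + 1))"
  have s1: "t > 0" using sqnorm_nonneg[of M f] unfolding t_def by linarith
  have e: "e > 0" using \<epsilon> L s1 unfolding e_def t_def[symmetric] by simp
  have e2: "L * e * sqnorm M f \<le> \<epsilon> / 2"
  proof -
    have "L * e * sqnorm M f \<le> L * e * (sqnorm M f + 1)" using L e by simp
    also have "\<dots> = \<epsilon> / 2" using L(1) s1 unfolding e_def t_def[symmetric] by simp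
    finally show ?thesis .
  qed
  define c where "c = L * (1 + 1 / e)"
  have c: "c > 0" using L e by (simp add: c_def add_pos_pos)
  have bound: "\<bar>(LINT x|M. A x * (norm (fn n x))\<^sup>2) - (LINT x|M. A x * (norm (f x))\<^sup>2)\<bar>
      \<le> c * sqnorm M (\<lambda>x. fn n x - f x) + L * e * sqnorm M f" for n
  proof -
    note i1 = integrable_weighted_square[OF fn A, of n] and i2 = integrable_weighted_square[OF f A]
    have "\<bar>(LINT x|M. A x * (norm (fn n x))\<^sup>2) - (LINT x|M. A x * (norm (f x))\<^sup>2)\<bar>
      = \<bar>LINT x|M. A x * (norm (fn n x))\<^sup>2 - A x * (norm (f x))\<^sup>2\<bar>"
      using i1 i2 by simp
    also have "\<dots> \<le> (LINT x|M. \<bar>A x * (norm (fn n x))\<^sup>2 - A x * (norm (f x))\<^sup>2\<bar>)"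
      by (rule integral_abs_bound)
    also have "\<dots> \<le> (LINT x|M. c * (norm (fn n x - f x))\<^sup>2 + (L * e) * (norm (f x))\<^sup>2)"
    proof (rule integral_mono_AE)
      show "integrable M (\<lambda>x. \<bar>A x * (norm (fn n x))\<^sup>2 - A x * (norm (f x))\<^sup>2\<bar>)"
        using i1 i2 by simp
      show "integrable M (\<lambda>x. c * (norm (fn n x - f x))\<^sup>2 + (L * e) * (norm (f x))\<^sup>2)"
        using square_integrable_diff[OF fn[of n] f] f by (simp add: square_integrable_def)
      show "AE x in M. \<bar>A x * (norm (fn n x))\<^sup>2 - A x * (norm (f x))\<^sup>2\<bar>
         \<le> c * (norm (fn n x - f x))\<^sup>2 + (L * e) * (norm (f x))\<^sup>2"
        using L(2)
      proof eventually_elim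
        case (elim x)
        have "\<bar>A x\<bar> * \<bar>(norm (fn n x))\<^sup>2 - (norm (f x))\<^sup>2\<bar> \<le>
          L * ((1 + 1 / e) * (norm (fn n x - f x))\<^sup>2 + e * (norm (f x))\<^sup>2)"
          using elim L(1) by (intro mult_mono square_norm_diff_le e) auto
        then show ?case
          unfolding c_def by (simp add: abs_mult[symmetric] algebra_simps)
      qed
    qed
    also have "\<dots> = c * sqnorm M (\<lambda>x. fn n x - f x) + L * e * sqnorm M f"
      using square_integrable_diff[OF fn[of n] f] f by (simp add: square_integrable_def sqnorm_def)
    finally show ?thesis .
  qed
  have "eventually (\<lambda>n. sqnorm M (\<lambda>x. fn n x - f x) < \<epsilon> / (2 * c)) sequentially"
    using lim \<epsilon> c by (intro order_tendstoD(2)) auto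
  then have "eventually (\<lambda>n. norm ((LINT x|M. A x * (norm (fn n x))\<^sup>2) - (LINT x|M. A x * (norm (f x))\<^sup>2)) < \<epsilon>) sequentially"
  proof eventually_elim
    case (elim n)
    have "c * sqnorm M (\<lambda>x. fn n x - f x) < c * (\<epsilon> / (2 * c))"
      using elim c by (intro mult_strict_left_mono)
    then have "c * sqnorm M (\<lambda>x. fn n x - f x) < \<epsilon> / 2" using c by simp
    then show ?case using bound[of n] e2 by simp
  qed
  then show "\<exists>N. \<forall>n\<ge>N. norm ((LINT x|M. A x * (norm (fn n x))\<^sup>2) - (LINT x|M. A x * (norm (f x))\<^sup>2)) < \<epsilon>"
    by (simp add: eventually_sequentially)
qed

section \<open>Completeness of L^2\<close>

lemma convergent_of_weighted_increments:
  fixes s :: "nat \<Rightarrow> 'b::banach"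
  assumes "(\<Sum>k. ennreal (2 ^ k * (norm (s (Suc k) - s k))\<^sup>2)) \<noteq> \<infinity>"
  shows "convergent s"
proof -
  have "summable (\<lambda>k. 2 ^ k * (norm (s (Suc k) - s k))\<^sup>2)"
    using assms by (intro summable_suminf_not_top) auto
  then have "Bseq (\<lambda>k. 2 ^ k * (norm (s (Suc k) - s k))\<^sup>2)"
    by (intro convergent_imp_Bseq) (auto dest: summable_LIMSEQ_zero simp: convergent_def)
  then obtain C where C: "\<And>k. norm (2 ^ k * (norm (s (Suc k) - s k))\<^sup>2) \<le> C"
    by (auto simp: Bseq_def)
  \<comment> \<open>The weighted squares are bounded by \<open>C\<close>, so the weight
    \<open>2 ^ k\<close> makes the increments decay like \<open>2 ^ (- k / 2)\<close>, a geometric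
    majorant.\<close>
  have "norm (s (Suc k) - s k) \<le> sqrt C * (1 / sqrt 2) ^ k" for k
  proof -
    have "2 ^ k * (norm (s (Suc k) - s k))\<^sup>2 \<le> C" using C[of k] by simp
    then have "sqrt (2 ^ k * (norm (s (Suc k) - s k))\<^sup>2) \<le> sqrt C" by (rule real_sqrt_le_mono)
    then have "sqrt 2 ^ k * norm (s (Suc k) - s k) \<le> sqrt C"
      by (simp add: real_sqrt_mult real_sqrt_power)
    then show ?thesis by (simp add: pos_le_divide_eq power_divide mult.commute)
  qed
  moreover have "summable (\<lambda>k. sqrt C * (1 / sqrt 2) ^ k)"
    by (intro summable_mult summable_geometric) simp
  ultimately have "summable (\<lambda>k. norm (s (Suc k) - s k))"
    using summable_comparison_test'[of "\<lambda>k. sqrt C * (1 / sqrt 2) ^ k" 0 "\<lambda>k. norm (s (Suc k) - s k)"]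
    by simp
  then have "summable (\<lambda>k. s (Suc k) - s k)" by (rule summable_norm_cancel)
  then have "convergent (\<lambda>n. (\<Sum>k<n. s (Suc k) - s k) + s 0)"
    by (intro convergent_add convergent_const) (simp add: summable_iff_convergent)
  then show ?thesis by (simp add: sum_lessThan_telescope)
qed

text \<open>A sufficiently fast subsequence converges almost everywhere. Its limit is compared with
  every late member of the full sequence by Fatou's lemma, which gives norm convergence of the whole
  sequence at once.\<close>

theorem Riesz_Fischer:
  fixes f :: "nat \<Rightarrow> 'a \<Rightarrow> 'b::euclidean_space"
  assumes f: "\<And>n. square_integrable M (f n)"
    and C: "\<And>e. e > 0 \<Longrightarrow> \<exists>N. \<forall>m\<ge>N. \<forall>n\<ge>N. sqnorm M (\<lambda>x. f m x - f n x) < e"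
  obtains g where "square_integrable M g" "(\<lambda>n. sqnorm M (\<lambda>x. f n x - g x)) \<longlonglongrightarrow> 0"
proof -
  have [measurable]: "\<And>n. f n \<in> borel_measurable M" using f by (simp add: square_integrable_def)
  have nn: "(\<integral>\<^sup>+x. ennreal ((norm (f m x - f n x))\<^sup>2) \<partial>M) = ennreal (sqnorm M (\<lambda>x. f m x - f n x))" for m n
    using square_integrable_diff[OF f f, of m n]
    unfolding sqnorm_def square_integrable_def by (intro nn_integral_eq_integral) auto
  \<comment> \<open>The tolerance \<open>(1/4) ^ k\<close> beats the weight \<open>2 ^ k\<close> in
    the series \<open>S\<close>, whose integral is therefore at most the sum of
    \<open>(1/2) ^ k\<close>.\<close>
  have "\<exists>r. \<forall>k. (\<forall>m\<ge>r k. \<forall>n\<ge>r k. sqnorm M (\<lambda>x. f m x - f n x) < (1/4) ^ k) \<and> r k < r (Suc k)"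
  proof (rule dependent_nat_choice)
    show "\<exists>N. \<forall>m\<ge>N. \<forall>n\<ge>N. sqnorm M (\<lambda>x. f m x - f n x) < (1/4) ^ 0" using C[of 1] by auto
    fix r k
    obtain N where "\<forall>m\<ge>N. \<forall>n\<ge>N. sqnorm M (\<lambda>x. f m x - f n x) < (1/4) ^ Suc k"
      using C[of "(1/4) ^ Suc k"] by auto
    then have "(\<forall>m\<ge>max N (Suc r). \<forall>n\<ge>max N (Suc r). sqnorm M (\<lambda>x. f m x - f n x) < (1/4) ^ Suc k)
      \<and> r < max N (Suc r)" by auto
    then show "\<exists>N. (\<forall>m\<ge>N. \<forall>n\<ge>N. sqnorm M (\<lambda>x. f m x - f n x) < (1/4) ^ Suc k) \<and> r < N" by blast
  qed
  then obtain r where r: "\<And>k m n. m \<ge> r k \<Longrightarrow> n \<ge> r k \<Longrightarrow> sqnorm M (\<lambda>x. f m x - f n x) < (1/4) ^ k"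
    and "\<And>k. r k < r (Suc k)" by blast
  then have sm: "strict_mono r" by (simp add: strict_mono_Suc_iff)
  define S where "S x = (\<Sum>k. ennreal (2 ^ k * (norm (f (r (Suc k)) x - f (r k) x))\<^sup>2))" for x
  have [measurable]: "S \<in> borel_measurable M" unfolding S_def by measurable
  have "(\<integral>\<^sup>+x. S x \<partial>M) = (\<Sum>k. \<integral>\<^sup>+x. ennreal (2 ^ k * (norm (f (r (Suc k)) x - f (r k) x))\<^sup>2) \<partial>M)"
    unfolding S_def by (rule nn_integral_suminf) measurable
  also have "\<dots> \<le> (\<Sum>k. ennreal ((1/2) ^ k))"
  proof (intro suminf_le)
    fix k
    have "(\<integral>\<^sup>+x. ennreal (2 ^ k * (norm (f (r (Suc k)) x - f (r k) x))\<^sup>2) \<partial>M)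
      = ennreal (2 ^ k) * ennreal (sqnorm M (\<lambda>x. f (r (Suc k)) x - f (r k) x))"
      by (simp add: ennreal_mult' nn_integral_cmult nn)
    also have "\<dots> = ennreal (2 ^ k * sqnorm M (\<lambda>x. f (r (Suc k)) x - f (r k) x))"
      by (simp add: ennreal_mult')
    also have "\<dots> \<le> ennreal (2 ^ k * (1/4) ^ k)"
      using r[of k "r (Suc k)" "r k"] sm
      by (intro ennreal_leI mult_left_mono) (auto simp: strict_mono_less_eq)
    also have "2 ^ k * (1/4) ^ k = (1/2 :: real) ^ k" by (simp add: power_mult_distrib[symmetric])
    finally show "(\<integral>\<^sup>+x. ennreal (2 ^ k * (norm (f (r (Suc k)) x - f (r k) x))\<^sup>2) \<partial>M) \<le> ennreal ((1/2) ^ k)" .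
  qed auto
  also have "\<dots> < \<infinity>"
    by (subst suminf_ennreal2) (auto intro!: summable_geometric simp: less_top[symmetric])
  finally have "AE x in M. S x \<noteq> \<infinity>"
    by (intro nn_integral_noteq_infinite) auto
  then have conv: "AE x in M. convergent (\<lambda>k. f (r k) x)"
    by eventually_elim (auto simp: S_def intro: convergent_of_weighted_increments)
  define g where "g x = lim (\<lambda>k. f (r k) x)" for x
  have gm [measurable]: "g \<in> borel_measurable M"
    unfolding g_def by (rule borel_measurable_lim_metric) measurable
  have lim: "AE x in M. (\<lambda>k. f (r k) x) \<longlonglongrightarrow> g x"
    using conv by eventually_elim (simp add: g_def convergent_LIMSEQ_iff)
  have bound: "(\<integral>\<^sup>+x. ennreal ((norm (f n x - g x))\<^sup>2) \<partial>M) \<le> ennreal ((1/4) ^ k)" if n: "n \<ge> r k" for n k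
  proof -
    have "(\<integral>\<^sup>+x. ennreal ((norm (f n x - g x))\<^sup>2) \<partial>M)
      = (\<integral>\<^sup>+x. liminf (\<lambda>j. ennreal ((norm (f n x - f (r j) x))\<^sup>2)) \<partial>M)"
    proof (rule nn_integral_cong_AE)
      show "AE x in M. ennreal ((norm (f n x - g x))\<^sup>2) = liminf (\<lambda>j. ennreal ((norm (f n x - f (r j) x))\<^sup>2))"
        using lim
      proof eventually_elim
        case (elim x)
        then have "(\<lambda>j. ennreal ((norm (f n x - f (r j) x))\<^sup>2)) \<longlonglongrightarrow> ennreal ((norm (f n x - g x))\<^sup>2)"
          by (intro tendsto_intros)
        then show ?case by (intro lim_imp_Liminf[symmetric]) simp_all
      qed
    qed
    also have "\<dots> \<le> liminf (\<lambda>j. \<integral>\<^sup>+x. ennreal ((norm (f n x - f (r j) x))\<^sup>2) \<partial>M)"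
      by (rule nn_integral_liminf) measurable
    also have "\<dots> \<le> ennreal ((1/4) ^ k)"
    proof (rule Liminf_le)
      show "\<forall>\<^sub>F j in sequentially. (\<integral>\<^sup>+x. ennreal ((norm (f n x - f (r j) x))\<^sup>2) \<partial>M) \<le> ennreal ((1/4) ^ k)"
        unfolding nn
        using eventually_ge_at_top[of k]
      proof eventually_elim
        case (elim j)
        then have "r k \<le> r j" using sm by (simp add: strict_mono_less_eq)
        then show ?case using r[of k n "r j"] n by (intro ennreal_leI) auto
      qed
    qed auto
    finally show ?thesis .
  qed
  have si: "square_integrable M (\<lambda>x. f n x - g x)" if "n \<ge> r 0" for n
    unfolding square_integrable_def
  proof
    show "integrable M (\<lambda>x. (norm (f n x - g x))\<^sup>2)"
      using bound[OF that] by (intro integrableI_bounded) (auto intro: le_less_trans)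
  qed simp
  \<comment> \<open>Fatou bounds only differences with \<open>g\<close>; \<open>g\<close> itself is
    recovered as \<open>f n - (f n - g)\<close>.\<close>
  have sg: "square_integrable M g"
    using square_integrable_diff[OF f[of "r 0"] si[of "r 0"]] by simp
  have small: "sqnorm M (\<lambda>x. f n x - g x) \<le> (1/4) ^ k" if "n \<ge> r k" for n k
  proof -
    have "n \<ge> r 0" using that sm by (meson le_trans strict_mono_less_eq zero_le)
    then have "ennreal (sqnorm M (\<lambda>x. f n x - g x)) = (\<integral>\<^sup>+x. ennreal ((norm (f n x - g x))\<^sup>2) \<partial>M)"
      using si[of n] unfolding sqnorm_def square_integrable_def
      by (intro nn_integral_eq_integral[symmetric]) auto
    with bound[OF that] have "ennreal (sqnorm M (\<lambda>x. f n x - g x)) \<le> ennreal ((1/4) ^ k)" by simp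
    then show ?thesis by (simp add: ennreal_le_iff)
  qed
  have "(\<lambda>n. sqnorm M (\<lambda>x. f n x - g x)) \<longlonglongrightarrow> 0"
  proof (rule LIMSEQ_I)
    fix e :: real assume "e > 0"
    then obtain k where "(1/4) ^ k < e" using real_arch_pow_inv[of e "1/4"] by auto
    then show "\<exists>N. \<forall>n\<ge>N. norm (sqnorm M (\<lambda>x. f n x - g x) - 0) < e"
      using small[of k] by (intro exI[of _ "r k"]) (auto intro: le_less_trans)
  qed
  with sg show ?thesis by (rule that)
qed

section \<open>Compactness of the Sobolev embedding\<close>

lemma square_integral_unit_interval_le:
  fixes \<phi> :: "real \<Rightarrow> real"
  assumes "continuous_on {0..1} \<phi>"
  shows "(LINT t:{0..1}|lborel. \<phi> t)\<^sup>2 \<le> (LINT t:{0..1}|lborel. (\<phi> t)\<^sup>2)"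
proof -
  define m where "m = (LINT t:{0..1}|lborel. \<phi> t)"
  have i1: "set_integrable lborel {0..1} \<phi>"
    using assms by (rule borel_integrable_atLeastAtMost')
  have i2: "set_integrable lborel {0..1} (\<lambda>t. (\<phi> t)\<^sup>2)"
    by (intro borel_integrable_atLeastAtMost' continuous_intros assms)
  have i3: "set_integrable lborel {0..1::real} (\<lambda>t. c)" for c :: real
    by (intro borel_integrable_atLeastAtMost' continuous_on_const)
  have c: "(LINT t:{0..1::real}|lborel. c) = c" for c :: real
    by (simp add: set_lebesgue_integral_def)
  \<comment> \<open>The variance of \<open>\<phi>\<close> about its mean is nonnegative; the
    interval has length one, so no normalising factor appears.\<close>
  have "0 \<le> (LINT t:{0..1}|lborel. (\<phi> t - m)\<^sup>2)"
    unfolding set_lebesgue_integral_def by (intro integral_nonneg_AE) auto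
  also have "\<dots> = (LINT t:{0..1}|lborel. ((\<phi> t)\<^sup>2 - (2 * m) * \<phi> t) + m\<^sup>2)"
    by (simp add: power2_diff algebra_simps)
  also have "\<dots> = (LINT t:{0..1}|lborel. (\<phi> t)\<^sup>2) - 2 * m * m + m\<^sup>2"
    using i1 i2 i3 by (simp add: set_integral_add set_integral_diff c m_def[symmetric])
  finally show ?thesis unfolding m_def[symmetric] by (simp add: power2_eq_square)
qed

lemma GDERIV_line:
  fixes f :: "'a::euclidean_space \<Rightarrow> real"
  assumes "\<And>x. GDERIV f x :> g x"
  shows "((\<lambda>t. f (x + t *\<^sub>R h)) has_real_derivative (g (x + t *\<^sub>R h) \<bullet> h)) (at t)"
proof -
  have 1: "((\<lambda>t. x + t *\<^sub>R h) has_derivative (\<lambda>s. s *\<^sub>R h)) (at t)"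
    by (auto intro!: derivative_eq_intros)
  have 2: "(f has_derivative (\<lambda>v. v \<bullet> g (x + t *\<^sub>R h))) (at (x + t *\<^sub>R h))"
    using assms[of "x + t *\<^sub>R h"] unfolding gderiv_def by (simp add: inner_commute)
  have "((\<lambda>t. f (x + t *\<^sub>R h)) has_derivative (\<lambda>s. (s *\<^sub>R h) \<bullet> g (x + t *\<^sub>R h))) (at t)"
    using has_derivative_compose[OF 1 2] by simp
  then show ?thesis
    by (simp add: has_field_derivative_def inner_commute mult.commute[of _ "h \<bullet> _"]) 
qed

lemma GDERIV_imp_continuous:
  fixes f :: "'a::euclidean_space \<Rightarrow> real"
  assumes "\<And>x. GDERIV f x :> g x"
  shows "continuous_on UNIV f"
  using assms has_derivative_continuous by (metis continuous_at_imp_continuous_on gderiv_def)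

lemma nn_set_integral_eq:
  fixes g :: "'a \<Rightarrow> real"
  assumes "set_integrable M A g" "\<And>x. 0 \<le> g x"
  shows "(\<integral>\<^sup>+x. indicator A x * ennreal (g x) \<partial>M) = ennreal (LINT x:A|M. g x)"
proof -
  have "(\<integral>\<^sup>+x. indicator A x * ennreal (g x) \<partial>M) = (\<integral>\<^sup>+x. ennreal (indicator A x *\<^sub>R g x) \<partial>M)"
    by (intro nn_integral_cong) (auto split: split_indicator)
  also have "\<dots> = ennreal (LINT x:A|M. g x)"
    using assms unfolding set_integrable_def set_lebesgue_integral_def
    by (intro nn_integral_eq_integral) auto
  finally show ?thesis .
qed

text \<open>The fundamental theorem of calculus on the segment from \<open>x\<close> to
  \<open>x + h\<close>, followed by the mean square inequality and Cauchy-Schwarz. The bound is a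
  nonnegative integral because it is next integrated over \<open>x\<close> with the order exchanged,
  where integrability is not known.\<close>

lemma increment_square_le:
  fixes f :: "'a::euclidean_space \<Rightarrow> real"
  assumes f: "\<And>x. GDERIV f x :> g x" and g: "continuous_on UNIV g"
  shows "ennreal ((f (x + h) - f x)\<^sup>2) \<le>
    (\<integral>\<^sup>+t. indicator {0..1} t * ennreal ((norm h)\<^sup>2 * (norm (g (x + t *\<^sub>R h)))\<^sup>2) \<partial>lborel)"
proof -
  define \<phi> where "\<phi> t = g (x + t *\<^sub>R h) \<bullet> h" for t
  have cg: "continuous_on A (\<lambda>t. g (x + t *\<^sub>R h))" for A
    by (rule continuous_on_compose2[OF g]) (auto intro!: continuous_intros)
  then have c: "continuous_on A \<phi>" for A
    unfolding \<phi>_def by (intro continuous_intros)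
  have "has_bochner_integral lborel (\<lambda>t. indicator {0..1} t *\<^sub>R \<phi> t)
      (f (x + 1 *\<^sub>R h) - f (x + 0 *\<^sub>R h))"
  proof (rule has_bochner_integral_FTC_Icc)
    fix t :: real
    show "((\<lambda>t. f (x + t *\<^sub>R h)) has_vector_derivative \<phi> t) (at t within {0..1})"
      using GDERIV_line[OF f, of x h t] unfolding \<phi>_def
      by (simp add: has_real_derivative_iff_has_vector_derivative has_vector_derivative_at_within)
  qed (auto intro!: c)
  then have "f (x + h) - f x = (LINT t:{0..1}|lborel. \<phi> t)"
    unfolding set_lebesgue_integral_def by (simp add: has_bochner_integral_iff)
  then have "(f (x + h) - f x)\<^sup>2 \<le> (LINT t:{0..1}|lborel. (\<phi> t)\<^sup>2)"
    using square_integral_unit_interval_le[OF c] by simp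
  also have "\<dots> \<le> (LINT t:{0..1}|lborel. (norm h)\<^sup>2 * (norm (g (x + t *\<^sub>R h)))\<^sup>2)"
  proof (rule set_integral_mono)
    fix t :: real
    have "\<bar>\<phi> t\<bar> \<le> norm h * norm (g (x + t *\<^sub>R h))"
      unfolding \<phi>_def by (metis Cauchy_Schwarz_ineq2 mult.commute)
    then have "\<bar>\<phi> t\<bar>\<^sup>2 \<le> (norm h * norm (g (x + t *\<^sub>R h)))\<^sup>2"
      by (rule power_mono) simp
    then show "(\<phi> t)\<^sup>2 \<le> (norm h)\<^sup>2 * (norm (g (x + t *\<^sub>R h)))\<^sup>2"
      by (simp add: power_mult_distrib)
  qed (auto intro!: borel_integrable_atLeastAtMost' continuous_intros c cg)
  finally have le: "(f (x + h) - f x)\<^sup>2 \<le>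
    (LINT t:{0..1}|lborel. (norm h)\<^sup>2 * (norm (g (x + t *\<^sub>R h)))\<^sup>2)" .
  have int: "set_integrable lborel {0..1::real} (\<lambda>t. (norm h)\<^sup>2 * (norm (g (x + t *\<^sub>R h)))\<^sup>2)"
    by (intro borel_integrable_atLeastAtMost' continuous_intros cg)
  have "(\<integral>\<^sup>+t. indicator {0..1} t * ennreal ((norm h)\<^sup>2 * (norm (g (x + t *\<^sub>R h)))\<^sup>2) \<partial>lborel)
    = ennreal (LINT t:{0..1}|lborel. (norm h)\<^sup>2 * (norm (g (x + t *\<^sub>R h)))\<^sup>2)"
    using int by (rule nn_set_integral_eq) simp
  then show ?thesis using le by (simp add: ennreal_leI)
qed

lemma nn_integral_lborel_translate:
  fixes f :: "'a::euclidean_space \<Rightarrow> ennreal"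
  assumes [measurable]: "f \<in> borel_measurable borel"
  shows "(\<integral>\<^sup>+x. f (x + h) \<partial>lborel) = (\<integral>\<^sup>+x. f x \<partial>lborel)"
proof -
  have "(\<integral>\<^sup>+x. f x \<partial>lborel) = (\<integral>\<^sup>+x. f x \<partial>(distr lborel borel ((+) h)))"
    by (simp add: lborel_distr_plus)
  also have "\<dots> = (\<integral>\<^sup>+x. f (h + x) \<partial>lborel)"
    by (rule nn_integral_distr) auto
  finally show ?thesis by (simp add: add.commute)
qed

text \<open>After the exchange of integrals, the integral over \<open>x\<close> for fixed
  \<open>t\<close> is the same for all \<open>t\<close> by translation invariance, so averaging over
  the unit interval reproduces the gradient norm.\<close>

lemma translation_estimate:
  fixes f :: "'a::euclidean_space \<Rightarrow> real"
  assumes f: "\<And>x. GDERIV f x :> g x" and g: "continuous_on UNIV g"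
  shows "(\<integral>\<^sup>+x. ennreal ((f (x + h) - f x)\<^sup>2) \<partial>lborel) \<le>
    ennreal ((norm h)\<^sup>2) * (\<integral>\<^sup>+x. ennreal ((norm (g x))\<^sup>2) \<partial>lborel)"
proof -
  have [measurable]: "g \<in> borel_measurable borel"
    using g by (rule borel_measurable_continuous_onI)
  let ?G = "\<integral>\<^sup>+x. ennreal ((norm (g x))\<^sup>2) \<partial>lborel"
  have "(\<integral>\<^sup>+x. ennreal ((f (x + h) - f x)\<^sup>2) \<partial>lborel) \<le>
    (\<integral>\<^sup>+x. (\<integral>\<^sup>+t. indicator {0..1} t * ennreal ((norm h)\<^sup>2 * (norm (g (x + t *\<^sub>R h)))\<^sup>2)
      \<partial>(lborel :: real measure)) \<partial>(lborel :: 'a measure))"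
    by (intro nn_integral_mono increment_square_le[OF f g])
  also have "\<dots> = (\<integral>\<^sup>+t. (\<integral>\<^sup>+x. indicator {0..1} t * ennreal ((norm h)\<^sup>2 * (norm (g (x + t *\<^sub>R h)))\<^sup>2)
      \<partial>(lborel :: 'a measure)) \<partial>(lborel :: real measure))"
    by (rule lborel_pair.Fubini') measurable
  also have "\<dots> = (\<integral>\<^sup>+t. indicator {0..1} t * (ennreal ((norm h)\<^sup>2) * ?G) \<partial>(lborel :: real measure))"
  proof (rule nn_integral_cong)
    fix t :: real
    have "(\<integral>\<^sup>+x. ennreal ((norm (g (x + t *\<^sub>R h)))\<^sup>2) \<partial>lborel) = ?G"
      by (rule nn_integral_lborel_translate) measurable
    then show "(\<integral>\<^sup>+x. indicator {0..1} t * ennreal ((norm h)\<^sup>2 * (norm (g (x + t *\<^sub>R h)))\<^sup>2) \<partial>lborel)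
      = indicator {0..1} t * (ennreal ((norm h)\<^sup>2) * ?G)"
      by (simp add: ennreal_mult' nn_integral_cmult)
  qed
  also have "\<dots> = ennreal ((norm h)\<^sup>2) * ?G"
    by (simp add: nn_integral_multc)
  finally show ?thesis .
qed

section \<open>A Poincare type inequality on a cubic grid\<close>

definition grid_point :: "real \<Rightarrow> 'a::euclidean_space \<Rightarrow> 'a" where
  "grid_point \<delta> x = (\<Sum>i\<in>Basis. (\<delta> * of_int \<lfloor>x \<bullet> i / \<delta>\<rfloor>) *\<^sub>R i)"

text \<open>As fibres of \<open>grid_point\<close> the cells are disjoint, cover the space and are
  Borel sets automatically. Each nonempty one is a half-open cube, and comparison with open and
  closed boxes supplies the geometry.\<close>

definition grid_cell :: "real \<Rightarrow> 'a::euclidean_space \<Rightarrow> 'a set" where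
  "grid_cell \<delta> p = {x. grid_point \<delta> x = p}"

lemma inner_grid_point: "i \<in> Basis \<Longrightarrow> grid_point \<delta> x \<bullet> i = \<delta> * of_int \<lfloor>x \<bullet> i / \<delta>\<rfloor>"
  unfolding grid_point_def by simp

lemma measurable_grid_point [measurable]: "grid_point \<delta> \<in> borel_measurable borel"
  unfolding grid_point_def by measurable

lemma grid_cell_measurable [measurable]: "grid_cell \<delta> p \<in> sets borel"
  unfolding grid_cell_def by measurable

lemma grid_point_bounds:
  assumes "\<delta> > 0" "i \<in> Basis"
  shows "grid_point \<delta> x \<bullet> i \<le> x \<bullet> i" "x \<bullet> i < grid_point \<delta> x \<bullet> i + \<delta>"
proof -
  have *: "x \<bullet> i = \<delta> * (x \<bullet> i / \<delta>)" using assms by simp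
  have "\<delta> * of_int \<lfloor>x \<bullet> i / \<delta>\<rfloor> \<le> \<delta> * (x \<bullet> i / \<delta>)"
    using assms by (intro mult_left_mono of_int_floor_le) auto
  then show "grid_point \<delta> x \<bullet> i \<le> x \<bullet> i"
    using assms * by (simp add: inner_grid_point)
  have "\<delta> * (x \<bullet> i / \<delta>) < \<delta> * (of_int \<lfloor>x \<bullet> i / \<delta>\<rfloor> + 1)"
    using assms by (intro mult_strict_left_mono) linarith+
  then show "x \<bullet> i < grid_point \<delta> x \<bullet> i + \<delta>"
    using assms * by (simp add: inner_grid_point algebra_simps)
qed

lemma box_subset_grid_cell:
  assumes "\<delta> > 0"
  shows "box (grid_point \<delta> x) (grid_point \<delta> x + \<delta> *\<^sub>R One) \<subseteq> grid_cell \<delta> (grid_point \<delta> x)"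
proof
  fix z assume z: "z \<in> box (grid_point \<delta> x) (grid_point \<delta> x + \<delta> *\<^sub>R One)"
  show "z \<in> grid_cell \<delta> (grid_point \<delta> x)"
    unfolding grid_cell_def mem_Collect_eq
  proof (rule euclidean_eqI)
    fix i :: 'a assume i: "i \<in> Basis"
    have "\<delta> * of_int \<lfloor>x \<bullet> i / \<delta>\<rfloor> < z \<bullet> i" "z \<bullet> i < \<delta> * of_int \<lfloor>x \<bullet> i / \<delta>\<rfloor> + \<delta>"
      using z i by (auto simp: mem_box inner_grid_point inner_simps)
    then have "\<lfloor>z \<bullet> i / \<delta>\<rfloor> = \<lfloor>x \<bullet> i / \<delta>\<rfloor>"
      using assms by (intro floor_unique) (auto simp: field_simps)
    then show "grid_point \<delta> z \<bullet> i = grid_point \<delta> x \<bullet> i"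
      using i by (simp add: inner_grid_point)
  qed
qed

lemma grid_cell_subset_cbox:
  assumes "\<delta> > 0"
  shows "grid_cell \<delta> p \<subseteq> cbox p (p + \<delta> *\<^sub>R One)"
proof
  fix x assume "x \<in> grid_cell \<delta> p"
  then have p: "p = grid_point \<delta> x" by (simp add: grid_cell_def)
  show "x \<in> cbox p (p + \<delta> *\<^sub>R One)"
    unfolding p mem_box
    using grid_point_bounds[OF assms, of _ x] by (auto simp: inner_simps intro: less_imp_le)
qed

lemma bounded_grid_cell: "\<delta> > 0 \<Longrightarrow> bounded (grid_cell \<delta> p)"
  using bounded_subset[OF bounded_cbox grid_cell_subset_cbox] .

text \<open>The bounds come from the closed box around a cell and the open box inside it. The cell
  of a \<open>p\<close> that is not a grid point is empty, hence the range condition for the lower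
  bound.\<close>

lemma measure_grid_cell:
  assumes "\<delta> > 0"
  shows "emeasure lborel (grid_cell \<delta> p) < \<infinity>"
    and "p \<in> range (grid_point \<delta>) \<Longrightarrow> \<delta> ^ DIM('a) \<le> measure lborel (grid_cell \<delta> (p::'a::euclidean_space))"
proof -
  have le: "emeasure lborel (grid_cell \<delta> p) \<le> emeasure lborel (cbox p (p + \<delta> *\<^sub>R One))"
    by (intro emeasure_mono grid_cell_subset_cbox assms) auto
  also have "\<dots> < \<infinity>" by (rule emeasure_lborel_cbox_finite)
  finally show fin: "emeasure lborel (grid_cell \<delta> p) < \<infinity>" .
  assume "p \<in> range (grid_point \<delta>)"
  then obtain x where p: "p = grid_point \<delta> x" by auto
  have "measure lborel (box p (p + \<delta> *\<^sub>R One)) \<le> measure lborel (grid_cell \<delta> p)"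
    using fin box_subset_grid_cell[OF assms, of x] unfolding p
    by (intro measure_mono_fmeasurable) (auto simp: fmeasurable_def)
  moreover have "measure lborel (box p (p + \<delta> *\<^sub>R One)) = \<delta> ^ DIM('a)"
    using assms by (subst measure_lborel_box) (auto simp: inner_simps)
  ultimately show "\<delta> ^ DIM('a) \<le> measure lborel (grid_cell \<delta> p)" by simp
qed

text \<open>Corners are \<open>\<delta>\<close> times integer vectors, and boundedness of
  \<open>D\<close> confines the integers to a finite range. This finiteness is what later turns
  bounded cell integrals into a convergent subsequence.\<close>

lemma finite_grid_points:
  fixes D :: "'a::euclidean_space set"
  assumes "\<delta> > 0" "bounded D"
  shows "finite (grid_point \<delta> ` D)"
proof -
  obtain B where B: "\<And>x. x \<in> D \<Longrightarrow> norm x \<le> B"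
    using assms by (auto simp: bounded_iff)
  define F where "F = (Basis::'a set) \<rightarrow>\<^sub>E {\<lfloor>- B / \<delta>\<rfloor>..\<lfloor>B / \<delta>\<rfloor>}"
  have "grid_point \<delta> ` D \<subseteq> (\<lambda>k. \<Sum>i\<in>Basis. (\<delta> * of_int (k i)) *\<^sub>R (i::'a)) ` F"
  proof
    fix p assume "p \<in> grid_point \<delta> ` D"
    then obtain x where x: "x \<in> D" "p = grid_point \<delta> x" by auto
    define k where "k = (\<lambda>i\<in>Basis. \<lfloor>x \<bullet> i / \<delta>\<rfloor>)"
    have "k \<in> F"
      unfolding F_def k_def
    proof (intro restrict_PiE_iff[THEN iffD2] ballI)
      fix i :: 'a assume i: "i \<in> Basis"
      have "\<bar>x \<bullet> i\<bar> \<le> B" using Basis_le_norm[OF i, of x] B[OF x(1)] by simp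
      then show "\<lfloor>x \<bullet> i / \<delta>\<rfloor> \<in> {\<lfloor>- B / \<delta>\<rfloor>..\<lfloor>B / \<delta>\<rfloor>}"
        using assms by (auto intro!: floor_mono simp: field_simps abs_le_iff)
    qed
    moreover have "p = (\<Sum>i\<in>Basis. (\<delta> * of_int (k i)) *\<^sub>R i)"
      unfolding x k_def grid_point_def by (intro sum.cong) auto
    ultimately show "p \<in> (\<lambda>k. \<Sum>i\<in>Basis. (\<delta> * of_int (k i)) *\<^sub>R (i::'a)) ` F" by blast
  qed
  moreover have "finite F" unfolding F_def by (intro finite_PiE) auto
  ultimately show ?thesis using finite_surj by blast
qed

lemma continuous_set_integrable_bounded:
  fixes g :: "'a::euclidean_space \<Rightarrow> real"
  assumes "continuous_on UNIV g" "bounded A" "A \<in> sets borel"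
  shows "set_integrable lborel A g"
proof (rule set_integrable_subset)
  show "set_integrable lborel (closure A) g"
    unfolding set_integrable_def using assms
    by (intro borel_integrable_compact) (auto intro: continuous_on_subset)
qed (use assms in \<open>auto simp: closure_subset\<close>)

text \<open>Expanding the square and integrating first in \<open>z\<close>, then in
  \<open>x\<close>, gives \<open>2 * V * Q - 2 * W^2\<close>. The term in \<open>W\<close> stands on
  the left because the identity is between extended nonnegative reals, where subtraction is
  truncated.\<close>

lemma variance_identity:
  fixes f :: "'a::euclidean_space \<Rightarrow> real"
  assumes [measurable]: "A \<in> sets borel" and fin: "emeasure lborel A < \<infinity>"
    and f: "continuous_on UNIV f" and bdd: "bounded A"
  defines "V \<equiv> measure lborel A"
    and "W \<equiv> (LINT x:A|lborel. f x)" and "Q \<equiv> (LINT x:A|lborel. (f x)\<^sup>2)"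
  shows "(\<integral>\<^sup>+x. (\<integral>\<^sup>+z. indicator A x * indicator A z * ennreal ((f x - f z)\<^sup>2) \<partial>lborel) \<partial>lborel)
    + ennreal (2 * W\<^sup>2) = ennreal (2 * V * Q)"
proof -
  have [measurable]: "f \<in> borel_measurable borel"
    using f by (rule borel_measurable_continuous_onI)
  have si: "set_integrable lborel A g" if "continuous_on UNIV g" for g :: "'a \<Rightarrow> real"
    using that bdd by (rule continuous_set_integrable_bounded) simp
  have i1: "set_integrable lborel A f" and i2: "set_integrable lborel A (\<lambda>x. (f x)\<^sup>2)"
    and i3: "set_integrable lborel A (\<lambda>x. c)" for c :: real
    using f by (auto intro!: si continuous_intros)
  have cc: "(LINT x:A|lborel. c) = V * c" for c :: real
    using fin by (simp add: V_def set_lebesgue_integral_def mult.commute)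
  note nn = nn_set_integral_eq[where M = lborel and A = A]
  have inner: "(LINT z:A|lborel. (f x - f z)\<^sup>2) = V * (f x)\<^sup>2 - 2 * f x * W + Q" for x
  proof -
    have "(LINT z:A|lborel. (f x - f z)\<^sup>2) = (LINT z:A|lborel. ((f x)\<^sup>2 - (2 * f x) * f z) + (f z)\<^sup>2)"
      by (simp add: power2_diff algebra_simps)
    also have "\<dots> = V * (f x)\<^sup>2 - 2 * f x * W + Q"
      using i1 i2 i3 by (simp add: set_integral_add set_integral_diff cc W_def Q_def)
    finally show ?thesis .
  qed
  have int: "set_integrable lborel A (\<lambda>z. (f x - f z)\<^sup>2)" for x
    using f by (intro si continuous_intros)
  have pos: "0 \<le> V * (f x)\<^sup>2 - 2 * f x * W + Q" for x
    unfolding inner[symmetric] set_lebesgue_integral_def by (intro integral_nonneg_AE) auto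
  have tot: "(LINT x:A|lborel. V * (f x)\<^sup>2 - 2 * f x * W + Q) = 2 * V * Q - 2 * W\<^sup>2"
  proof -
    have "(LINT x:A|lborel. V * (f x)\<^sup>2 - 2 * f x * W + Q) = (LINT x:A|lborel. (V * (f x)\<^sup>2 - (2 * W) * f x) + Q)"
      by (simp add: algebra_simps)
    also have "\<dots> = 2 * V * Q - 2 * W\<^sup>2"
      using i1 i2 i3 by (simp add: set_integral_add set_integral_diff cc W_def[symmetric] Q_def[symmetric] power2_eq_square[of W])
    finally show ?thesis .
  qed
  have "(\<integral>\<^sup>+x. (\<integral>\<^sup>+z. indicator A x * indicator A z * ennreal ((f x - f z)\<^sup>2) \<partial>lborel) \<partial>lborel)
    = (\<integral>\<^sup>+x. indicator A x * (\<integral>\<^sup>+z. indicator A z * ennreal ((f x - f z)\<^sup>2) \<partial>lborel) \<partial>lborel)"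
    by (simp add: mult.assoc nn_integral_cmult)
  also have "\<dots> = (\<integral>\<^sup>+x. indicator A x * ennreal (V * (f x)\<^sup>2 - 2 * f x * W + Q) \<partial>lborel)"
    by (subst nn) (auto simp: int inner)
  also have "\<dots> = ennreal (LINT x:A|lborel. V * (f x)\<^sup>2 - 2 * f x * W + Q)"
    using pos f by (intro nn si continuous_intros) auto
  also note tot
  finally have *: "(\<integral>\<^sup>+x. (\<integral>\<^sup>+z. indicator A x * indicator A z * ennreal ((f x - f z)\<^sup>2) \<partial>lborel) \<partial>lborel)
    = ennreal (2 * V * Q - 2 * W\<^sup>2)" .
  have "0 \<le> (LINT x:A|lborel. V * (f x)\<^sup>2 - 2 * f x * W + Q)"
    unfolding set_lebesgue_integral_def using pos by (intro integral_nonneg_AE) auto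
  also note tot
  finally show ?thesis
    unfolding * by (subst ennreal_plus[symmetric]) auto
qed

text \<open>Substituting \<open>z = x + h\<close> turns the double integral into an integral of
  translation differences over a cube of shifts. The cube has volume
  \<open>(2 * \<delta>) ^ d\<close>, and the l^1 bound on the norm gives
  \<open>norm h \<le> d * \<delta>\<close>.\<close>

lemma double_integral_near_diagonal_le:
  fixes f :: "'a::euclidean_space \<Rightarrow> real" and \<delta> :: real
  assumes f: "\<And>x. GDERIV f x :> g x" and g: "continuous_on UNIV g" and \<delta>: "\<delta> > 0"
  shows "(\<integral>\<^sup>+x. (\<integral>\<^sup>+z. indicator (box (- \<delta> *\<^sub>R One) (\<delta> *\<^sub>R One)) (z - x) * ennreal ((f x - f z)\<^sup>2)
      \<partial>lborel) \<partial>lborel)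
    \<le> ennreal ((2 * \<delta>) ^ DIM('a) * (DIM('a) * \<delta>)\<^sup>2) * (\<integral>\<^sup>+x. ennreal ((norm (g x))\<^sup>2) \<partial>lborel)"
proof -
  have "continuous_on UNIV f"
    by (rule GDERIV_imp_continuous[OF f])
  then have [measurable]: "f \<in> borel_measurable borel"
    by (rule borel_measurable_continuous_onI)
  define B where "B = box (- \<delta> *\<^sub>R One) (\<delta> *\<^sub>R One :: 'a)"
  have [measurable]: "B \<in> sets borel" unfolding B_def by simp
  let ?G = "\<integral>\<^sup>+x. ennreal ((norm (g x))\<^sup>2) \<partial>lborel"
  have nb: "norm h \<le> real DIM('a) * \<delta>" if "h \<in> B" for h
  proof -
    have "norm h \<le> (\<Sum>i\<in>Basis. \<bar>h \<bullet> i\<bar>)" by (rule norm_le_l1)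
    also have "\<dots> \<le> (\<Sum>i\<in>(Basis::'a set). \<delta>)"
    proof (rule sum_mono)
      fix i :: 'a assume i: "i \<in> Basis"
      show "\<bar>h \<bullet> i\<bar> \<le> \<delta>"
        using that i unfolding B_def mem_box by (auto simp: inner_simps dest!: bspec[OF _ i])
    qed
    finally show ?thesis by simp
  qed
  have "(\<integral>\<^sup>+x. (\<integral>\<^sup>+z. indicator B (z - x) * ennreal ((f x - f z)\<^sup>2) \<partial>lborel) \<partial>lborel)
    = (\<integral>\<^sup>+x. (\<integral>\<^sup>+h. indicator B h * ennreal ((f x - f (x + h))\<^sup>2) \<partial>lborel) \<partial>lborel)"
  proof (rule nn_integral_cong)
    fix x
    have "(\<integral>\<^sup>+h. indicator B (h + x - x) * ennreal ((f x - f (h + x))\<^sup>2) \<partial>lborel)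
      = (\<integral>\<^sup>+z. indicator B (z - x) * ennreal ((f x - f z)\<^sup>2) \<partial>lborel)"
      by (rule nn_integral_lborel_translate) measurable
    then show "(\<integral>\<^sup>+z. indicator B (z - x) * ennreal ((f x - f z)\<^sup>2) \<partial>lborel)
      = (\<integral>\<^sup>+h. indicator B h * ennreal ((f x - f (x + h))\<^sup>2) \<partial>lborel)"
      by (simp add: add.commute)
  qed
  also have "\<dots> = (\<integral>\<^sup>+h. (\<integral>\<^sup>+x. indicator B h * ennreal ((f x - f (x + h))\<^sup>2) \<partial>lborel) \<partial>lborel)"
    by (rule lborel_pair.Fubini') measurable
  also have "\<dots> \<le> (\<integral>\<^sup>+h. indicator B h * (ennreal ((DIM('a) * \<delta>)\<^sup>2) * ?G) \<partial>(lborel :: 'a measure))"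
  proof (rule nn_integral_mono)
    fix h :: 'a
    have "(\<integral>\<^sup>+x. indicator B h * ennreal ((f x - f (x + h))\<^sup>2) \<partial>lborel)
      = indicator B h * (\<integral>\<^sup>+x. ennreal ((f (x + h) - f x)\<^sup>2) \<partial>lborel)"
      by (subst nn_integral_cmult) (auto simp: power2_commute)
    also have "\<dots> \<le> indicator B h * (ennreal ((norm h)\<^sup>2) * ?G)"
      by (intro mult_left_mono translation_estimate f g) auto
    also have "\<dots> \<le> indicator B h * (ennreal ((DIM('a) * \<delta>)\<^sup>2) * ?G)"
      using nb[of h] by (auto split: split_indicator intro!: mult_right_mono ennreal_leI power_mono)
    finally show "(\<integral>\<^sup>+x. indicator B h * ennreal ((f x - f (x + h))\<^sup>2) \<partial>lborel) \<le> \<dots>" .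
  qed
  also have "\<dots> = emeasure lborel B * (ennreal ((DIM('a) * \<delta>)\<^sup>2) * ?G)"
    by (simp add: nn_integral_multc)
  also have "emeasure lborel B = ennreal ((2 * \<delta>) ^ DIM('a))"
    unfolding B_def using \<delta> by (subst emeasure_lborel_box) (auto simp: inner_simps)
  finally show ?thesis
    unfolding B_def using \<delta> by (simp add: ennreal_mult' mult.assoc)
qed

text \<open>The variance identity is applied in each cell that meets \<open>D\<close>. Division by
  \<open>2 * \<delta> ^ d\<close> leaves a multiple of \<open>\<delta>^2\<close> in front of the
  gradient norm, so up to finitely many cell integrals the function is controlled by an arbitrarily
  small multiple of its gradient. Cells may stick out of \<open>D\<close>; this is harmless, since
  \<open>f\<close> lives on the whole space and vanishes off \<open>D\<close>.\<close>

lemma grid_inequality: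
  fixes f :: "'a::euclidean_space \<Rightarrow> real" and \<delta> :: real
  assumes f: "\<And>x. GDERIV f x :> g x" and g: "continuous_on UNIV g" and \<delta>: "\<delta> > 0"
    and D: "bounded D" and f0: "\<And>x. x \<notin> D \<Longrightarrow> f x = 0"
  shows "ennreal (2 * \<delta> ^ DIM('a)) * (\<integral>\<^sup>+x. ennreal ((f x)\<^sup>2) \<partial>lborel)
    \<le> ennreal ((2 * \<delta>) ^ DIM('a) * (DIM('a) * \<delta>)\<^sup>2) * (\<integral>\<^sup>+x. ennreal ((norm (g x))\<^sup>2) \<partial>lborel)
      + ennreal (\<Sum>p\<in>grid_point \<delta> ` D. 2 * (LINT x:grid_cell \<delta> p|lborel. f x)\<^sup>2)"
proof -
  have fc: "continuous_on UNIV f"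
    by (rule GDERIV_imp_continuous[OF f])
  then have [measurable]: "f \<in> borel_measurable borel"
    by (rule borel_measurable_continuous_onI)
  define P where "P = grid_point \<delta> ` D"
  have fP: "finite P" unfolding P_def by (rule finite_grid_points[OF \<delta> D])
  define c where "c = 2 * \<delta> ^ DIM('a)"
  have c0: "0 \<le> c" using \<delta> by (simp add: c_def)
  define W where "W p = 2 * (LINT x:grid_cell \<delta> p|lborel. f x)\<^sup>2" for p
  define I where "I p = (\<integral>\<^sup>+x. (\<integral>\<^sup>+z. indicator (grid_cell \<delta> p) x * indicator (grid_cell \<delta> p) z *
     ennreal ((f x - f z)\<^sup>2) \<partial>lborel) \<partial>lborel)" for p
  have cell: "ennreal c * (\<integral>\<^sup>+x. indicator (grid_cell \<delta> p) x * ennreal ((f x)\<^sup>2) \<partial>lborel) \<le> I p + ennreal (W p)"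
    if p: "p \<in> P" for p
  proof -
    define Q where "Q = (LINT x:grid_cell \<delta> p|lborel. (f x)\<^sup>2)"
    have si: "set_integrable lborel (grid_cell \<delta> p) (\<lambda>x. (f x)\<^sup>2)"
      by (intro continuous_set_integrable_bounded continuous_intros fc bounded_grid_cell[OF \<delta>]) simp
    have eq: "(\<integral>\<^sup>+x. indicator (grid_cell \<delta> p) x * ennreal ((f x)\<^sup>2) \<partial>lborel) = ennreal Q"
      unfolding Q_def using si by (rule nn_set_integral_eq) simp
    have Q0: "0 \<le> Q" unfolding Q_def set_lebesgue_integral_def by (intro integral_nonneg_AE) auto
    have "ennreal c * ennreal Q = ennreal (c * Q)" using c0 by (simp add: ennreal_mult')
    also have "\<dots> \<le> ennreal (2 * measure lborel (grid_cell \<delta> p) * Q)"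
      using measure_grid_cell(2)[OF \<delta>, of p] p Q0 unfolding c_def P_def
      by (intro ennreal_leI mult_right_mono) auto
    also have "\<dots> = I p + ennreal (W p)"
      unfolding I_def W_def Q_def
      by (rule variance_identity[symmetric]) (auto intro!: measure_grid_cell(1)[OF \<delta>, simplified] fc bounded_grid_cell[OF \<delta>])
    finally show ?thesis unfolding eq .
  qed
  have "(\<integral>\<^sup>+x. ennreal ((f x)\<^sup>2) \<partial>lborel) \<le>
    (\<integral>\<^sup>+x. (\<Sum>p\<in>P. indicator (grid_cell \<delta> p) x * ennreal ((f x)\<^sup>2)) \<partial>lborel)"
  proof (rule nn_integral_mono)
    fix x
    show "ennreal ((f x)\<^sup>2) \<le> (\<Sum>p\<in>P. indicator (grid_cell \<delta> p) x * ennreal ((f x)\<^sup>2))"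
    proof (cases "x \<in> D")
      case True
      then have "grid_point \<delta> x \<in> P" by (simp add: P_def)
      then have "indicator (grid_cell \<delta> (grid_point \<delta> x)) x * ennreal ((f x)\<^sup>2)
         \<le> (\<Sum>p\<in>P. indicator (grid_cell \<delta> p) x * ennreal ((f x)\<^sup>2))"
        using fP by (intro member_le_sum) auto
      then show ?thesis by (simp add: grid_cell_def)
    qed (simp add: f0)
  qed
  also have "\<dots> = (\<Sum>p\<in>P. (\<integral>\<^sup>+x. indicator (grid_cell \<delta> p) x * ennreal ((f x)\<^sup>2) \<partial>lborel))"
    by (rule nn_integral_sum) measurable
  finally have "ennreal c * (\<integral>\<^sup>+x. ennreal ((f x)\<^sup>2) \<partial>lborel) \<le>
    ennreal c * (\<Sum>p\<in>P. (\<integral>\<^sup>+x. indicator (grid_cell \<delta> p) x * ennreal ((f x)\<^sup>2) \<partial>lborel))"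
    by (intro mult_left_mono) auto
  also have "\<dots> \<le> (\<Sum>p\<in>P. I p + ennreal (W p))"
    unfolding sum_distrib_left by (intro sum_mono cell)
  also have "\<dots> = (\<Sum>p\<in>P. I p) + ennreal (\<Sum>p\<in>P. W p)"
    unfolding sum.distrib by (subst sum_ennreal) (auto simp: W_def)
  also have "(\<Sum>p\<in>P. I p) \<le> ennreal ((2 * \<delta>) ^ DIM('a) * (DIM('a) * \<delta>)\<^sup>2) *
      (\<integral>\<^sup>+x. ennreal ((norm (g x))\<^sup>2) \<partial>lborel)"
  proof -
    have "(\<Sum>p\<in>P. I p) = (\<integral>\<^sup>+x. (\<Sum>p\<in>P. (\<integral>\<^sup>+z. indicator (grid_cell \<delta> p) x * indicator (grid_cell \<delta> p) z *
        ennreal ((f x - f z)\<^sup>2) \<partial>lborel)) \<partial>lborel)"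
      unfolding I_def by (subst nn_integral_sum) measurable
    also have "\<dots> = (\<integral>\<^sup>+x. (\<integral>\<^sup>+z. (\<Sum>p\<in>P. indicator (grid_cell \<delta> p) x * indicator (grid_cell \<delta> p) z *
        ennreal ((f x - f z)\<^sup>2)) \<partial>lborel) \<partial>lborel)"
      by (subst nn_integral_sum) measurable
    \<comment> \<open>At most one cell contains both points, and then \<open>z - x\<close> lies in
      the open cube of half width \<open>\<delta>\<close>; all cell squares together thus fit into
      one strip around the diagonal.\<close>
    also have "\<dots> \<le> (\<integral>\<^sup>+x. (\<integral>\<^sup>+z. indicator (box (- \<delta> *\<^sub>R One) (\<delta> *\<^sub>R One)) (z - x) *
        ennreal ((f x - f z)\<^sup>2) \<partial>lborel) \<partial>lborel)"
    proof (intro nn_integral_mono)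
      fix x z :: 'a
      show "(\<Sum>p\<in>P. indicator (grid_cell \<delta> p) x * indicator (grid_cell \<delta> p) z * ennreal ((f x - f z)\<^sup>2))
        \<le> indicator (box (- \<delta> *\<^sub>R One) (\<delta> *\<^sub>R One)) (z - x) * ennreal ((f x - f z)\<^sup>2)"
      proof (cases "grid_point \<delta> x = grid_point \<delta> z")
        case True
        have "z - x \<in> box (- \<delta> *\<^sub>R One) (\<delta> *\<^sub>R One)"
          unfolding mem_box
        proof
          fix i :: 'a assume i: "i \<in> Basis"
          show "(- \<delta> *\<^sub>R One) \<bullet> i < (z - x) \<bullet> i \<and> (z - x) \<bullet> i < (\<delta> *\<^sub>R One) \<bullet> i"
            using grid_point_bounds[OF \<delta> i, of x] grid_point_bounds[OF \<delta> i, of z] True i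
            by (auto simp: inner_simps)
        qed
        have "(\<Sum>p\<in>P. indicator (grid_cell \<delta> p) x * indicator (grid_cell \<delta> p) z * ennreal ((f x - f z)\<^sup>2))
          \<le> (\<Sum>p\<in>P. if p = grid_point \<delta> x then ennreal ((f x - f z)\<^sup>2) else 0)"
          by (intro sum_mono) (auto simp: grid_cell_def split: split_indicator)
        also have "\<dots> \<le> ennreal ((f x - f z)\<^sup>2)"
          using fP by (simp add: sum.delta)
        finally have "(\<Sum>p\<in>P. indicator (grid_cell \<delta> p) x * indicator (grid_cell \<delta> p) z * ennreal ((f x - f z)\<^sup>2))
          \<le> ennreal ((f x - f z)\<^sup>2)" .
        with \<open>z - x \<in> _\<close> show ?thesis by simp
      next
        case False
        then have "(\<Sum>p\<in>P. indicator (grid_cell \<delta> p) x * indicator (grid_cell \<delta> p) z * ennreal ((f x - f z)\<^sup>2)) = 0"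
          by (intro sum.neutral) (auto simp: grid_cell_def split: split_indicator)
        then show ?thesis by simp
      qed
    qed
    also note double_integral_near_diagonal_le[OF f g \<delta>]
    finally show ?thesis .
  qed
  finally show ?thesis unfolding c_def W_def P_def by (simp add: add_right_mono)
qed

section \<open>Test functions and their gradients on a domain\<close>

lemma L2_iff_square_integrable: "L2 D f \<longleftrightarrow> square_integrable (lebesgue_on D) f"
  by (simp add: L2_def square_integrable_def)

lemma GDERIV_unique:
  fixes f :: "'a::euclidean_space \<Rightarrow> real"
  assumes "GDERIV f x :> a" "GDERIV f x :> b"
  shows "a = b"
proof -
  have "(\<lambda>h. h \<bullet> a) = (\<lambda>h. h \<bullet> b)"
    using assms unfolding gderiv_def by (intro has_derivative_unique[where f = f and x = x]) (auto simp: inner_commute)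
  then have "(a - b) \<bullet> a = (a - b) \<bullet> b" by (rule fun_cong)
  then have "(a - b) \<bullet> (a - b) = 0" by (simp add: inner_diff_right)
  then show ?thesis by simp
qed

text \<open>Continuity is known only for the gradient that \<open>cont_diff\<close> provides;
  uniqueness of gradients identifies it with the given \<open>d\<phi>\<close>.\<close>

lemma test_function_gradient_continuous:
  assumes "test_function D \<phi>" and d: "\<And>x. GDERIV \<phi> x :> d\<phi> x"
  shows "continuous_on UNIV d\<phi>"
proof -
  have "cont_diff (Suc 0) \<phi>" using assms by (simp add: test_function_def)
  then obtain g where g: "\<And>x. GDERIV \<phi> x :> g x" and c: "\<And>i. i \<in> Basis \<Longrightarrow> continuous_on UNIV (\<lambda>x. g x \<bullet> i)"
    by auto
  have "g = d\<phi>" using GDERIV_unique[OF g d] by auto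
  with c show ?thesis by (auto intro: continuous_on_componentwise[THEN iffD2])
qed

lemma test_function_zero:
  assumes "test_function D \<phi>" "x \<notin> D"
  shows "\<phi> x = 0"
  using assms closure_subset[of "{x. \<phi> x \<noteq> 0}"] by (auto simp: test_function_def)

text \<open>Off its support \<open>\<phi>\<close> coincides with the zero function on an open set,
  which determines the gradient there.\<close>

lemma test_function_gradient_zero:
  assumes t: "test_function D \<phi>" and d: "\<And>x. GDERIV \<phi> x :> d\<phi> x"
    and x: "x \<notin> closure {x. \<phi> x \<noteq> 0}"
  shows "d\<phi> x = 0"
proof -
  have "((\<lambda>x. 0) has_derivative (\<lambda>h. h \<bullet> d\<phi> x)) (at x)"
    using d[of x] unfolding gderiv_def inner_commute[of "d\<phi> x"]
    by (rule has_derivative_transform_within_open[where s = "- closure {x. \<phi> x \<noteq> 0}"])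
      (use x closure_subset[of "{x. \<phi> x \<noteq> 0}"] in auto)
  then have "GDERIV (\<lambda>x. 0) x :> d\<phi> x" unfolding gderiv_def by (simp add: inner_commute)
  then show ?thesis using GDERIV_unique GDERIV_const by blast
qed

text \<open>The bridge between two settings: translation and Tonelli arguments take place on
  \<open>lborel\<close>, Sobolev norms on \<open>lebesgue_on D\<close>.\<close>

lemma nn_integral_lebesgue_on_eq_lborel:
  fixes f :: "'a::euclidean_space \<Rightarrow> ennreal"
  assumes "f \<in> borel_measurable borel" "D \<in> sets lebesgue" "\<And>x. x \<notin> D \<Longrightarrow> f x = 0"
  shows "(\<integral>\<^sup>+x. f x \<partial>lebesgue_on D) = (\<integral>\<^sup>+x. f x \<partial>lborel)"
proof -
  have "(\<integral>\<^sup>+x. f x \<partial>lebesgue_on D) = (\<integral>\<^sup>+x. f x * indicator D x \<partial>lebesgue)"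
    using assms by (intro nn_integral_restrict_space) simp
  also have "\<dots> = (\<integral>\<^sup>+x. f x \<partial>lebesgue)"
    using assms by (intro nn_integral_cong) (auto split: split_indicator)
  also have "\<dots> = (\<integral>\<^sup>+x. f x \<partial>lborel)" by (rule nn_integral_completion)
  finally show ?thesis .
qed

lemma continuous_compact_support_square_integrable:
  fixes f :: "'a::euclidean_space \<Rightarrow> 'b::euclidean_space"
  assumes c: "continuous_on UNIV f" and K: "compact K" "K \<subseteq> D" and D: "D \<in> sets lebesgue"
    and z: "\<And>x. x \<notin> K \<Longrightarrow> f x = 0"
  shows "square_integrable (lebesgue_on D) f"
    and "(\<integral>\<^sup>+x. ennreal ((norm (f x))\<^sup>2) \<partial>lborel) = ennreal (sqnorm (lebesgue_on D) f)"
proof -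
  have [measurable]: "f \<in> borel_measurable borel" using c by (rule borel_measurable_continuous_onI)
  have m: "f \<in> borel_measurable (lebesgue_on D)"
    by (intro measurable_restrict_space1 measurable_completion) simp
  have "integrable lborel (\<lambda>x. indicator K x *\<^sub>R (norm (f x))\<^sup>2)"
    using K c by (intro borel_integrable_compact continuous_intros) (auto intro: continuous_on_subset)
  then have "integrable lborel (\<lambda>x. (norm (f x))\<^sup>2)"
    by (rule Bochner_Integration.integrable_bound) (auto simp: z split: split_indicator)
  then have fin: "(\<integral>\<^sup>+x. ennreal ((norm (f x))\<^sup>2) \<partial>lborel) < \<infinity>"
    by (simp add: integrable_iff_bounded)
  have eq: "(\<integral>\<^sup>+x. ennreal ((norm (f x))\<^sup>2) \<partial>lebesgue_on D) = (\<integral>\<^sup>+x. ennreal ((norm (f x))\<^sup>2) \<partial>lborel)"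
    using z K D by (intro nn_integral_lebesgue_on_eq_lborel) auto
  show si: "square_integrable (lebesgue_on D) f"
    unfolding square_integrable_def using m fin eq by (auto intro!: integrableI_bounded)
  show "(\<integral>\<^sup>+x. ennreal ((norm (f x))\<^sup>2) \<partial>lborel) = ennreal (sqnorm (lebesgue_on D) f)"
    unfolding eq[symmetric] sqnorm_def
    using si by (intro nn_integral_eq_integral) (auto simp: square_integrable_def)
qed

lemma
  assumes t: "test_function D \<phi>" and d: "\<And>x. GDERIV \<phi> x :> d\<phi> x" and D: "open D"
  shows test_function_square_integrable: "square_integrable (lebesgue_on D) \<phi>"
    and test_function_gradient_square_integrable: "square_integrable (lebesgue_on D) d\<phi>"
proof -
  let ?K = "closure {x. \<phi> x \<noteq> 0}"
  have K: "compact ?K" "?K \<subseteq> D" using t by (auto simp: test_function_def)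
  have Dl: "D \<in> sets lebesgue" using D by auto
  show "square_integrable (lebesgue_on D) \<phi>"
    using closure_subset[of "{x. \<phi> x \<noteq> 0}"]
    by (intro continuous_compact_support_square_integrable(1)[OF GDERIV_imp_continuous[OF d] K Dl]) auto
  show "square_integrable (lebesgue_on D) d\<phi>"
    by (intro continuous_compact_support_square_integrable(1)[OF test_function_gradient_continuous[OF t d] K Dl]
        test_function_gradient_zero[OF t d])
qed

text \<open>This is \<open>grid_inequality\<close> for a difference of test functions. Compact
  support makes every term finite, which permits the passage from extended reals to reals.\<close>

lemma test_function_grid_inequality:
  fixes \<phi> \<psi> :: "'a::euclidean_space \<Rightarrow> real" and \<delta> :: real
  assumes D: "open D" "bounded D" and \<delta>: "\<delta> > 0"
    and t: "test_function D \<phi>" "test_function D \<psi>"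
    and d: "\<And>x. GDERIV \<phi> x :> d\<phi> x" "\<And>x. GDERIV \<psi> x :> d\<psi> x"
  defines "M \<equiv> lebesgue_on D"
  shows "2 * \<delta> ^ DIM('a) * sqnorm M (\<lambda>x. \<phi> x - \<psi> x) \<le>
    (2 * \<delta>) ^ DIM('a) * (DIM('a) * \<delta>)\<^sup>2 * sqnorm M (\<lambda>x. d\<phi> x - d\<psi> x)
    + (\<Sum>p\<in>grid_point \<delta> ` D. 2 * ((LINT x:grid_cell \<delta> p|lborel. \<phi> x) - (LINT x:grid_cell \<delta> p|lborel. \<psi> x))\<^sup>2)"
proof -
  define K where "K = closure {x. \<phi> x \<noteq> 0} \<union> closure {x. \<psi> x \<noteq> 0}"
  have K: "compact K" "K \<subseteq> D" using t by (auto simp: test_function_def K_def)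
  have Dl: "D \<in> sets lebesgue" using D by auto
  have c: "continuous_on UNIV \<phi>" "continuous_on UNIV \<psi>" "continuous_on UNIV d\<phi>" "continuous_on UNIV d\<psi>"
    using GDERIV_imp_continuous[OF d(1)] GDERIV_imp_continuous[OF d(2)]
      test_function_gradient_continuous[OF t(1) d(1)] test_function_gradient_continuous[OF t(2) d(2)] by auto
  have "x \<notin> K \<Longrightarrow> \<phi> x - \<psi> x = 0" for x
    using subsetD[OF closure_subset, of x "{x. \<phi> x \<noteq> 0}"] subsetD[OF closure_subset, of x "{x. \<psi> x \<noteq> 0}"]
    unfolding K_def by (cases "\<phi> x = 0"; cases "\<psi> x = 0") auto
  then have e1: "(\<integral>\<^sup>+x. ennreal ((\<phi> x - \<psi> x)\<^sup>2) \<partial>lborel) = ennreal (sqnorm M (\<lambda>x. \<phi> x - \<psi> x))"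
    using continuous_compact_support_square_integrable(2)[of "\<lambda>x. \<phi> x - \<psi> x", OF _ K Dl] c
    unfolding M_def by (auto intro: continuous_intros)
  have "x \<notin> K \<Longrightarrow> d\<phi> x - d\<psi> x = 0" for x
    using test_function_gradient_zero[OF t(1) d(1), of x] test_function_gradient_zero[OF t(2) d(2), of x]
    unfolding K_def by auto
  then have e2: "(\<integral>\<^sup>+x. ennreal ((norm (d\<phi> x - d\<psi> x))\<^sup>2) \<partial>lborel) = ennreal (sqnorm M (\<lambda>x. d\<phi> x - d\<psi> x))"
    using continuous_compact_support_square_integrable(2)[of "\<lambda>x. d\<phi> x - d\<psi> x", OF _ K Dl] c
    unfolding M_def by (auto intro: continuous_intros)
  have si: "set_integrable lborel (grid_cell \<delta> p) g" if "continuous_on UNIV g" for g :: "'a \<Rightarrow> real" and p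
    using that bounded_grid_cell[OF \<delta>] by (rule continuous_set_integrable_bounded) simp
  have W: "(LINT x:grid_cell \<delta> p|lborel. \<phi> x - \<psi> x) =
    (LINT x:grid_cell \<delta> p|lborel. \<phi> x) - (LINT x:grid_cell \<delta> p|lborel. \<psi> x)" for p
    using si c by (intro set_integral_diff) auto
  have "ennreal (2 * \<delta> ^ DIM('a)) * (\<integral>\<^sup>+x. ennreal ((\<phi> x - \<psi> x)\<^sup>2) \<partial>lborel)
    \<le> ennreal ((2 * \<delta>) ^ DIM('a) * (DIM('a) * \<delta>)\<^sup>2) * (\<integral>\<^sup>+x. ennreal ((norm (d\<phi> x - d\<psi> x))\<^sup>2) \<partial>lborel)
      + ennreal (\<Sum>p\<in>grid_point \<delta> ` D. 2 * (LINT x:grid_cell \<delta> p|lborel. \<phi> x - \<psi> x)\<^sup>2)"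
  proof (rule grid_inequality)
    show "GDERIV (\<lambda>x. \<phi> x - \<psi> x) x :> d\<phi> x - d\<psi> x" for x
      using d by (intro GDERIV_diff)
    show "x \<notin> D \<Longrightarrow> \<phi> x - \<psi> x = 0" for x
      by (simp add: test_function_zero[OF t(1)] test_function_zero[OF t(2)])
  qed (use c D \<delta> in \<open>auto intro: continuous_intros\<close>)
  then have "ennreal (2 * \<delta> ^ DIM('a) * sqnorm M (\<lambda>x. \<phi> x - \<psi> x)) \<le>
    ennreal ((2 * \<delta>) ^ DIM('a) * (DIM('a) * \<delta>)\<^sup>2 * sqnorm M (\<lambda>x. d\<phi> x - d\<psi> x)
      + (\<Sum>p\<in>grid_point \<delta> ` D. 2 * (LINT x:grid_cell \<delta> p|lborel. \<phi> x - \<psi> x)\<^sup>2))"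
    unfolding e1 e2 using \<delta> by (simp add: ennreal_mult sum_nonneg)
  then show ?thesis
    unfolding W using \<delta> by (subst (asm) ennreal_le_iff) (auto intro!: add_nonneg_nonneg sum_nonneg)
qed

section \<open>Rellich's theorem\<close>

lemma convergent_subsequence_finite_family:
  fixes w :: "'p \<Rightarrow> nat \<Rightarrow> real"
  assumes "finite P" "\<And>p. p \<in> P \<Longrightarrow> bounded (range (w p))"
  shows "\<exists>r. strict_mono r \<and> (\<forall>p\<in>P. convergent (w p \<circ> r))"
  using assms
proof (induction P rule: finite_induct)
  case empty
  then show ?case by (auto intro: exI[of _ id] strict_mono_id)
next
  case (insert q P)
  then have "\<exists>r. strict_mono r \<and> (\<forall>p\<in>P. convergent (w p \<circ> r))" by blast
  then obtain r where r: "strict_mono r" "\<And>p. p \<in> P \<Longrightarrow> convergent (w p \<circ> r)" by blast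
  have "bounded (range (w q \<circ> r))"
    using insert.prems[of q] by (auto intro: bounded_subset)
  then obtain l s where s: "strict_mono s" "((w q \<circ> r) \<circ> s) \<longlonglongrightarrow> l"
    using bounded_imp_convergent_subsequence by blast
  \<comment> \<open>The members treated earlier keep converging along the thinner
    subsequence.\<close>
  have "convergent (w p \<circ> (r \<circ> s))" if "p \<in> insert q P" for p
    using that r(2)[of p] s convergent_subseq_convergent[of "w p \<circ> r" s]
    by (auto simp: o_assoc convergent_def)
  then show ?case using strict_mono_o[OF r(1) s(1)] by blast
qed

lemma H10_grad_square_integrable:
  assumes "H10_grad D u g"
  shows "square_integrable (lebesgue_on D) u" "square_integrable (lebesgue_on D) g"
  using assms by (auto simp: H10_grad_def L2_iff_square_integrable)

lemma H10_grad_iff: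
  "H10_grad D u g \<longleftrightarrow> square_integrable (lebesgue_on D) u \<and> square_integrable (lebesgue_on D) g \<and>
     (\<exists>\<phi> d\<phi>. (\<forall>n. test_function D (\<phi> n) \<and> (\<forall>x. GDERIV (\<phi> n) x :> d\<phi> n x)) \<and>
        (\<lambda>n. sqnorm (lebesgue_on D) (\<lambda>x. \<phi> n x - u x)) \<longlonglongrightarrow> 0 \<and>
        (\<lambda>n. sqnorm (lebesgue_on D) (\<lambda>x. d\<phi> n x - g x)) \<longlonglongrightarrow> 0)"
  by (simp add: H10_grad_def L2_iff_square_integrable sqnorm_def)

text \<open>The epsilon form of the sequential definition. Together with its converse
  \<open>H10_gradI\<close> it spares later arguments the handling of approximating
  sequences.\<close>

lemma H10_grad_approx:
  assumes H: "H10_grad D u g" and e: "e > 0"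
  obtains \<phi> d\<phi> where "test_function D \<phi>" "\<And>x. GDERIV \<phi> x :> d\<phi> x"
    "sqnorm (lebesgue_on D) (\<lambda>x. \<phi> x - u x) < e" "sqnorm (lebesgue_on D) (\<lambda>x. d\<phi> x - g x) < e"
proof -
  obtain \<phi> d\<phi> where *: "\<And>n::nat. test_function D (\<phi> n)" "\<And>n x. GDERIV (\<phi> n) x :> d\<phi> n x"
    and l: "(\<lambda>n. sqnorm (lebesgue_on D) (\<lambda>x. \<phi> n x - u x)) \<longlonglongrightarrow> 0"
       "(\<lambda>n. sqnorm (lebesgue_on D) (\<lambda>x. d\<phi> n x - g x)) \<longlonglongrightarrow> 0"
    using H unfolding H10_grad_iff by blast
  have "eventually (\<lambda>n. sqnorm (lebesgue_on D) (\<lambda>x. \<phi> n x - u x) < e \<and>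
      sqnorm (lebesgue_on D) (\<lambda>x. d\<phi> n x - g x) < e) sequentially"
    using order_tendstoD(2)[OF l(1) e] order_tendstoD(2)[OF l(2) e] by eventually_elim auto
  then obtain n where "sqnorm (lebesgue_on D) (\<lambda>x. \<phi> n x - u x) < e"
      "sqnorm (lebesgue_on D) (\<lambda>x. d\<phi> n x - g x) < e" by (auto simp: eventually_sequentially)
  with * show ?thesis by (intro that[of "\<phi> n" "d\<phi> n"])
qed

text \<open>For a fixed tolerance, a fine grid makes the gradient part small, and the finitely many
  bounded cell integrals have a common convergent subsequence. This gives closeness up to that
  tolerance only, so a diagonal sequence over the tolerances \<open>1 / real (Suc k)\<close> is
  taken.\<close>

lemma test_function_gradients_compact:
  fixes \<phi> :: "nat \<Rightarrow> 'a::euclidean_space \<Rightarrow> real"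
  assumes D: "open D" "bounded D"
    and t: "\<And>n. test_function D (\<phi> n)" and d: "\<And>n x. GDERIV (\<phi> n) x :> d\<phi> n x"
    and B: "\<And>n. sqnorm (lebesgue_on D) (\<phi> n) \<le> B" "\<And>n. sqnorm (lebesgue_on D) (d\<phi> n) \<le> B"
  obtains r :: "nat \<Rightarrow> nat" where "strict_mono r"
    "\<And>e. e > 0 \<Longrightarrow> \<exists>N. \<forall>m\<ge>N. \<forall>n\<ge>N. sqnorm (lebesgue_on D) (\<lambda>x. \<phi> (r m) x - \<phi> (r n) x) < e"
proof -
  define M where "M = lebesgue_on D"
  note B' = B[folded M_def]
  have Dl: "D \<in> sets lebesgue" using D by auto
  have s: "square_integrable M (\<phi> n)" "square_integrable M (d\<phi> n)" for n
    using test_function_square_integrable[OF t d D(1)] test_function_gradient_square_integrable[OF t d D(1)]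
    unfolding M_def by auto
  have B0: "0 \<le> B" using B(1)[of 0] sqnorm_nonneg order_trans by blast
  have sub: "\<exists>r' :: nat \<Rightarrow> nat. strict_mono r' \<and> (\<exists>N. \<forall>m\<ge>N. \<forall>n\<ge>N.
      sqnorm M (\<lambda>x. \<phi> (q (r' m)) x - \<phi> (q (r' n)) x) < e)"
    if e: "e > 0" for q :: "nat \<Rightarrow> nat" and e
  proof -
    define d where "d = real DIM('a)"
    have d0: "d > 0" by (simp add: d_def)
    \<comment> \<open>Chosen so that the gradient term of the grid inequality is at most
      \<open>\<delta> ^ d * (C * \<delta>^2)\<close>; the factor \<open>4 * B\<close> bounds the
      squared norm of a difference of two gradients.\<close>
    define C where "C = 2 ^ DIM('a) * d\<^sup>2 * (4 * B)"
    have C0: "0 \<le> C" using B0 by (simp add: C_def)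
    obtain \<delta> where \<delta>: "\<delta> > 0" "C * \<delta>\<^sup>2 < e"
    proof
      define \<delta> where "\<delta> = sqrt (e / (C + 1))"
      show "\<delta> > 0" using e C0 by (simp add: \<delta>_def)
      have "C * \<delta>\<^sup>2 = (C / (C + 1)) * e" using e C0 by (simp add: \<delta>_def)
      also have "\<dots> < 1 * e" using e C0 by (intro mult_strict_right_mono) (auto simp: divide_simps)
      finally show "C * \<delta>\<^sup>2 < e" by simp
    qed
    define P where "P = grid_point \<delta> ` D"
    have fP: "finite P" unfolding P_def by (rule finite_grid_points[OF \<delta>(1) D(2)])
    define w where "w p n = (LINT x:grid_cell \<delta> p|lborel. \<phi> (q n) x)" for p n
    have wb: "bounded (range (w p))" for p
    proof -
      have [measurable]: "\<phi> n \<in> borel_measurable borel" for n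
        using GDERIV_imp_continuous[OF d] by (rule borel_measurable_continuous_onI)
      have iq: "integrable lborel (\<lambda>x. (\<phi> n x)\<^sup>2)" and eq: "(LINT x|lborel. (\<phi> n x)\<^sup>2) = sqnorm M (\<phi> n)" for n
      proof -
        have "(\<integral>\<^sup>+x. ennreal ((norm (\<phi> n x))\<^sup>2) \<partial>lborel) = ennreal (sqnorm M (\<phi> n))"
          unfolding M_def
        proof (rule continuous_compact_support_square_integrable(2)[OF GDERIV_imp_continuous[OF d] _ _ Dl])
          show "compact (closure {x. \<phi> n x \<noteq> 0})" "closure {x. \<phi> n x \<noteq> 0} \<subseteq> D"
            using t[of n] by (auto simp: test_function_def)
          show "x \<notin> closure {x. \<phi> n x \<noteq> 0} \<Longrightarrow> \<phi> n x = 0" for x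
            using closure_subset[of "{x. \<phi> n x \<noteq> 0}"] by auto
        qed
        then have "has_bochner_integral lborel (\<lambda>x. (\<phi> n x)\<^sup>2) (sqnorm M (\<phi> n))"
          by (intro has_bochner_integral_nn_integral) auto
        then show "integrable lborel (\<lambda>x. (\<phi> n x)\<^sup>2)" "(LINT x|lborel. (\<phi> n x)\<^sup>2) = sqnorm M (\<phi> n)"
          by (auto simp: has_bochner_integral_iff)
      qed
      \<comment> \<open>Since \<open>|s| \<le> 1 + s^2\<close>, an L^2 bound controls the integral
        over a cell of finite volume.\<close>
      have "\<bar>w p n\<bar> \<le> measure lborel (grid_cell \<delta> p) + B" for n
      proof -
        have ii: "integrable lborel (indicator (grid_cell \<delta> p) :: 'a \<Rightarrow> real)"
          using measure_grid_cell(1)[OF \<delta>(1), of p] by (intro integrable_real_indicator) auto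
        have "\<bar>w p n\<bar> \<le> (LINT x|lborel. \<bar>indicator (grid_cell \<delta> p) x *\<^sub>R \<phi> (q n) x\<bar>)"
          unfolding w_def set_lebesgue_integral_def by (rule integral_abs_bound)
        also have "\<dots> \<le> (LINT x|lborel. indicator (grid_cell \<delta> p) x + (\<phi> (q n) x)\<^sup>2)"
        proof (rule integral_mono_AE')
          show "AE x in lborel. \<bar>indicator (grid_cell \<delta> p) x *\<^sub>R \<phi> (q n) x\<bar> \<le> indicator (grid_cell \<delta> p) x + (\<phi> (q n) x)\<^sup>2"
          proof (rule AE_I2)
            fix x
            have "0 \<le> (\<bar>\<phi> (q n) x\<bar> - 1)\<^sup>2" by simp
            then have "2 * \<bar>\<phi> (q n) x\<bar> \<le> 1 + (\<phi> (q n) x)\<^sup>2" by (simp add: power2_diff)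
            then have "\<bar>\<phi> (q n) x\<bar> \<le> 1 + (\<phi> (q n) x)\<^sup>2" by linarith
            then show "\<bar>indicator (grid_cell \<delta> p) x *\<^sub>R \<phi> (q n) x\<bar> \<le> indicator (grid_cell \<delta> p) x + (\<phi> (q n) x)\<^sup>2"
              by (simp split: split_indicator)
          qed
        qed (use ii iq in auto)
        also have "\<dots> = measure lborel (grid_cell \<delta> p) + sqnorm M (\<phi> (q n))"
          using ii iq by (simp add: eq)
        finally show ?thesis using B'(1)[of "q n"] by simp
      qed
      then show ?thesis by (auto simp: bounded_iff)
    qed
    obtain r' where r': "strict_mono r'" "\<And>p. p \<in> P \<Longrightarrow> convergent (w p \<circ> r')"
      using convergent_subsequence_finite_family[OF fP, of w] wb by blast
    \<comment> \<open>The cell terms, \<open>2 * \<epsilon>\<close> each, together stay below twice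
      the slack \<open>(e - C * \<delta>^2) * \<delta> ^ d\<close>, so that the whole right-hand
      side falls below \<open>2 * \<delta> ^ d * e\<close>. The \<open>+ 1\<close> makes the
      comparison strict.\<close>
    define \<epsilon> where "\<epsilon> = (e - C * \<delta>\<^sup>2) * \<delta> ^ DIM('a) / (real (card P) + 1)"
    have \<epsilon>: "\<epsilon> > 0" using \<delta> by (simp add: \<epsilon>_def)
    have "\<exists>N. \<forall>m\<ge>N. \<forall>n\<ge>N. \<forall>p\<in>P. (w p (r' m) - w p (r' n))\<^sup>2 < \<epsilon>"
    proof -
      have "\<exists>N. \<forall>m\<ge>N. \<forall>n\<ge>N. (w p (r' m) - w p (r' n))\<^sup>2 < \<epsilon>" if "p \<in> P" for p
      proof -
        have "Cauchy (w p \<circ> r')" using r'(2)[OF that] by (rule convergent_Cauchy)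
        then obtain N where N: "\<forall>m\<ge>N. \<forall>n\<ge>N. dist (w p (r' m)) (w p (r' n)) < sqrt \<epsilon>"
          unfolding Cauchy_def using \<epsilon> by (auto dest!: spec[of _ "sqrt \<epsilon>"])
        have "(w p (r' m) - w p (r' n))\<^sup>2 < \<epsilon>" if "m \<ge> N" "n \<ge> N" for m n
        proof -
          have "\<bar>w p (r' m) - w p (r' n)\<bar> < sqrt \<epsilon>" using N that by (auto simp: dist_real_def)
          then have "\<bar>w p (r' m) - w p (r' n)\<bar>\<^sup>2 < (sqrt \<epsilon>)\<^sup>2" by (intro power_strict_mono) auto
          then show ?thesis using \<epsilon> by simp
        qed
        then show ?thesis by blast
      qed
      then obtain N where N: "\<And>p m n. p \<in> P \<Longrightarrow> m \<ge> N p \<Longrightarrow> n \<ge> N p \<Longrightarrow> (w p (r' m) - w p (r' n))\<^sup>2 < \<epsilon>"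
        by metis
      have "N p \<le> (\<Sum>p\<in>P. N p)" if "p \<in> P" for p using fP that by (intro member_le_sum) auto
      then show ?thesis using N by (intro exI[of _ "\<Sum>p\<in>P. N p"]) (meson order_trans)
    qed
    then obtain N where N: "\<And>m n p. m \<ge> N \<Longrightarrow> n \<ge> N \<Longrightarrow> p \<in> P \<Longrightarrow> (w p (r' m) - w p (r' n))\<^sup>2 < \<epsilon>"
      by blast
    have "sqnorm M (\<lambda>x. \<phi> (q (r' m)) x - \<phi> (q (r' n)) x) < e" if mn: "m \<ge> N" "n \<ge> N" for m n
    proof -
      let ?m = "q (r' m)" and ?n = "q (r' n)"
      have dd: "sqnorm M (\<lambda>x. d\<phi> ?m x - d\<phi> ?n x) \<le> 4 * B"
        using sqnorm_add_le[OF s(2) square_integrable_scale[OF s(2)], of ?m "-1" ?n]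
          B'(2)[of ?m] B'(2)[of ?n] by (simp add: sqnorm_def)
      have "2 * \<delta> ^ DIM('a) * sqnorm M (\<lambda>x. \<phi> ?m x - \<phi> ?n x) \<le>
        (2 * \<delta>) ^ DIM('a) * (d * \<delta>)\<^sup>2 * sqnorm M (\<lambda>x. d\<phi> ?m x - d\<phi> ?n x)
        + (\<Sum>p\<in>P. 2 * (w p (r' m) - w p (r' n))\<^sup>2)"
        unfolding w_def M_def P_def d_def using test_function_grid_inequality[OF D \<delta>(1) t t d d] by simp
      also have "\<dots> \<le> (2 * \<delta>) ^ DIM('a) * (d * \<delta>)\<^sup>2 * (4 * B) + (\<Sum>p\<in>P. 2 * \<epsilon>)"
        using dd N[OF mn] \<delta> by (intro add_mono mult_left_mono sum_mono) (auto intro: less_imp_le)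
      also have "\<dots> = \<delta> ^ DIM('a) * (C * \<delta>\<^sup>2) + 2 * (real (card P) * \<epsilon>)"
        by (simp add: C_def power_mult_distrib mult_ac)
      also have "\<dots> < \<delta> ^ DIM('a) * (C * \<delta>\<^sup>2) + 2 * ((e - C * \<delta>\<^sup>2) * \<delta> ^ DIM('a))"
      proof -
        have "real (card P) * \<epsilon> < (real (card P) + 1) * \<epsilon>" using \<epsilon> by simp
        also have "\<dots> = (e - C * \<delta>\<^sup>2) * \<delta> ^ DIM('a)"
          unfolding \<epsilon>_def by simp
        finally show ?thesis by simp
      qed
      also have "\<dots> = \<delta> ^ DIM('a) * (2 * e - C * \<delta>\<^sup>2)" by (simp add: algebra_simps)
      also have "\<dots> \<le> \<delta> ^ DIM('a) * (2 * e)" using \<delta> C0 by (intro mult_left_mono) auto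
      finally have "(2 * \<delta> ^ DIM('a)) * sqnorm M (\<lambda>x. \<phi> ?m x - \<phi> ?n x) < (2 * \<delta> ^ DIM('a)) * e"
        by (simp add: mult_ac)
      then show ?thesis using \<delta>(1) by (subst (asm) mult_less_cancel_left_pos) auto
    qed
    then show ?thesis using r'(1) by blast
  qed
  define Pr where "Pr k q \<longleftrightarrow> (\<exists>N. \<forall>m\<ge>N. \<forall>n\<ge>N.
      sqnorm M (\<lambda>x. \<phi> (q m) x - \<phi> (q n) x) < 1 / real (Suc k))" for k and q :: "nat \<Rightarrow> nat"
  interpret subseqs Pr
    by unfold_locales (use sub in \<open>auto simp: Pr_def\<close>)
  have "\<exists>N. \<forall>m\<ge>N. \<forall>n\<ge>N. sqnorm M (\<lambda>x. \<phi> (diagseq m) x - \<phi> (diagseq n) x) < e" if "e > 0" for e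
  proof -
    obtain k where k: "1 / real (Suc k) < e" using \<open>e > 0\<close> nat_approx_posE by blast
    \<comment> \<open>From index \<open>Suc k\<close> on, the diagonal sequence runs inside the
      refinement made for tolerance \<open>k\<close>, and \<open>Pr\<close> passes to
      subsequences.\<close>
    have "Pr k (diagseq \<circ> (+) (Suc k))"
    proof (rule diagseq_holds)
      fix r s :: "nat \<Rightarrow> nat" and n
      assume r: "strict_mono r" and "Pr n s"
      then obtain N where "\<forall>m\<ge>N. \<forall>j\<ge>N. sqnorm M (\<lambda>x. \<phi> (s m) x - \<phi> (s j) x) < 1 / real (Suc n)"
        unfolding Pr_def by blast
      moreover have "r m \<ge> N" if "m \<ge> N" for m using seq_suble[OF r, of m] that by simp
      ultimately show "Pr n (s \<circ> r)" unfolding Pr_def by (intro exI[of _ N]) auto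
    qed
    then obtain N where N: "\<And>m n. m \<ge> N \<Longrightarrow> n \<ge> N \<Longrightarrow>
        sqnorm M (\<lambda>x. \<phi> (diagseq (Suc k + m)) x - \<phi> (diagseq (Suc k + n)) x) < 1 / real (Suc k)"
      unfolding Pr_def by auto
    have "sqnorm M (\<lambda>x. \<phi> (diagseq m) x - \<phi> (diagseq n) x) < e" if "m \<ge> Suc k + N" "n \<ge> Suc k + N" for m n
    proof -
      have "N \<le> m - Suc k" "N \<le> n - Suc k" "Suc k \<le> m" "Suc k \<le> n" using that by auto
      with N[of "m - Suc k" "n - Suc k"] k show ?thesis by simp
    qed
    then show ?thesis by blast
  qed
  then show ?thesis
    using subseq_diagseq unfolding M_def by (intro that[of diagseq]) auto
qed

text \<open>Each \<open>v n\<close> is replaced by a test function within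
  \<open>1 / real (Suc n)\<close> in value and in gradient. The errors tend to zero along any
  subsequence, so the Cauchy property carries over to \<open>v\<close>.\<close>

theorem Rellich:
  fixes v :: "nat \<Rightarrow> 'a::euclidean_space \<Rightarrow> real"
  assumes D: "open D" "bounded D" and H: "\<And>n. H10_grad D (v n) (g n)"
    and B: "\<And>n. sqnorm (lebesgue_on D) (v n) \<le> B" "\<And>n. sqnorm (lebesgue_on D) (g n) \<le> B"
  obtains r :: "nat \<Rightarrow> nat" where "strict_mono r"
    "\<And>e. e > 0 \<Longrightarrow> \<exists>N. \<forall>m\<ge>N. \<forall>n\<ge>N. sqnorm (lebesgue_on D) (\<lambda>x. v (r m) x - v (r n) x) < e"
proof -
  define M where "M = lebesgue_on D"
  note s = H10_grad_square_integrable[OF H, folded M_def]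
  have "\<exists>\<phi> d\<phi>. test_function D \<phi> \<and> (\<forall>x. GDERIV \<phi> x :> d\<phi> x) \<and>
    sqnorm M (\<lambda>x. \<phi> x - v n x) < 1 / real (Suc n) \<and> sqnorm M (\<lambda>x. d\<phi> x - g n x) < 1 / real (Suc n)" for n
  proof -
    have "0 < 1 / real (Suc n)" by simp
    from H10_grad_approx[OF H this, of n, folded M_def] show ?thesis by blast
  qed
  from choice[OF allI[OF this]] obtain \<phi> where "\<forall>n. \<exists>d\<phi>. test_function D (\<phi> n) \<and> (\<forall>x. GDERIV (\<phi> n) x :> d\<phi> x) \<and>
    sqnorm M (\<lambda>x. \<phi> n x - v n x) < 1 / real (Suc n) \<and> sqnorm M (\<lambda>x. d\<phi> x - g n x) < 1 / real (Suc n)" ..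
  from choice[OF this] obtain d\<phi> where t: "\<And>n. test_function D (\<phi> n)" and d: "\<And>n x. GDERIV (\<phi> n) x :> d\<phi> n x"
    and a: "\<And>n. sqnorm M (\<lambda>x. \<phi> n x - v n x) < 1 / real (Suc n)" "\<And>n. sqnorm M (\<lambda>x. d\<phi> n x - g n x) < 1 / real (Suc n)"
    by blast
  have st: "square_integrable M (\<phi> n)" "square_integrable M (d\<phi> n)" for n
    using test_function_square_integrable[OF t d D(1)] test_function_gradient_square_integrable[OF t d D(1)]
    unfolding M_def by auto
  have le1: "1 / real (Suc n) \<le> 1" for n
    by (simp add: divide_le_eq)
  have b1: "sqnorm M (\<phi> n) \<le> 2 * 1 + 2 * B" for n
    using sqnorm_add_le[OF square_integrable_diff[OF st(1)[of n] s(1)[of n]] s(1)[of n]] less_le_trans[OF a(1) le1, of n]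
      B(1)[of n, folded M_def] by simp
  have b2: "sqnorm M (d\<phi> n) \<le> 2 * 1 + 2 * B" for n
    using sqnorm_add_le[OF square_integrable_diff[OF st(2)[of n] s(2)[of n]] s(2)[of n]] less_le_trans[OF a(2) le1, of n]
      B(2)[of n, folded M_def] by simp
  obtain r :: "nat \<Rightarrow> nat" where r: "strict_mono r"
    and c: "\<And>e. e > 0 \<Longrightarrow> \<exists>N. \<forall>m\<ge>N. \<forall>n\<ge>N. sqnorm M (\<lambda>x. \<phi> (r m) x - \<phi> (r n) x) < e"
    by (rule test_function_gradients_compact[OF D t d b1[unfolded M_def] b2[unfolded M_def], folded M_def])
      (assumption | rule that)+
  have "\<exists>N. \<forall>m\<ge>N. \<forall>n\<ge>N. sqnorm M (\<lambda>x. v (r m) x - v (r n) x) < e" if e: "e > 0" for e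
  proof -
    \<comment> \<open>Two triangle inequalities with factor 2 are used in succession: the total is
      at most \<open>2/16 + 4/16 + 4/16\<close> times \<open>e\<close>.\<close>
    obtain N1 where N1: "\<And>m n. m \<ge> N1 \<Longrightarrow> n \<ge> N1 \<Longrightarrow> sqnorm M (\<lambda>x. \<phi> (r m) x - \<phi> (r n) x) < e / 16"
      using c[of "e / 16"] e by auto
    obtain k where k: "1 / real (Suc k) < e / 16" using nat_approx_posE[of "e / 16"] e by auto
    have "sqnorm M (\<lambda>x. v (r m) x - v (r n) x) < e" if mn: "m \<ge> max N1 k" "n \<ge> max N1 k" for m n
    proof -
      have small: "sqnorm M (\<lambda>x. \<phi> (r j) x - v (r j) x) < e / 16" if "j \<ge> k" for j
      proof -
        have "j \<le> r j" using seq_suble[OF r] .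
        then have "1 / real (Suc (r j)) \<le> 1 / real (Suc k)" using that by (intro divide_left_mono) auto
        then show ?thesis using a(1)[of "r j"] k by linarith
      qed
      have "sqnorm M (\<lambda>x. v (r m) x - v (r n) x)
        \<le> 2 * sqnorm M (\<lambda>x. v (r m) x - \<phi> (r m) x) + 2 * sqnorm M (\<lambda>x. \<phi> (r m) x - v (r n) x)"
        by (intro sqnorm_triangle s st)
      also have "sqnorm M (\<lambda>x. \<phi> (r m) x - v (r n) x)
        \<le> 2 * sqnorm M (\<lambda>x. \<phi> (r m) x - \<phi> (r n) x) + 2 * sqnorm M (\<lambda>x. \<phi> (r n) x - v (r n) x)"
        by (intro sqnorm_triangle s st)
      also have "sqnorm M (\<lambda>x. v (r m) x - \<phi> (r m) x) = sqnorm M (\<lambda>x. \<phi> (r m) x - v (r m) x)"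
        by (rule sqnorm_minus_commute)
      finally show ?thesis using small[of m] small[of n] N1[of m n] mn e by simp
    qed
    then show ?thesis by blast
  qed
  then show ?thesis using r unfolding M_def by (rule that[rotated])
qed

section \<open>Minimisation of the Rayleigh quotient\<close>

lemma cont_diff_add_scale:
  fixes f g :: "'a::euclidean_space \<Rightarrow> real"
  assumes "cont_diff k f" "cont_diff k g"
  shows "cont_diff k (\<lambda>x. f x + t * g x)"
  using assms
proof (induction k arbitrary: f g)
  case 0
  then show ?case by (auto intro!: continuous_intros)
next
  case (Suc k)
  from Suc.prems(1) obtain f' where f: "\<forall>x. GDERIV f x :> f' x" "\<forall>i\<in>Basis. cont_diff k (\<lambda>x. f' x \<bullet> i)"
    by auto
  from Suc.prems(2) obtain g' where g: "\<forall>x. GDERIV g x :> g' x" "\<forall>i\<in>Basis. cont_diff k (\<lambda>x. g' x \<bullet> i)"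
    by auto
  have "GDERIV (\<lambda>x. f x + t * g x) x :> f' x + t *\<^sub>R g' x" for x
    using GDERIV_add[OF f(1)[rule_format] GDERIV_mult[OF GDERIV_const g(1)[rule_format]]] by simp
  moreover have "cont_diff k (\<lambda>x. (f' x + t *\<^sub>R g' x) \<bullet> i)" if "i \<in> Basis" for i
    using Suc.IH[OF f(2)[rule_format, OF that] g(2)[rule_format, OF that]] by (simp add: inner_simps)
  ultimately show ?case by (auto intro!: exI[of _ "\<lambda>x. f' x + t *\<^sub>R g' x"])
qed

lemma test_function_add_scale:
  assumes "test_function D f" "test_function D g"
  shows "test_function D (\<lambda>x. f x + t * g x)"
proof -
  have sub: "closure {x. f x + t * g x \<noteq> 0} \<subseteq> closure {x. f x \<noteq> 0} \<union> closure {x. g x \<noteq> 0}"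
    unfolding closure_Un[symmetric] by (intro closure_mono) auto
  have "compact (closure {x. f x \<noteq> 0} \<union> closure {x. g x \<noteq> 0})"
    using assms by (auto simp: test_function_def)
  then have "compact (closure {x. f x + t * g x \<noteq> 0})"
    using sub by (metis compact_Int_closed closed_closure Int_absorb1)
  then show ?thesis
    using assms sub cont_diff_add_scale unfolding test_function_def by blast
qed

lemma tendsto_zero_of_inverse_bound:
  assumes "\<And>n. 0 \<le> f n" "\<And>n. f n < 1 / real (Suc n)"
  shows "f \<longlonglongrightarrow> 0"
  by (rule tendsto_sandwich[OF _ _ tendsto_const LIMSEQ_inverse_real_of_nat])
    (use assms in \<open>auto intro!: always_eventually less_imp_le simp: inverse_eq_divide\<close>)

lemma H10_gradI:
  assumes s: "square_integrable (lebesgue_on D) u" "square_integrable (lebesgue_on D) g"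
    and a: "\<And>e. e > 0 \<Longrightarrow> \<exists>\<phi> d\<phi>. test_function D \<phi> \<and> (\<forall>x. GDERIV \<phi> x :> d\<phi> x) \<and>
      sqnorm (lebesgue_on D) (\<lambda>x. \<phi> x - u x) < e \<and> sqnorm (lebesgue_on D) (\<lambda>x. d\<phi> x - g x) < e"
  shows "H10_grad D u g"
proof -
  define M where "M = lebesgue_on D"
  have "\<exists>\<phi> d\<phi>. test_function D \<phi> \<and> (\<forall>x. GDERIV \<phi> x :> d\<phi> x) \<and>
      sqnorm M (\<lambda>x. \<phi> x - u x) < 1 / real (Suc n) \<and> sqnorm M (\<lambda>x. d\<phi> x - g x) < 1 / real (Suc n)" for n
    unfolding M_def by (rule a) simp
  from choice[OF allI[OF this]] obtain \<phi> where
    "\<forall>n. \<exists>d\<phi>. test_function D (\<phi> n) \<and> (\<forall>x. GDERIV (\<phi> n) x :> d\<phi> x) \<and>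
      sqnorm M (\<lambda>x. \<phi> n x - u x) < 1 / real (Suc n) \<and> sqnorm M (\<lambda>x. d\<phi> x - g x) < 1 / real (Suc n)" ..
  from choice[OF this] obtain d\<phi> where *:
    "\<forall>n. test_function D (\<phi> n) \<and> (\<forall>x. GDERIV (\<phi> n) x :> d\<phi> n x) \<and>
      sqnorm M (\<lambda>x. \<phi> n x - u x) < 1 / real (Suc n) \<and> sqnorm M (\<lambda>x. d\<phi> n x - g x) < 1 / real (Suc n)" ..
  have "(\<lambda>n. sqnorm M (\<lambda>x. \<phi> n x - u x)) \<longlonglongrightarrow> 0" "(\<lambda>n. sqnorm M (\<lambda>x. d\<phi> n x - g x)) \<longlonglongrightarrow> 0"
    using * by (auto intro!: tendsto_zero_of_inverse_bound)
  with * s show ?thesis unfolding H10_grad_iff M_def by blast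
qed

lemma H10_grad_add_scale:
  assumes D: "open D" and u: "H10_grad D u g" and v: "H10_grad D v w"
  shows "H10_grad D (\<lambda>x. u x + t * v x) (\<lambda>x. g x + t *\<^sub>R w x)"
proof -
  define M where "M = lebesgue_on D"
  note s = H10_grad_square_integrable[OF u, folded M_def] H10_grad_square_integrable[OF v, folded M_def]
  have s1: "square_integrable M (\<lambda>x. u x + t * v x)"
    using square_integrable_add[OF s(1) square_integrable_scale[OF s(3), of t]] by simp
  have s2: "square_integrable M (\<lambda>x. g x + t *\<^sub>R w x)"
    using square_integrable_add[OF s(2) square_integrable_scale[OF s(4), of t]] by simp
  show ?thesis
  proof (rule H10_gradI[OF s1[unfolded M_def] s2[unfolded M_def]], unfold M_def[symmetric])
    fix e :: real assume e: "e > 0"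
    \<comment> \<open>The total of the factors lost by \<open>sqnorm_add_le\<close> and by scaling
      with \<open>t\<close>; two approximations within \<open>e / c\<close> therefore combine to
      \<open>e\<close>.\<close>
    define c where "c = 2 + 2 * t\<^sup>2"
    have c: "c > 0" unfolding c_def by (simp add: add_pos_nonneg)
    then have ec: "0 < e / c" using e by simp
    obtain \<phi> d\<phi> where p: "test_function D \<phi>" "\<And>x. GDERIV \<phi> x :> d\<phi> x"
      "sqnorm M (\<lambda>x. \<phi> x - u x) < e / c" "sqnorm M (\<lambda>x. d\<phi> x - g x) < e / c"
      using H10_grad_approx[OF u ec] unfolding M_def by blast
    obtain \<psi> d\<psi> where q: "test_function D \<psi>" "\<And>x. GDERIV \<psi> x :> d\<psi> x"
      "sqnorm M (\<lambda>x. \<psi> x - v x) < e / c" "sqnorm M (\<lambda>x. d\<psi> x - w x) < e / c"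
      using H10_grad_approx[OF v ec] unfolding M_def by blast
    have si: "square_integrable M \<phi>" "square_integrable M d\<phi>" "square_integrable M \<psi>" "square_integrable M d\<psi>"
      using test_function_square_integrable[OF p(1,2) D] test_function_gradient_square_integrable[OF p(1,2) D]
        test_function_square_integrable[OF q(1,2) D] test_function_gradient_square_integrable[OF q(1,2) D]
      unfolding M_def by auto
    have fin: "2 * a + 2 * (t\<^sup>2 * b) < e" if "a < e / c" "b < e / c" for a b :: real
    proof -
      have "2 * a + 2 * (t\<^sup>2 * b) < 2 * (e / c) + 2 * (t\<^sup>2 * (e / c))"
        using that by (intro add_less_le_mono mult_left_mono mult_strict_left_mono) auto
      also have "\<dots> = c * (e / c)" by (simp only: c_def distrib_right mult.assoc)
      finally show ?thesis using c by simp
    qed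
    have "sqnorm M (\<lambda>x. (\<phi> x - u x) + t *\<^sub>R (\<psi> x - v x)) \<le>
      2 * sqnorm M (\<lambda>x. \<phi> x - u x) + 2 * (t\<^sup>2 * sqnorm M (\<lambda>x. \<psi> x - v x))"
      unfolding sqnorm_scale[symmetric]
      by (intro sqnorm_add_le square_integrable_diff square_integrable_scale si s)
    also have "\<dots> < e" by (intro fin p q)
    also have "(\<lambda>x. (\<phi> x - u x) + t *\<^sub>R (\<psi> x - v x)) = (\<lambda>x. (\<phi> x + t * \<psi> x) - (u x + t * v x))"
      by (auto simp: algebra_simps)
    finally have 1: "sqnorm M (\<lambda>x. (\<phi> x + t * \<psi> x) - (u x + t * v x)) < e" .
    have "sqnorm M (\<lambda>x. (d\<phi> x - g x) + t *\<^sub>R (d\<psi> x - w x)) \<le>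
      2 * sqnorm M (\<lambda>x. d\<phi> x - g x) + 2 * (t\<^sup>2 * sqnorm M (\<lambda>x. d\<psi> x - w x))"
      unfolding sqnorm_scale[symmetric]
      by (intro sqnorm_add_le square_integrable_diff square_integrable_scale si s)
    also have "\<dots> < e" by (intro fin p q)
    also have "(\<lambda>x. (d\<phi> x - g x) + t *\<^sub>R (d\<psi> x - w x)) = (\<lambda>x. (d\<phi> x + t *\<^sub>R d\<psi> x) - (g x + t *\<^sub>R w x))"
      by (auto simp: algebra_simps)
    finally have 2: "sqnorm M (\<lambda>x. (d\<phi> x + t *\<^sub>R d\<psi> x) - (g x + t *\<^sub>R w x)) < e" .
    have GD: "GDERIV (\<lambda>x. \<phi> x + t * \<psi> x) x :> d\<phi> x + t *\<^sub>R d\<psi> x" for x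
      using GDERIV_add[OF p(2) GDERIV_mult[OF GDERIV_const q(2)]] by simp
        show "\<exists>\<phi> d\<phi>. test_function D \<phi> \<and> (\<forall>x. GDERIV \<phi> x :> d\<phi> x) \<and>
      sqnorm M (\<lambda>x. \<phi> x - (u x + t * v x)) < e \<and> sqnorm M (\<lambda>x. d\<phi> x - (g x + t *\<^sub>R w x)) < e"
      by (intro exI[of _ "\<lambda>x. \<phi> x + t * \<psi> x"] exI[of _ "\<lambda>x. d\<phi> x + t *\<^sub>R d\<psi> x"] conjI allI GD 1 2
          test_function_add_scale p q)
  qed
qed

text \<open>One late pair \<open>(v n, g n)\<close> is approximated by a test function; the
  tolerance \<open>e / 4\<close> absorbs the doubling in \<open>sqnorm_triangle\<close>.\<close>

lemma H10_grad_closed: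
  assumes D: "open D" and v: "\<And>n. H10_grad D (v n) (g n)"
    and s: "square_integrable (lebesgue_on D) u" "square_integrable (lebesgue_on D) w"
    and l: "(\<lambda>n. sqnorm (lebesgue_on D) (\<lambda>x. v n x - u x)) \<longlonglongrightarrow> 0"
      "(\<lambda>n. sqnorm (lebesgue_on D) (\<lambda>x. g n x - w x)) \<longlonglongrightarrow> 0"
  shows "H10_grad D u w"
proof (rule H10_gradI[OF s])
  fix e :: real assume e: "e > 0"
  define M where "M = lebesgue_on D"
  note sv = H10_grad_square_integrable[OF v, folded M_def] and s = s[folded M_def] and l = l[folded M_def]
  have e4: "e / 4 > 0" using e by simp
  have "eventually (\<lambda>n. sqnorm M (\<lambda>x. v n x - u x) < e / 4 \<and> sqnorm M (\<lambda>x. g n x - w x) < e / 4) sequentially"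
    using order_tendstoD(2)[OF l(1) e4] order_tendstoD(2)[OF l(2) e4] by eventually_elim auto
  then obtain n where n: "sqnorm M (\<lambda>x. v n x - u x) < e / 4" "sqnorm M (\<lambda>x. g n x - w x) < e / 4"
    by (auto simp: eventually_sequentially)
  obtain \<phi> d\<phi> where p: "test_function D \<phi>" "\<And>x. GDERIV \<phi> x :> d\<phi> x"
    "sqnorm M (\<lambda>x. \<phi> x - v n x) < e / 4" "sqnorm M (\<lambda>x. d\<phi> x - g n x) < e / 4"
    using H10_grad_approx[OF v e4] unfolding M_def by blast
  have si: "square_integrable M \<phi>" "square_integrable M d\<phi>"
    using test_function_square_integrable[OF p(1,2) D] test_function_gradient_square_integrable[OF p(1,2) D]
    unfolding M_def by auto
  have "sqnorm M (\<lambda>x. \<phi> x - u x) < e"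
    using sqnorm_triangle[OF si(1) sv(1)[of n] s(1)] n p by linarith
  moreover have "sqnorm M (\<lambda>x. d\<phi> x - w x) < e"
    using sqnorm_triangle[OF si(2) sv(2)[of n] s(2)] n p by linarith
  ultimately show "\<exists>\<phi> d\<phi>. test_function D \<phi> \<and> (\<forall>x. GDERIV \<phi> x :> d\<phi> x) \<and>
      sqnorm (lebesgue_on D) (\<lambda>x. \<phi> x - u x) < e \<and> sqnorm (lebesgue_on D) (\<lambda>x. d\<phi> x - w x) < e"
    using p(1,2) unfolding M_def by blast
qed

section \<open>The energy and mass forms\<close>

lemma sqnorm_cong_AE:
  assumes "AE x in M. f x = g x" "f \<in> borel_measurable M" "g \<in> borel_measurable M"
  shows "sqnorm M f = sqnorm M g"
  unfolding sqnorm_def using assms by (intro integral_cong_AE) auto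

lemma weighted_square_expand:
  fixes f h :: "'a \<Rightarrow> 'b::euclidean_space" and t :: real
  assumes f: "square_integrable M f" and h: "square_integrable M h"
    and A: "A \<in> borel_measurable M" "AE x in M. \<bar>A x\<bar> \<le> (K::real)"
  shows "(LINT x|M. A x * (norm (f x + t *\<^sub>R h x))\<^sup>2) =
    (LINT x|M. A x * (norm (f x))\<^sup>2) + 2 * t * (LINT x|M. A x * (f x \<bullet> h x)) + t\<^sup>2 * (LINT x|M. A x * (norm (h x))\<^sup>2)"
proof -
  note i = integrable_weighted_square[OF f A] integrable_weighted_inner[OF f h A] integrable_weighted_square[OF h A]
  have "(LINT x|M. A x * (norm (f x + t *\<^sub>R h x))\<^sup>2) =
    (LINT x|M. (A x * (norm (f x))\<^sup>2 + (2 * t) * (A x * (f x \<bullet> h x))) + t\<^sup>2 * (A x * (norm (h x))\<^sup>2))"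
    by (intro Bochner_Integration.integral_cong refl)
      (simp add: power2_norm_eq_inner inner_add_left inner_add_right inner_commute power2_eq_square[of t] algebra_simps)
  also have "\<dots> = (LINT x|M. A x * (norm (f x))\<^sup>2) + 2 * t * (LINT x|M. A x * (f x \<bullet> h x)) + t\<^sup>2 * (LINT x|M. A x * (norm (h x))\<^sup>2)"
    using i by simp
  finally show ?thesis .
qed

text \<open>If \<open>p\<close> were nonzero, then at \<open>t = - p / s\<close> with
  \<open>s = |q| + 1\<close> the expression would be at most \<open>- p^2 / s\<close>.\<close>

lemma linear_coefficient_zero:
  fixes p q :: real
  assumes "\<And>t. 0 \<le> 2 * t * p + t\<^sup>2 * q"
  shows "p = 0"
proof (rule ccontr)
  assume p: "p \<noteq> 0"
  define s where "s = \<bar>q\<bar> + 1"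
  have s: "s > 0" "q \<le> s" by (auto simp: s_def)
  have "0 \<le> 2 * (- p / s) * p + (- p / s)\<^sup>2 * q" by (rule assms)
  also have "\<dots> \<le> 2 * (- p / s) * p + (- p / s)\<^sup>2 * s"
    using s by (intro add_left_mono mult_left_mono) auto
  also have "\<dots> = - (p\<^sup>2 / s)" using s by (simp add: power2_eq_square field_simps)
  also have "\<dots> < 0" using p s by simp
  finally show False by simp
qed

text \<open>The last argument is a pair because \<open>H10_grad\<close> is a relation, which leaves
  the gradient free on null sets.\<close>

definition energy :: "'a::euclidean_space set \<Rightarrow> ('a \<Rightarrow> real) \<Rightarrow> ('a \<Rightarrow> real) \<Rightarrow> ('a \<Rightarrow> real) \<times> ('a \<Rightarrow> 'a) \<Rightarrow> real" where
  "energy D A B = (\<lambda>(v, g). (LINT x|lebesgue_on D. A x * (norm (g x))\<^sup>2) + (LINT x|lebesgue_on D. B x * (v x)\<^sup>2))"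

definition mass :: "'a::euclidean_space set \<Rightarrow> ('a \<Rightarrow> real) \<Rightarrow> ('a \<Rightarrow> real) \<Rightarrow> real" where
  "mass D c v = (LINT x|lebesgue_on D. c x * (v x)\<^sup>2)"

definition unit_states :: "'a::euclidean_space set \<Rightarrow> ('a \<Rightarrow> real) set \<Rightarrow> ('a \<Rightarrow> real) \<Rightarrow> (('a \<Rightarrow> real) \<times> ('a \<Rightarrow> 'a)) set" where
  "unit_states D V c = {(v, g). v \<in> V \<and> H10_grad D v g \<and> mass D c v = 1}"

definition rayleigh_inf :: "'a::euclidean_space set \<Rightarrow> ('a \<Rightarrow> real) set \<Rightarrow> ('a \<Rightarrow> real) \<Rightarrow> ('a \<Rightarrow> real) \<Rightarrow> ('a \<Rightarrow> real) \<Rightarrow> real" where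
  "rayleigh_inf D V c A B = Inf (energy D A B ` unit_states D V c)"

text \<open>In the closedness assumption of a trial space the limit may be changed on a null set, because
  the elements of a finite element space are determined everywhere.\<close>

definition trial_space :: "'a::euclidean_space set \<Rightarrow> ('a \<Rightarrow> real) set \<Rightarrow> bool" where
  "trial_space D V \<longleftrightarrow> V \<subseteq> H10 D \<and> (\<forall>u\<in>V. \<forall>v\<in>V. \<forall>t. (\<lambda>x. u x + t * v x) \<in> V) \<and>
     (\<forall>v u. (\<forall>n. v n \<in> V) \<and> u \<in> H10 D \<and> (\<lambda>n. sqnorm (lebesgue_on D) (\<lambda>x. v n x - u x)) \<longlonglongrightarrow> 0 \<longrightarrow>
        (\<exists>u'\<in>V. AE x in lebesgue_on D. u' x = u x))"

lemma trial_spaceD: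
  assumes "trial_space D V"
  shows "v \<in> V \<Longrightarrow> v \<in> H10 D"
    and "u \<in> V \<Longrightarrow> v \<in> V \<Longrightarrow> (\<lambda>x. u x + t * v x) \<in> V"
    and "(\<And>n. w n \<in> V) \<Longrightarrow> u \<in> H10 D \<Longrightarrow> (\<lambda>n. sqnorm (lebesgue_on D) (\<lambda>x. w n x - u x)) \<longlonglongrightarrow> 0 \<Longrightarrow>
      \<exists>u'\<in>V. AE x in lebesgue_on D. u' x = u x"
  using assms unfolding trial_space_def by blast+

text \<open>In the closedness condition the limit is a member of \<open>H10 D\<close> by assumption
  and serves as its own representative.\<close>

lemma trial_space_H10: "open D \<Longrightarrow> trial_space D (H10 D)"
  unfolding trial_space_def H10_def by (auto intro: H10_grad_add_scale)

text \<open>The bound \<open>k\<close> on \<open>A\<close> controls gradients by the energy, the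
  same bound on \<open>c\<close> controls functions by the mass. The constants \<open>k\<close> and
  \<open>K\<close> stand for \<open>amin\<close> and \<open>amax\<close>.\<close>

locale elliptic_form =
  fixes D :: "'a::euclidean_space set" and c A B :: "'a \<Rightarrow> real" and k K :: real
  assumes D: "open D" "bounded D" and k: "0 < k"
    and mA: "A \<in> borel_measurable (lebesgue_on D)" and mB: "B \<in> borel_measurable (lebesgue_on D)"
    and mc: "c \<in> borel_measurable (lebesgue_on D)"
    and uA: "AE x in lebesgue_on D. \<bar>A x\<bar> \<le> K" and uB: "AE x in lebesgue_on D. \<bar>B x\<bar> \<le> K"
    and uc: "AE x in lebesgue_on D. \<bar>c x\<bar> \<le> K"
    and lA: "AE x in lebesgue_on D. k \<le> A x" and lB: "AE x in lebesgue_on D. 0 \<le> B x"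
    and lc: "AE x in lebesgue_on D. k \<le> c x"
begin

abbreviation "M \<equiv> lebesgue_on D"

lemma energy_bounds:
  assumes "square_integrable M v" "square_integrable M g"
  shows "k * sqnorm M g \<le> energy D A B (v, g)" "0 \<le> energy D A B (v, g)"
    "energy D A B (v, g) \<le> K * (sqnorm M g + sqnorm M v)"
proof -
  have B0: "0 \<le> (LINT x|M. B x * (v x)\<^sup>2)"
    using weighted_square_ge[OF assms(1) mB uB lB] by simp
  show 1: "k * sqnorm M g \<le> energy D A B (v, g)"
    using weighted_square_ge[OF assms(2) mA uA lA] B0 by (simp add: energy_def)
  show "0 \<le> energy D A B (v, g)"
    using order_trans[OF _ 1] k by simp
  show "energy D A B (v, g) \<le> K * (sqnorm M g + sqnorm M v)"
    using weighted_square_le[OF assms(1) mB uB] weighted_square_le[OF assms(2) mA uA]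
    by (simp add: energy_def distrib_left)
qed

lemma mass_bounds:
  assumes "square_integrable M v"
  shows "k * sqnorm M v \<le> mass D c v" "mass D c v \<le> K * sqnorm M v" "0 \<le> mass D c v"
proof -
  show 1: "k * sqnorm M v \<le> mass D c v"
    using weighted_square_ge[OF assms mc uc lc] by (simp add: mass_def)
  show "mass D c v \<le> K * sqnorm M v"
    using weighted_square_le[OF assms mc uc] by (simp add: mass_def)
  show "0 \<le> mass D c v" using order_trans[OF _ 1] k by simp
qed

text \<open>The polar form of the energy, namely the middle coefficient of the energy along a line;
  \<open>mass2\<close> below plays the same part for the mass.\<close>

definition energy2 :: "('a \<Rightarrow> real) \<Rightarrow> ('a \<Rightarrow> 'a) \<Rightarrow> ('a \<Rightarrow> real) \<Rightarrow> ('a \<Rightarrow> 'a) \<Rightarrow> real" where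
  "energy2 u g v w = (LINT x|M. A x * (g x \<bullet> w x)) + (LINT x|M. B x * (u x * v x))"

definition mass2 :: "('a \<Rightarrow> real) \<Rightarrow> ('a \<Rightarrow> real) \<Rightarrow> real" where
  "mass2 u v = (LINT x|M. c x * (u x * v x))"

lemma mass_expand:
  assumes "square_integrable M u" "square_integrable M v"
  shows "mass D c (\<lambda>x. u x + t * v x) = mass D c u + 2 * t * mass2 u v + t\<^sup>2 * mass D c v"
  using weighted_square_expand[OF assms mc uc, of t] by (simp add: mass_def mass2_def)

lemma energy_expand:
  assumes "square_integrable M u" "square_integrable M g" "square_integrable M v" "square_integrable M w"
  shows "energy D A B (\<lambda>x. u x + t * v x, \<lambda>x. g x + t *\<^sub>R w x) =
    energy D A B (u, g) + 2 * t * energy2 u g v w + t\<^sup>2 * energy D A B (v, w)"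
  using weighted_square_expand[OF assms(2,4) mA uA, of t] weighted_square_expand[OF assms(1,3) mB uB, of t]
  by (simp add: energy_def energy2_def algebra_simps)

lemma energy_cong_AE:
  assumes "AE x in M. u x = v x" "square_integrable M u" "square_integrable M v"
  shows "energy D A B (u, g) = energy D A B (v, g)" "mass D c u = mass D c v"
proof -
  have [measurable]: "u \<in> borel_measurable M" "v \<in> borel_measurable M" "B \<in> borel_measurable M" "c \<in> borel_measurable M"
    using assms mB mc by (auto simp: square_integrable_def)
  have "(LINT x|M. B x * (u x)\<^sup>2) = (LINT x|M. B x * (v x)\<^sup>2)"
    using assms(1) by (intro integral_cong_AE) auto
  then show "energy D A B (u, g) = energy D A B (v, g)" by (simp add: energy_def)
  show "mass D c u = mass D c v"
    unfolding mass_def using assms(1) by (intro integral_cong_AE) auto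
qed

lemma energy_nonneg_state:
  assumes "s \<in> unit_states D V c"
  shows "0 \<le> energy D A B s"
proof -
  obtain v g where "s = (v, g)" "H10_grad D v g" using assms by (auto simp: unit_states_def)
  then show ?thesis using energy_bounds(2)[OF H10_grad_square_integrable] by simp
qed

lemma bdd_below_energy: "bdd_below (energy D A B ` unit_states D V c)"
  using energy_nonneg_state by (auto intro!: bdd_belowI[of _ 0])

lemma rayleigh_inf_le: "s \<in> unit_states D V c \<Longrightarrow> rayleigh_inf D V c A B \<le> energy D A B s"
  unfolding rayleigh_inf_def using bdd_below_energy by (intro cInf_lower) auto

lemma rayleigh_inf_nonneg: "unit_states D V c \<noteq> {} \<Longrightarrow> 0 \<le> rayleigh_inf D V c A B"
  unfolding rayleigh_inf_def using energy_nonneg_state by (intro cInf_greatest) auto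

text \<open>Normalising \<open>v\<close> to unit mass gives the homogeneous form of the infimum,
  applicable to sums and perturbations of unit states. For zero mass, nonnegativity of the energy is
  enough.\<close>

lemma rayleigh_inf_mass_le_energy:
  assumes V: "trial_space D V" and ne: "unit_states D V c \<noteq> {}"
    and v: "v \<in> V" "H10_grad D v g"
  shows "rayleigh_inf D V c A B * mass D c v \<le> energy D A B (v, g)"
proof (cases "mass D c v = 0")
  case True
  then show ?thesis using energy_bounds(2) H10_grad_square_integrable[OF v(2)] by simp
next
  case False
  note s = H10_grad_square_integrable[OF v(2)]
  \<comment> \<open>A trial space is only known to contain the combinations
    \<open>u + t * v\<close>: zero is obtained as \<open>v - v\<close>, and the multiple of
    \<open>v\<close> as \<open>0 + t * v\<close>.\<close>
  have z: "(\<lambda>x. 0) \<in> V"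
    using trial_spaceD(2)[OF V v(1) v(1), of "-1"] by simp
  have z': "H10_grad D (\<lambda>x. 0) (\<lambda>x. 0)"
    using H10_grad_add_scale[OF D(1) v(2) v(2), of "-1"] by simp
  have m: "mass D c v > 0" using False mass_bounds(3)[OF s(1)] by simp
  define t where "t = 1 / sqrt (mass D c v)"
  have t: "t\<^sup>2 = 1 / mass D c v" using m by (simp add: t_def power_divide)
  have e0: "energy D A B (\<lambda>x. 0, \<lambda>x. 0) = 0" "mass D c (\<lambda>x. 0) = 0"
    "energy2 (\<lambda>x. 0) (\<lambda>x. 0) v g = 0" "mass2 (\<lambda>x. 0) v = 0"
    by (simp_all add: energy_def mass_def energy2_def mass2_def)
  have "(\<lambda>x. 0 + t * v x, \<lambda>x. 0 + t *\<^sub>R g x) \<in> unit_states D V c"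
    unfolding unit_states_def
    using trial_spaceD(2)[OF V z v(1), of t] H10_grad_add_scale[OF D(1) z' v(2), of t]
      mass_expand[OF H10_grad_square_integrable(1)[OF z'] s(1), of t] m
    by (simp add: e0 t)
  then have "rayleigh_inf D V c A B \<le> energy D A B (\<lambda>x. 0 + t * v x, \<lambda>x. 0 + t *\<^sub>R g x)"
    by (rule rayleigh_inf_le)
  also have "\<dots> = energy D A B (v, g) / mass D c v"
    using energy_expand[OF H10_grad_square_integrable[OF z'] s, of t] by (simp add: e0 t)
  finally show ?thesis using m by (simp add: field_simps)
qed

lemma minimiser_exists:
  assumes V: "trial_space D V" and ne: "unit_states D V c \<noteq> {}"
  obtains s where "s \<in> unit_states D V c" "energy D A B s = rayleigh_inf D V c A B"
proof -
  define \<Lambda> where "\<Lambda> = rayleigh_inf D V c A B"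
  have \<Lambda>0: "0 \<le> \<Lambda>" unfolding \<Lambda>_def by (rule rayleigh_inf_nonneg[OF ne])
  have "\<exists>s. s \<in> unit_states D V c \<and> energy D A B s < \<Lambda> + 1 / real (Suc n)" for n
  proof -
    have "Inf (energy D A B ` unit_states D V c) < \<Lambda> + 1 / real (Suc n)"
      by (simp add: \<Lambda>_def rayleigh_inf_def)
    then show ?thesis
      using ne bdd_below_energy by (subst (asm) cInf_less_iff) auto
  qed
  then have "\<forall>n. \<exists>s. s \<in> unit_states D V c \<and> energy D A B s < \<Lambda> + 1 / real (Suc n)" ..
  from choice[OF this] obtain S where
    S: "\<And>n. S n \<in> unit_states D V c" "\<And>n. energy D A B (S n) < \<Lambda> + 1 / real (Suc n)" by blast
  define v where "v n = fst (S n)" for n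
  define g where "g n = snd (S n)" for n
  have v: "\<And>n. v n \<in> V" "\<And>n. H10_grad D (v n) (g n)" "\<And>n. mass D c (v n) = 1"
    and E: "\<And>n. energy D A B (v n, g n) < \<Lambda> + 1 / real (Suc n)"
    using S unfolding v_def g_def unit_states_def by (force simp: case_prod_beta)+
  note s = H10_grad_square_integrable[OF v(2)]
  have le1: "1 / real (Suc n) \<le> 1" for n by (simp add: divide_le_eq)
  \<comment> \<open>\<open>Rellich\<close> takes one common bound for functions and gradients, so
    the two bounds are added.\<close>
  have b1: "sqnorm M (v n) \<le> (\<Lambda> + 1) / k + 1 / k" for n
  proof -
    have "k * sqnorm M (v n) \<le> 1" using mass_bounds(1)[OF s(1)[of n]] v(3)[of n] by simp
    then have "sqnorm M (v n) \<le> 1 / k" using k by (simp add: field_simps)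
    moreover have "0 \<le> (\<Lambda> + 1) / k" using \<Lambda>0 k by simp
    ultimately show ?thesis by linarith
  qed
  have b2: "sqnorm M (g n) \<le> (\<Lambda> + 1) / k + 1 / k" for n
  proof -
    have "k * sqnorm M (g n) \<le> \<Lambda> + 1"
      using energy_bounds(1)[OF s[of n]] less_le_trans[OF E[of n] add_left_mono[OF le1[of n]]] by linarith
    then have "sqnorm M (g n) \<le> (\<Lambda> + 1) / k" using k by (simp add: field_simps)
    moreover have "0 \<le> 1 / k" using k by simp
    ultimately show ?thesis by linarith
  qed
  obtain r :: "nat \<Rightarrow> nat" where r: "strict_mono r"
    and C: "\<And>e. e > 0 \<Longrightarrow> \<exists>N. \<forall>m\<ge>N. \<forall>n\<ge>N. sqnorm M (\<lambda>x. v (r m) x - v (r n) x) < e"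
    by (rule Rellich[OF D v(2) b1 b2]) (assumption | rule that)+
  have small: "energy D A B (v (r n), g (r n)) < \<Lambda> + 1 / real (Suc n)" for n
  proof -
    have "1 / real (Suc (r n)) \<le> 1 / real (Suc n)"
      using seq_suble[OF r, of n] by (intro divide_left_mono) auto
    then show ?thesis using E[of "r n"] by linarith
  qed
  define K' where "K' = \<bar>K\<bar> + 1"
  have K': "K' > 0" "K \<le> K'" by (auto simp: K'_def)
  text \<open>By the parallelogram identity the energy of a difference is controlled by its mass.\<close>
  have par: "k * sqnorm M (\<lambda>x. g (r m) x - g (r n) x) \<le>
     2 * (1 / real (Suc m)) + 2 * (1 / real (Suc n)) + \<Lambda> * K' * sqnorm M (\<lambda>x. v (r m) x - v (r n) x)" for m n
  proof -
    let ?u = "v (r m)" and ?v = "v (r n)" and ?g = "g (r m)" and ?w = "g (r n)"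
    note e = energy_expand[OF s[of "r m"] s[of "r n"]] and me = mass_expand[OF s(1)[of "r m"] s(1)[of "r n"]]
    have d: "square_integrable M (\<lambda>x. ?u x - ?v x)" "square_integrable M (\<lambda>x. ?g x - ?w x)"
      by (intro square_integrable_diff s)+
    have "\<Lambda> * mass D c (\<lambda>x. ?u x + 1 * ?v x) \<le> energy D A B (\<lambda>x. ?u x + 1 * ?v x, \<lambda>x. ?g x + 1 *\<^sub>R ?w x)"
      unfolding \<Lambda>_def
      by (intro rayleigh_inf_mass_le_energy V ne trial_spaceD(2)[OF V] H10_grad_add_scale D v)
    moreover have "energy D A B (\<lambda>x. ?u x + 1 * ?v x, \<lambda>x. ?g x + 1 *\<^sub>R ?w x) =
      2 * energy D A B (?u, ?g) + 2 * energy D A B (?v, ?w) - energy D A B (\<lambda>x. ?u x - ?v x, \<lambda>x. ?g x - ?w x)"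
      using e[of 1] e[of "-1"] by simp
    moreover have "\<Lambda> * mass D c (\<lambda>x. ?u x + 1 * ?v x) = 4 * \<Lambda> - \<Lambda> * mass D c (\<lambda>x. ?u x - ?v x)"
    proof -
      have "mass D c (\<lambda>x. ?u x + 1 * ?v x) = 4 - mass D c (\<lambda>x. ?u x - ?v x)"
        using me[of 1] me[of "-1"] v(3)[of "r m"] v(3)[of "r n"] by simp
      then show ?thesis by (simp add: right_diff_distrib)
    qed
    moreover have "\<Lambda> * mass D c (\<lambda>x. ?u x - ?v x) \<le> \<Lambda> * K' * sqnorm M (\<lambda>x. ?u x - ?v x)"
      unfolding mult.assoc
      using mass_bounds(2)[OF d(1)] mult_right_mono[OF K'(2) sqnorm_nonneg, of M "\<lambda>x. ?u x - ?v x"] \<Lambda>0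
      by (intro mult_left_mono) linarith+
    ultimately have "energy D A B (\<lambda>x. ?u x - ?v x, \<lambda>x. ?g x - ?w x) \<le>
      2 * energy D A B (?u, ?g) + 2 * energy D A B (?v, ?w) - 4 * \<Lambda> + \<Lambda> * K' * sqnorm M (\<lambda>x. ?u x - ?v x)"
      by linarith
    \<comment> \<open>The two energies exceed \<open>\<Lambda>\<close> by less than
      \<open>1 / real (Suc m)\<close> and \<open>1 / real (Suc n)\<close>, so the multiples of
      \<open>\<Lambda>\<close> cancel.\<close>
    then show ?thesis
      using energy_bounds(1)[OF d] small[of m] small[of n] by linarith
  qed
  have Cg: "\<exists>N. \<forall>m\<ge>N. \<forall>n\<ge>N. sqnorm M (\<lambda>x. g (r m) x - g (r n) x) < e" if e: "e > 0" for e
  proof -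
    \<comment> \<open>Three error terms below a quarter of \<open>k * e\<close> add up to less than
      \<open>k * e\<close>.\<close>
    define f where "f = k * e / 4"
    have f: "f > 0" using k e by (simp add: f_def)
    define q where "q = \<Lambda> * K' + 1"
    have q: "q > 0" using \<Lambda>0 K' by (simp add: q_def add_nonneg_pos)
    obtain N where N: "\<And>m n. m \<ge> N \<Longrightarrow> n \<ge> N \<Longrightarrow> sqnorm M (\<lambda>x. v (r m) x - v (r n) x) < f / q"
      using C[of "f / q"] f q by auto
    obtain j where j: "1 / real (Suc j) < f / 2" using nat_approx_posE[of "f / 2"] f by auto
    have "sqnorm M (\<lambda>x. g (r m) x - g (r n) x) < e" if mn: "m \<ge> max N j" "n \<ge> max N j" for m n
    proof -
      have mj: "i \<ge> j" if "i \<ge> max N j" for i using that by simp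
      have j': "2 * (1 / real (Suc i)) < f" if "i \<ge> j" for i
      proof -
        have "1 / real (Suc i) \<le> 1 / real (Suc j)" using that by (intro divide_left_mono) auto
        with j show ?thesis by linarith
      qed
      have "\<Lambda> * K' * sqnorm M (\<lambda>x. v (r m) x - v (r n) x) \<le> q * sqnorm M (\<lambda>x. v (r m) x - v (r n) x)"
        by (intro mult_right_mono) (auto simp: q_def)
      also have "\<dots> < q * (f / q)" using N[of m n] mn q by (intro mult_strict_left_mono) auto
      also have "\<dots> = f" using q by simp
      finally have "k * sqnorm M (\<lambda>x. g (r m) x - g (r n) x) < f + f + f"
        using par[of m n] j'[OF mj[OF mn(1)]]
        j'[OF mj[OF mn(2)]] by linarith
      also have "\<dots> < k * e" using f unfolding f_def by linarith
      finally show ?thesis using k by simp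
    qed
    then show ?thesis by blast
  qed
  obtain u where u: "square_integrable M u" "(\<lambda>n. sqnorm M (\<lambda>x. v (r n) x - u x)) \<longlonglongrightarrow> 0"
    by (rule Riesz_Fischer[where f = "\<lambda>n. v (r n)", OF s(1) C]) (assumption | rule that)+
  obtain w where w: "square_integrable M w" "(\<lambda>n. sqnorm M (\<lambda>x. g (r n) x - w x)) \<longlonglongrightarrow> 0"
    by (rule Riesz_Fischer[where f = "\<lambda>n. g (r n)", OF s(2) Cg]) (assumption | rule that)+
  have H: "H10_grad D u w"
    by (rule H10_grad_closed[OF D(1) v(2) u(1) w(1) u(2) w(2)])
  then have "u \<in> H10 D" by (auto simp: H10_def)
  \<comment> \<open>The limit belongs to \<open>V\<close> only up to a null set. Its representative
    \<open>u'\<close> keeps the gradient \<open>w\<close>, since the approximation by test functions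
    is measured in L^2 only.\<close>
  then obtain u' where u': "u' \<in> V" "AE x in M. u' x = u x"
    using trial_spaceD(3)[OF V v(1) _ u(2)] by blast
  then have "u' \<in> H10 D" using trial_spaceD(1)[OF V] by blast
  then have su': "square_integrable M u'" using H10_grad_square_integrable by (auto simp: H10_def)
  have eqd: "sqnorm M (\<lambda>x. f x - u' x) = sqnorm M (\<lambda>x. f x - u x)" if "square_integrable M f" for f
  proof (rule sqnorm_cong_AE)
    show "AE x in M. f x - u' x = f x - u x" using u'(2) by eventually_elim simp
  qed (use that su' u(1) in \<open>auto simp: square_integrable_def\<close>)
  have H': "H10_grad D u' w"
  proof (rule H10_gradI[OF su' w(1)])
    fix e :: real assume e: "e > 0"
    obtain \<phi> d\<phi> where p: "test_function D \<phi>" "\<And>x. GDERIV \<phi> x :> d\<phi> x"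
      "sqnorm M (\<lambda>x. \<phi> x - u x) < e" "sqnorm M (\<lambda>x. d\<phi> x - w x) < e"
      using H10_grad_approx[OF H e] by blast
    have "sqnorm M (\<lambda>x. \<phi> x - u' x) < e"
      using eqd[OF test_function_square_integrable[OF p(1,2) D(1)]] p(3) by simp
    with p show "\<exists>\<phi> d\<phi>. test_function D \<phi> \<and> (\<forall>x. GDERIV \<phi> x :> d\<phi> x) \<and>
      sqnorm M (\<lambda>x. \<phi> x - u' x) < e \<and> sqnorm M (\<lambda>x. d\<phi> x - w x) < e" by blast
  qed
  have l1: "(\<lambda>n. mass D c (v (r n))) \<longlonglongrightarrow> mass D c u"
    using weighted_square_tendsto[OF s(1) u(1) mc uc u(2)] by (simp add: mass_def)
  have l2: "(\<lambda>n. energy D A B (v (r n), g (r n))) \<longlonglongrightarrow> energy D A B (u, w)"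
    using tendsto_add[OF weighted_square_tendsto[OF s(2) w(1) mA uA w(2)] weighted_square_tendsto[OF s(1) u(1) mB uB u(2)]]
    by (simp add: energy_def)
  have "mass D c u = 1" using l1 v(3) by (simp add: LIMSEQ_const_iff)
  then have "mass D c u' = 1" using energy_cong_AE(2)[OF u'(2) su' u(1)] by simp
  then have st: "(u', w) \<in> unit_states D V c" using u'(1) H' by (simp add: unit_states_def)
  have "energy D A B (u, w) \<le> \<Lambda>"
  proof (rule LIMSEQ_le[OF l2])
    have "(\<lambda>n. \<Lambda> + 1 / real (Suc n)) \<longlonglongrightarrow> \<Lambda> + 0"
      using LIMSEQ_inverse_real_of_nat by (intro tendsto_intros) (simp add: inverse_eq_divide)
    then show "(\<lambda>n. \<Lambda> + 1 / real (Suc n)) \<longlonglongrightarrow> \<Lambda>" by simp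
    show "\<exists>N. \<forall>n\<ge>N. energy D A B (v (r n), g (r n)) \<le> \<Lambda> + 1 / real (Suc n)"
      using small by (auto intro: less_imp_le)
  qed
  then have "energy D A B (u', w) \<le> \<Lambda>" using energy_cong_AE(1)[OF u'(2) su' u(1)] by simp
  moreover have "\<Lambda> \<le> energy D A B (u', w)" unfolding \<Lambda>_def by (rule rayleigh_inf_le[OF st])
  ultimately show ?thesis using st that unfolding \<Lambda>_def by force
qed

text \<open>The difference of the energy and \<open>\<Lambda>\<close> times the mass is nonnegative
  on \<open>V\<close> and vanishes at \<open>u\<close>. Its derivative at \<open>u\<close> in each
  direction \<open>v\<close> is thus zero, which is the weak eigenvalue equation.\<close>

lemma minimiser_eigenpair:
  assumes V: "trial_space D V" and s: "(u, g) \<in> unit_states D V c"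
    and m: "energy D A B (u, g) = rayleigh_inf D V c A B"
  shows "eigenpair D V A B c (rayleigh_inf D V c A B) u"
proof -
  define \<Lambda> where "\<Lambda> = rayleigh_inf D V c A B"
  have u: "u \<in> V" "H10_grad D u g" "mass D c u = 1" using s by (auto simp: unit_states_def)
  have "energy2 u g v w = \<Lambda> * mass2 u v" if v: "v \<in> V" "H10_grad D v w" for v w
  proof -
    note su = H10_grad_square_integrable[OF u(2)] and sv = H10_grad_square_integrable[OF v(2)]
    have "energy2 u g v w - \<Lambda> * mass2 u v = 0"
    proof (rule linear_coefficient_zero)
      fix t :: real
      have "\<Lambda> * mass D c (\<lambda>x. u x + t * v x) \<le> energy D A B (\<lambda>x. u x + t * v x, \<lambda>x. g x + t *\<^sub>R w x)"
        unfolding \<Lambda>_def using s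
        by (intro rayleigh_inf_mass_le_energy V trial_spaceD(2)[OF V] H10_grad_add_scale D v u) auto
      then show "0 \<le> 2 * t * (energy2 u g v w - \<Lambda> * mass2 u v) +
          t\<^sup>2 * (energy D A B (v, w) - \<Lambda> * mass D c v)"
        unfolding energy_expand[OF su sv] mass_expand[OF su(1) sv(1)] u(3) m \<Lambda>_def[symmetric]
        by (simp add: algebra_simps)
    qed
    then show ?thesis by simp
  qed
  then show ?thesis
    using u unfolding eigenpair_def energy2_def mass2_def \<Lambda>_def mass_def mult.assoc by blast
qed

text \<open>Test the weak equation with \<open>u\<close> itself.\<close>

lemma eigenpair_state:
  assumes "eigenpair D V A B c \<mu> u"
  obtains g where "(u, g) \<in> unit_states D V c" "energy D A B (u, g) = \<mu>"
proof -
  obtain g where u: "u \<in> V" "mass D c u = 1" "H10_grad D u g"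
    and e: "\<And>v w. v \<in> V \<Longrightarrow> H10_grad D v w \<Longrightarrow>
           (LINT x|M. A x * (g x \<bullet> w x)) + (LINT x|M. B x * u x * v x) = \<mu> * (LINT x|M. c x * u x * v x)"
    using assms unfolding eigenpair_def mass_def by blast
  have "energy D A B (u, g) = \<mu> * mass D c u"
    using e[OF u(1,3)] by (simp add: energy_def mass_def power2_norm_eq_inner power2_eq_square[of "u x" for x] mult.assoc)
  with u show ?thesis by (intro that[of g]) (auto simp: unit_states_def)
qed

text \<open>The infimum is attained and hence an eigenvalue, so \<open>\<mu>\<close> does not exceed
  it; conversely \<open>\<mu>\<close> is the energy of a unit state.\<close>

theorem smallest_eigenvalue_eq_rayleigh_inf:
  assumes V: "trial_space D V" and sm: "smallest_eigenpair D V A B c \<mu> u"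
  shows "\<mu> = rayleigh_inf D V c A B"
proof -
  obtain g where g: "(u, g) \<in> unit_states D V c" "energy D A B (u, g) = \<mu>"
    using sm eigenpair_state unfolding smallest_eigenpair_def by blast
  then have "unit_states D V c \<noteq> {}" by auto
  then obtain s where "s \<in> unit_states D V c" "energy D A B s = rayleigh_inf D V c A B"
    using minimiser_exists[OF V] by blast
  then have "eigenpair D V A B c (rayleigh_inf D V c A B) (fst s)"
    using minimiser_eigenpair[OF V, of "fst s" "snd s"] by simp
  then have "\<mu> \<le> rayleigh_inf D V c A B"
    using sm unfolding smallest_eigenpair_def by blast
  moreover have "rayleigh_inf D V c A B \<le> \<mu>" using rayleigh_inf_le[OF g(1)] g(2) by simp
  ultimately show ?thesis by simp
qed

end

section \<open>Finite element spaces\<close>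

lemma affine_sequence_convergence_set:
  fixes p :: "nat \<Rightarrow> 'a::euclidean_space" and q :: "nat \<Rightarrow> real"
  shows "affine {x. convergent (\<lambda>n. p n \<bullet> x + q n)}"
  unfolding affine_def
proof (intro ballI allI impI)
  fix x y :: 'a and s t :: real
  assume x: "x \<in> {x. convergent (\<lambda>n. p n \<bullet> x + q n)}" and y: "y \<in> {x. convergent (\<lambda>n. p n \<bullet> x + q n)}"
    and st: "s + t = 1"
  have "p n \<bullet> (s *\<^sub>R x + t *\<^sub>R y) + q n = s * (p n \<bullet> x + q n) + t * (p n \<bullet> y + q n)" for n
  proof -
    have "q n = (s + t) * q n" using st by simp
    then show ?thesis by (simp add: inner_simps algebra_simps)
  qed
  moreover have "convergent (\<lambda>n. s * (p n \<bullet> x + q n) + t * (p n \<bullet> y + q n))"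
    using convergent_add[OF convergent_mult[OF convergent_const x[unfolded mem_Collect_eq]]
      convergent_mult[OF convergent_const y[unfolded mem_Collect_eq]]] .
  ultimately show "s *\<^sub>R x + t *\<^sub>R y \<in> {x. convergent (\<lambda>n. p n \<bullet> x + q n)}" by simp
qed

text \<open>The points of convergence form an affine set, and a proper affine subspace is
  negligible; convergence almost everywhere on an open set therefore spreads to the whole space.
  Evaluation at zero and at the basis vectors then yields the limits of the coefficients.\<close>

lemma affine_sequence_limit:
  fixes p :: "nat \<Rightarrow> 'a::euclidean_space" and q :: "nat \<Rightarrow> real"
  assumes U: "open U" "U \<noteq> {}" and N: "negligible N"
    and conv: "\<And>x. x \<in> U - N \<Longrightarrow> convergent (\<lambda>n. p n \<bullet> x + q n)"
  obtains p' q' where "\<And>x. (\<lambda>n. p n \<bullet> x + q n) \<longlonglongrightarrow> p' \<bullet> x + q'"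
proof -
  define S where "S = {x. convergent (\<lambda>n. p n \<bullet> x + q n)}"
  have aff: "affine S" unfolding S_def by (rule affine_sequence_convergence_set)
  have "S = UNIV"
  proof (rule ccontr)
    assume "S \<noteq> UNIV"
    then have "interior S = {}"
      using affine_hull_nonempty_interior[of S] aff by (metis hull_same)
    then have "negligible S" using negligible_convex_interior[OF affine_imp_convex[OF aff]] by simp
    then have "negligible (S \<union> N)" using N by (rule negligible_Un)
    moreover have "U \<subseteq> S \<union> N" using conv unfolding S_def by blast
    ultimately have "negligible U" by (rule negligible_subset)
    then show False using open_not_negligible U by blast
  qed
  then have c: "convergent (\<lambda>n. p n \<bullet> x + q n)" for x unfolding S_def by blast
  have q: "convergent q" using c[of 0] by simp
  then obtain q' where q': "q \<longlonglongrightarrow> q'" by (auto simp: convergent_def)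
  have "convergent (\<lambda>n. p n \<bullet> i)" for i
    using convergent_diff[OF c[of i] q] by simp
  then obtain l where l: "\<And>i. (\<lambda>n. p n \<bullet> i) \<longlonglongrightarrow> l i" unfolding convergent_def using choice by metis
  define p' where "p' = (\<Sum>i\<in>Basis. l i *\<^sub>R i)"
  have "(\<lambda>n. \<Sum>i\<in>Basis. (p n \<bullet> i) *\<^sub>R i) \<longlonglongrightarrow> p'"
    unfolding p'_def by (intro tendsto_intros l)
  then have "p \<longlonglongrightarrow> p'" by (simp add: euclidean_representation)
  then have "(\<lambda>n. p n \<bullet> x + q n) \<longlonglongrightarrow> p' \<bullet> x + q'" for x by (intro tendsto_intros q')
  then show ?thesis by (rule that)
qed

lemma full_simplex_interior_nonempty:
  fixes T :: "'a::euclidean_space set"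
  assumes "int DIM('a) simplex T"
  shows "interior T \<noteq> {}"
proof -
  have d: "aff_dim T = int DIM('a)" by (rule aff_dim_simplex[OF assms])
  then have "T \<noteq> {}" by (auto simp: aff_dim_empty)
  moreover have "interior T = rel_interior T"
    using d aff_dim_eq_full[of T] rel_interior_interior[of T] by simp
  ultimately show ?thesis using rel_interior_eq_empty[OF convex_simplex[OF assms]] by simp
qed

text \<open>L^2 convergence gives an almost everywhere convergent subsequence, and affinity on each
  simplex upgrades this to convergence at every point of the mesh. The pointwise limit is the
  required representative; its continuity is glued from the simplices and the closure of the
  complement of the mesh.\<close>

theorem trial_space_fe_space:
  fixes D :: "'a::euclidean_space set"
  assumes D: "open D" "convex D" and fe: "fe_space D h V"
  shows "trial_space D V"
proof -
  obtain \<T> where tri: "triangulation \<T>" "\<And>T. T \<in> \<T> \<Longrightarrow> int DIM('a) simplex T" "\<Union>\<T> \<subseteq> closure D"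
    and V: "V = {v. continuous_on UNIV v \<and> (\<forall>x. x \<notin> \<Union>\<T> \<longrightarrow> v x = 0) \<and>
                (\<forall>T\<in>\<T>. \<exists>p q. \<forall>x\<in>T. v x = p \<bullet> x + q)}"
    and sub: "V \<subseteq> H10 D"
    using fe unfolding fe_space_def by blast
  have fin: "finite \<T>" using tri(1) by (simp add: triangulation_def)
  have lin: "(\<lambda>x. u x + t * v x) \<in> V" if u: "u \<in> V" and v: "v \<in> V" for u v t
  proof -
    have u': "continuous_on UNIV u" "\<And>x. x \<notin> \<Union>\<T> \<Longrightarrow> u x = 0" "\<And>T. T \<in> \<T> \<Longrightarrow> \<exists>p q. \<forall>x\<in>T. u x = p \<bullet> x + q"
      and v': "continuous_on UNIV v" "\<And>x. x \<notin> \<Union>\<T> \<Longrightarrow> v x = 0" "\<And>T. T \<in> \<T> \<Longrightarrow> \<exists>p q. \<forall>x\<in>T. v x = p \<bullet> x + q"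
      using u v unfolding V by simp_all
    have "\<exists>p q. \<forall>x\<in>T. u x + t * v x = p \<bullet> x + q" if T: "T \<in> \<T>" for T
    proof -
      obtain p q where "\<forall>x\<in>T. u x = p \<bullet> x + q" using u'(3)[OF T] by blast
      moreover obtain p' q' where "\<forall>x\<in>T. v x = p' \<bullet> x + q'" using v'(3)[OF T] by blast
      ultimately have "\<forall>x\<in>T. u x + t * v x = (p + t *\<^sub>R p') \<bullet> x + (q + t * q')"
        by (simp add: inner_simps algebra_simps)
      then show ?thesis by blast
    qed
    moreover have "continuous_on UNIV (\<lambda>x. u x + t * v x)" by (intro continuous_intros u' v')
    ultimately show ?thesis using u'(2) v'(2) unfolding V by simp
  qed
  have closed: "\<exists>u'\<in>V. AE x in lebesgue_on D. u' x = u x"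
    if v: "\<And>n. v n \<in> V" and u: "u \<in> H10 D"
      and l: "(\<lambda>n. sqnorm (lebesgue_on D) (\<lambda>x. v n x - u x)) \<longlonglongrightarrow> 0" for v u
  proof -
    define M where "M = lebesgue_on D"
    have si: "square_integrable M w" if "w \<in> H10 D" for w
      using that H10_grad_square_integrable(1) unfolding H10_def M_def by blast
    have int: "integrable M (\<lambda>x. (v n x - u x)\<^sup>2)" for n
      using square_integrable_diff[OF si si, of "v n" u] u v sub by (auto simp: square_integrable_def)
    obtain r :: "nat \<Rightarrow> nat" where r: "strict_mono r" "AE x in M. (\<lambda>n. (v (r n) x - u x)\<^sup>2) \<longlonglongrightarrow> 0"
      using tendsto_L1_AE_subseq[of M "\<lambda>n x. (v n x - u x)\<^sup>2", OF int] l
      unfolding M_def sqnorm_def by auto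
    have ae: "AE x in M. (\<lambda>n. v (r n) x) \<longlonglongrightarrow> u x"
      using r(2)
    proof eventually_elim
      case (elim x)
      then have "(\<lambda>n. sqrt ((v (r n) x - u x)\<^sup>2)) \<longlonglongrightarrow> sqrt 0" by (rule tendsto_real_sqrt)
      then have "(\<lambda>n. \<bar>v (r n) x - u x\<bar>) \<longlonglongrightarrow> 0" by simp
      then show ?case by (simp add: tendsto_rabs_zero_iff LIM_zero_iff)
    qed
    have "AE x in lebesgue. x \<in> D \<longrightarrow> (\<lambda>n. v (r n) x) \<longlonglongrightarrow> u x"
      using ae D(1) unfolding M_def by (subst (asm) AE_restrict_space_iff) auto
    then obtain N where N: "N \<in> null_sets lebesgue" "{x. \<not> (x \<in> D \<longrightarrow> (\<lambda>n. v (r n) x) \<longlonglongrightarrow> u x)} \<subseteq> N"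
      by (auto simp: eventually_ae_filter)
    have neg: "negligible N" using N(1) by (simp add: negligible_iff_null_sets)
    have lim_T: "\<exists>p' q'. \<forall>x\<in>T. (\<lambda>n. v (r n) x) \<longlonglongrightarrow> p' \<bullet> x + q'" if T: "T \<in> \<T>" for T
    proof -
      have "\<forall>n. \<exists>p q. \<forall>x\<in>T. v (r n) x = p \<bullet> x + q" using v T unfolding V by blast
      from choice[OF this] obtain p where "\<forall>n. \<exists>q. \<forall>x\<in>T. v (r n) x = p n \<bullet> x + q" ..
      from choice[OF this] obtain q where pq: "\<forall>n. \<forall>x\<in>T. v (r n) x = p n \<bullet> x + q n" ..
      \<comment> \<open>For convex open \<open>D\<close> the interior of the closure is
        \<open>D\<close> again, so information on \<open>D\<close> reaches the interior of every
        simplex.\<close>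
      have sub: "interior T \<subseteq> D"
        using interior_mono[of T "closure D"] tri(3) T convex_interior_closure[OF D(2)] interior_open[OF D(1)] by auto
      have "convergent (\<lambda>n. p n \<bullet> x + q n)" if x: "x \<in> interior T - N" for x
      proof -
        have "(\<lambda>n. v (r n) x) \<longlonglongrightarrow> u x" using N(2) x sub by blast
        moreover have "x \<in> T" using x interior_subset by blast
        ultimately show ?thesis using pq by (auto simp: convergent_def)
      qed
      then obtain p' q' where "\<And>x. (\<lambda>n. p n \<bullet> x + q n) \<longlonglongrightarrow> p' \<bullet> x + q'"
        using affine_sequence_limit[OF open_interior full_simplex_interior_nonempty[OF tri(2)[OF T]] neg, of p q]
        by blast
      then show ?thesis using pq by (intro exI[of _ p'] exI[of _ q']) simp
    qed
    define u' where "u' x = lim (\<lambda>n. v (r n) x)" for x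
    have u'_T: "\<exists>p q. \<forall>x\<in>T. u' x = p \<bullet> x + q" if "T \<in> \<T>" for T
    proof -
      obtain p q where "\<forall>x\<in>T. (\<lambda>n. v (r n) x) \<longlonglongrightarrow> p \<bullet> x + q" using lim_T[OF \<open>T \<in> \<T>\<close>] by blast
      then have "\<forall>x\<in>T. u' x = p \<bullet> x + q" unfolding u'_def by (auto intro: limI)
      then show ?thesis by blast
    qed
    have u'_0: "u' x = 0" if "\<And>n. v n x = 0" for x
      using that unfolding u'_def by simp
    have closedT: "closed (\<Union>\<T>)"
      using fin tri(2) closed_simplex by (intro closed_Union) auto
    have c1: "continuous_on (\<Union>\<T>) u'"
    proof -
      have "continuous_on (\<Union>T\<in>\<T>. T) u'"
      proof (rule continuous_on_closed_Union)
        fix T assume T: "T \<in> \<T>"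
        show "closed T" using tri(2)[OF T] by (rule closed_simplex)
        obtain p q where "\<forall>x\<in>T. u' x = p \<bullet> x + q" using u'_T[OF T] by blast
        then have "continuous_on T u' \<longleftrightarrow> continuous_on T (\<lambda>x. p \<bullet> x + q)"
          by (intro continuous_on_cong) auto
        then show "continuous_on T u'" by (simp add: continuous_intros)
      qed (rule fin)
      then show ?thesis by simp
    qed
    \<comment> \<open>The closure contains boundary points of the mesh, where the value zero comes
      from the continuity of each \<open>v n\<close>. So \<open>u'\<close> is constant on a closed
      set that covers the outside.\<close>
    have zero: "u' x = 0" if x: "x \<in> closure (- \<Union>\<T>)" for x
    proof (rule u'_0)
      fix n
      show "v n x = 0"
      proof (rule continuous_constant_on_closure[OF _ _ x])
        show "continuous_on (closure (- \<Union>\<T>)) (v n)"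
          using v[of n] unfolding V by (auto intro: continuous_on_subset)
        show "v n y = 0" if "y \<in> - \<Union>\<T>" for y using v[of n] that unfolding V by auto
      qed
    qed
    have c2: "continuous_on (closure (- \<Union>\<T>)) u'"
      using continuous_on_cong[of "closure (- \<Union>\<T>)" _ u' "\<lambda>x. 0"] zero by auto
    have "continuous_on (\<Union>\<T> \<union> closure (- \<Union>\<T>)) u'"
      by (intro continuous_on_closed_Un closedT closed_closure c1 c2)
    moreover have "\<Union>\<T> \<union> closure (- \<Union>\<T>) = UNIV" using closure_subset[of "- \<Union>\<T>"] by blast
    ultimately have "continuous_on UNIV u'" by simp
    moreover have "u' x = 0" if "x \<notin> \<Union>\<T>" for x
      using zero closure_subset[of "- \<Union>\<T>"] that by blast
    ultimately have "u' \<in> V" using u'_T unfolding V by blast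
    moreover have "AE x in lebesgue_on D. u' x = u x"
      using ae unfolding M_def by eventually_elim (simp add: u'_def limI)
    ultimately show ?thesis by blast
  qed
  show ?thesis
    unfolding trial_space_def using sub lin closed by blast
qed

section \<open>Dependence of the eigenvalue on the parameters\<close>

lemma Linf_AE_le:
  fixes f :: "'a::euclidean_space \<Rightarrow> real"
  assumes "Linf D f"
  shows "AE x in lebesgue_on D. \<bar>f x\<bar> \<le> Linf_norm D f"
proof -
  let ?e = "esssup (lebesgue_on D) (\<lambda>x. ereal (norm (f x)))"
  have fin: "?e \<noteq> \<infinity>" using assms by (auto simp: Linf_def)
  have "AE x in lebesgue_on D. ereal (norm (f x)) \<le> ?e" by (rule esssup_AE)
  then show ?thesis
  proof eventually_elim
    case (elim x)
    \<comment> \<open>An essential supremum of minus infinity is excluded by the point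
      \<open>x\<close> at hand, where a norm lies below it.\<close>
    then have "?e \<noteq> - \<infinity>" by auto
    with fin have "?e = ereal (Linf_norm D f)" unfolding Linf_norm_def by (auto simp: ereal_real)
    with elim show ?case by simp
  qed
qed

lemma Linf_AE_bound:
  fixes f :: "'a::euclidean_space \<Rightarrow> real"
  assumes "Linf D f" "Linf_norm D f \<le> B"
  shows "AE x in lebesgue_on D. \<bar>f x\<bar> \<le> B"
  using Linf_AE_le[OF assms(1)] by eventually_elim (use assms(2) in linarith)

text \<open>A negative value would make \<open>D\<close> a null set, but a nonempty open set is not
  negligible.\<close>

lemma Linf_norm_nonneg:
  fixes f :: "'a::euclidean_space \<Rightarrow> real"
  assumes D: "open D" "D \<noteq> {}" and f: "Linf D f"
  shows "0 \<le> Linf_norm D f"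
proof (rule ccontr)
  assume neg: "\<not> 0 \<le> Linf_norm D f"
  have "AE x in lebesgue_on D. False"
    using Linf_AE_le[OF f] by eventually_elim (use neg in auto)
  then have "AE x in lebesgue. x \<notin> D"
    using D(1) by (subst (asm) AE_restrict_space_iff) auto
  then obtain N where "N \<in> null_sets lebesgue" "D \<subseteq> N" by (auto simp: eventually_ae_filter)
  then have "negligible D" using negligible_iff_null_sets negligible_subset by blast
  then show False using open_not_negligible D by blast
qed

text \<open>The powers tend to zero, so eventually \<open>w j < 1\<close>, and there
  \<open>w j \<le> w j powr p\<close>.\<close>

lemma summable_of_summable_powr:
  fixes w :: "nat \<Rightarrow> real"
  assumes w: "\<And>j. 0 \<le> w j" and p: "0 < p" "p < 1" and s: "summable (\<lambda>j. w j powr p)"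
  shows "summable w"
proof -
  have "eventually (\<lambda>j. w j powr p < 1) sequentially"
    using summable_LIMSEQ_zero[OF s] by (rule order_tendstoD(2)) simp
  then have "eventually (\<lambda>j. norm (w j) \<le> w j powr p) sequentially"
  proof eventually_elim
    case (elim j)
    have "w j < 1"
    proof (rule ccontr)
      assume "\<not> w j < 1"
      then have "1 \<le> w j powr p" using p by (intro ge_one_powr_ge_zero) auto
      then show False using elim by simp
    qed
    then have "w j powr 1 \<le> w j powr p" using p w[of j] by (intro powr_mono') auto
    then show ?case using w[of j] by simp
  qed
  then show ?thesis using s by (rule summable_comparison_test_ev)
qed

section \<open>Measurability and discretisation on the parameter domain\<close>

lemma space_param_measure: "space param_measure = {1..} \<rightarrow>\<^sub>E {-1/2..1/2}"
  by (simp add: param_measure_def space_PiM space_restrict_space)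

lemma measurable_param_coordinate:
  assumes "1 \<le> j"
  shows "(\<lambda>y. y j) \<in> borel_measurable param_measure"
proof -
  have "(\<lambda>y. y j) \<in> measurable param_measure (restrict_space lborel {-1/2..1/2})"
    unfolding param_measure_def using assms by (intro measurable_component_singleton) auto
  moreover have "(\<lambda>t. t) \<in> borel_measurable (restrict_space lborel {-1/2..1/2 :: real})"
    by (intro measurable_restrict_space1) simp
  ultimately show ?thesis using measurable_compose by blast
qed

lemma prob_space_param: "prob_space param_measure"
proof -
  have "prob_space (restrict_space lborel {-1/2..1/2 :: real})"
    by (rule prob_spaceI) (simp add: space_restrict_space emeasure_restrict_space)
  then show ?thesis unfolding param_measure_def by (intro prob_space_PiM)
qed

lemma measurable_truncate_param: "truncate_param s \<in> measurable param_measure param_measure"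
proof -
  have "(\<lambda>y. \<lambda>j\<in>{1..}. if j \<le> s then y j else 0) \<in> measurable param_measure
      (PiM {1..} (\<lambda>_. restrict_space lborel {-1/2..1/2}))"
  proof (rule measurable_restrict)
    fix j :: nat assume j: "j \<in> {1..}"
    have "(\<lambda>y. if j \<le> s then y j else 0) \<in> borel_measurable param_measure"
      using measurable_param_coordinate[of j] j by (cases "j \<le> s") auto
    then show "(\<lambda>y. if j \<le> s then y j else 0) \<in> measurable param_measure (restrict_space lborel {-1/2..1/2})"
      using j by (intro measurable_restrict_space2) (auto simp: space_param_measure PiE_iff)
  qed
  then show ?thesis unfolding param_measure_def truncate_param_def[abs_def] by simp
qed

text \<open>A function of the parameters is a pointwise limit of functions of grid codes if it is continuous,
  and every function of a grid code is measurable since there are only countably many codes.\<close>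

definition grid_param :: "nat \<Rightarrow> int list \<Rightarrow> nat \<Rightarrow> real" where
  "grid_param n ks = (\<lambda>j\<in>{1..}. if j \<le> n then of_int (ks ! (j - 1)) / (2 * real (Suc n)) else 0)"

text \<open>Coordinate \<open>j\<close> is stored at list position \<open>j - 1\<close>. The factor
  2 makes both ends of the interval grid values, so that rounding down never leaves it.\<close>

definition grid_code :: "nat \<Rightarrow> (nat \<Rightarrow> real) \<Rightarrow> int list" where
  "grid_code n y = map (\<lambda>j. \<lfloor>2 * real (Suc n) * y (Suc j)\<rfloor>) [0..<n]"

text \<open>Integer lists are countable, so it is enough to treat the preimage of a single list, a
  finite intersection of floor conditions.\<close>

lemma measurable_grid_code: "grid_code n \<in> measurable param_measure (count_space UNIV)"
proof -
  have "grid_code n -` {ks} \<inter> space param_measure \<in> sets param_measure" for ks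
  proof (cases "length ks = n")
    case True
    have m: "(\<lambda>y. \<lfloor>2 * real (Suc n) * y (Suc j)\<rfloor>) \<in> measurable param_measure (count_space UNIV)" for j
    proof -
      have [measurable]: "(\<lambda>y. y (Suc j)) \<in> borel_measurable param_measure"
        by (rule measurable_param_coordinate) simp
      show ?thesis by measurable
    qed
    have eq: "grid_code n y = ks \<longleftrightarrow> (\<forall>j<n. \<lfloor>2 * real (Suc n) * y (Suc j)\<rfloor> = ks ! j)" for y
      unfolding grid_code_def list_eq_iff_nth_eq using True by (simp del: of_nat_Suc)
    have "grid_code n -` {ks} \<inter> space param_measure =
      {y \<in> space param_measure. \<forall>j\<in>{..<n}. \<lfloor>2 * real (Suc n) * y (Suc j)\<rfloor> = ks ! j}"
      unfolding vimage_def Int_def mem_Collect_eq singleton_iff eq lessThan_iff Ball_def by blast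
    also have "\<dots> \<in> sets param_measure"
    proof (rule sets.sets_Collect_finite_All)
      fix j
      have "{y \<in> space param_measure. \<lfloor>2 * real (Suc n) * y (Suc j)\<rfloor> = ks ! j} =
        (\<lambda>y. \<lfloor>2 * real (Suc n) * y (Suc j)\<rfloor>) -` {ks ! j} \<inter> space param_measure" by auto
      also have "\<dots> \<in> sets param_measure" using m by (rule measurable_sets) simp
      finally show "{y \<in> space param_measure. \<lfloor>2 * real (Suc n) * y (Suc j)\<rfloor> = ks ! j} \<in> sets param_measure" .
    qed simp
    finally show ?thesis .
  next
    case False
    then have "grid_code n -` {ks} \<inter> space param_measure = {}" by (auto simp: grid_code_def)
    then show ?thesis by simp
  qed
  then show ?thesis by (subst measurable_count_space_eq2_countable) auto
qed

text \<open>Past the first \<open>n\<close> coordinates the rounded point is zero and only a crude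
  bound is kept; the tail of the weights pays for it.\<close>

lemma grid_param_approx:
  assumes y: "y \<in> space param_measure"
  shows "grid_param n (grid_code n y) \<in> space param_measure"
    and "\<bar>y (Suc j) - grid_param n (grid_code n y) (Suc j)\<bar> \<le> (if j < n then 1 / real (Suc n) else 1)"
proof -
  define N where "N = real (Suc n)"
  have N: "N > 0" by (simp add: N_def)
  have yb: "- 1 / 2 \<le> y j" "y j \<le> 1 / 2" if "1 \<le> j" for j
    using y that by (auto simp: space_param_measure PiE_iff)
  have val: "grid_param n (grid_code n y) j = (if j \<le> n then of_int \<lfloor>2 * N * y j\<rfloor> / (2 * N) else 0)" if "1 \<le> j" for j
    using that by (auto simp: grid_param_def grid_code_def N_def)
  have lo: "- N \<le> of_int \<lfloor>2 * N * y j\<rfloor>" if "1 \<le> j" for j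
  proof -
    have "N * (- 1) \<le> N * (2 * y j)" using yb(1)[OF that] N by (intro mult_left_mono) auto
    then have "of_int (- int (Suc n)) \<le> 2 * N * y j" by (simp add: N_def algebra_simps)
    then have "- int (Suc n) \<le> \<lfloor>2 * N * y j\<rfloor>" by (simp only: le_floor_iff)
    then have "real_of_int (- int (Suc n)) \<le> of_int \<lfloor>2 * N * y j\<rfloor>" by (simp only: of_int_le_iff)
    then show ?thesis by (simp add: N_def)
  qed
  have hi: "of_int \<lfloor>2 * N * y j\<rfloor> \<le> N" if "1 \<le> j" for j
  proof -
    have "N * (2 * y j) \<le> N * 1" using yb(2)[OF that] N by (intro mult_left_mono) auto
    then have "2 * N * y j \<le> N" by (simp add: mult.assoc mult.left_commute)
    then show ?thesis using of_int_floor_le[of "2 * N * y j"] by linarith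
  qed
  show "grid_param n (grid_code n y) \<in> space param_measure"
    unfolding space_param_measure
  proof (rule PiE_I)
    fix j :: nat assume "j \<in> {1..}"
    then have j: "1 \<le> j" by simp
    show "grid_param n (grid_code n y) j \<in> {- 1 / 2..1 / 2}"
      using lo[OF j] hi[OF j] N by (auto simp: val[OF j] field_simps)
  qed (auto simp: grid_param_def)
  have b: "-1/2 \<le> grid_param n (grid_code n y) (Suc j)" "grid_param n (grid_code n y) (Suc j) \<le> 1/2"
    using lo[of "Suc j"] hi[of "Suc j"] N by (auto simp: val field_simps)
  show "\<bar>y (Suc j) - grid_param n (grid_code n y) (Suc j)\<bar> \<le> (if j < n then 1 / real (Suc n) else 1)"
  proof (cases "j < n")
    case True
    define t where "t = 2 * N * y (Suc j)"
    have "y (Suc j) - grid_param n (grid_code n y) (Suc j) = (t - of_int \<lfloor>t\<rfloor>) / (2 * N)"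
      using True N by (simp add: val t_def diff_divide_distrib)
    moreover have "\<bar>(t - of_int \<lfloor>t\<rfloor>) / (2 * N)\<bar> \<le> 1 / (2 * N)"
    proof -
      have "\<bar>t - of_int \<lfloor>t\<rfloor>\<bar> \<le> 1" using floor_correct[of t] by linarith
      then show ?thesis unfolding abs_divide using N by (simp add: divide_right_mono)
    qed
    moreover have "1 / (2 * N) \<le> 1 / N" using N by (simp add: field_simps)
    ultimately show ?thesis using True by (simp add: N_def)
  next
    case False
    then show ?thesis using yb[of "Suc j"] b by auto
  qed
qed

section \<open>Lipschitz dependence of the eigenvalue on the parameters\<close>

definition coeff_weight :: "'a::euclidean_space set \<Rightarrow> (nat \<Rightarrow> 'a \<Rightarrow> real) \<Rightarrow> (nat \<Rightarrow> 'a \<Rightarrow> real) \<Rightarrow> nat \<Rightarrow> real" where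
  "coeff_weight D a b j = max (Linf_norm D (a (Suc j))) (Linf_norm D (b (Suc j)))"

text \<open>A weighted l^1 distance, with \<open>w j\<close> belonging to coordinate
  \<open>Suc j\<close>. With \<open>coeff_weight\<close> it dominates the change of both
  coefficients almost everywhere.\<close>

definition param_dist :: "(nat \<Rightarrow> real) \<Rightarrow> (nat \<Rightarrow> real) \<Rightarrow> (nat \<Rightarrow> real) \<Rightarrow> real" where
  "param_dist w y y' = (\<Sum>j. \<bar>y (Suc j) - y' (Suc j)\<bar> * w j)"

lemma param_dist_summable:
  assumes w: "summable w" "\<And>j. 0 \<le> w j" and y: "y \<in> space param_measure" "y' \<in> space param_measure"
  shows "summable (\<lambda>j. \<bar>y (Suc j) - y' (Suc j)\<bar> * w j)"
proof (rule summable_comparison_test'[OF w(1), of 0])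
  fix j :: nat
  have "-1/2 \<le> y (Suc j)" "y (Suc j) \<le> 1/2" "-1/2 \<le> y' (Suc j)" "y' (Suc j) \<le> 1/2"
    using y by (auto simp: space_param_measure PiE_iff)
  then have "\<bar>y (Suc j) - y' (Suc j)\<bar> \<le> 1" by linarith
  then have "\<bar>y (Suc j) - y' (Suc j)\<bar> * w j \<le> 1 * w j" using w(2) by (intro mult_right_mono) auto
  then show "norm (\<bar>y (Suc j) - y' (Suc j)\<bar> * w j) \<le> w j" using w(2)[of j] by simp
qed

lemma param_dist_grid_tendsto:
  assumes w: "summable w" "\<And>j. 0 \<le> w j" and y: "y \<in> space param_measure"
  shows "(\<lambda>n. param_dist w y (grid_param n (grid_code n y))) \<longlonglongrightarrow> 0"
proof (rule tendsto_sandwich[OF _ _ tendsto_const])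
  let ?y = "\<lambda>n. grid_param n (grid_code n y)"
  \<comment> \<open>The first \<open>n\<close> coordinates are off by at most
    \<open>1 / real (Suc n)\<close>, the others by at most 1, which costs a tail of the series of
    weights.\<close>
  let ?b = "\<lambda>n. (1 / real (Suc n)) * suminf w + (suminf w - (\<Sum>j<n. w j))"
  show "\<forall>\<^sub>F n in sequentially. 0 \<le> param_dist w y (?y n)"
    unfolding param_dist_def
    by (intro always_eventually allI suminf_nonneg param_dist_summable w y grid_param_approx) (auto simp: w)
  show "\<forall>\<^sub>F n in sequentially. param_dist w y (?y n) \<le> ?b n"
  proof (intro always_eventually allI)
    fix n
    have s2: "(\<lambda>j. if j < n then w j else 0) sums (\<Sum>j<n. w j)"
      using sums_If_finite[of "\<lambda>j. j < n" w] by (simp add: lessThan_def)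
    have s: "(\<lambda>j. (1 / real (Suc n)) * w j + (w j - (if j < n then w j else 0))) sums ?b n"
      by (intro sums_add sums_diff sums_mult s2 summable_sums w)
    have "param_dist w y (?y n) \<le> (\<Sum>j. (1 / real (Suc n)) * w j + (w j - (if j < n then w j else 0)))"
      unfolding param_dist_def
    proof (rule suminf_le)
      fix j
      have "\<bar>y (Suc j) - ?y n (Suc j)\<bar> * w j \<le> (if j < n then 1 / real (Suc n) else 1) * w j"
        using grid_param_approx(2)[OF y] w(2) by (intro mult_right_mono) auto
      also have "\<dots> \<le> (1 / real (Suc n)) * w j + (w j - (if j < n then w j else 0))"
        using w(2)[of j] by simp
      finally show "\<bar>y (Suc j) - ?y n (Suc j)\<bar> * w j \<le> \<dots>" .
    qed (use s in \<open>auto intro!: param_dist_summable w y grid_param_approx dest: sums_summable\<close>)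
    also have "\<dots> = ?b n" using s by (rule sums_unique[symmetric])
    finally show "param_dist w y (?y n) \<le> ?b n" .
  qed
  have "(\<lambda>n. 1 / real (Suc n)) \<longlonglongrightarrow> 0"
    using LIMSEQ_inverse_real_of_nat by (simp add: inverse_eq_divide)
  then have "?b \<longlonglongrightarrow> 0 * suminf w + (suminf w - suminf w)"
    by (intro tendsto_intros summable_LIMSEQ w)
  then show "?b \<longlonglongrightarrow> 0" by simp
qed

lemma coefficient_diff_le:
  fixes a :: "nat \<Rightarrow> 'a::euclidean_space \<Rightarrow> real"
  assumes w: "summable w" "\<And>j. 0 \<le> w j" and a: "\<And>j. \<bar>a (Suc j) x\<bar> \<le> w j"
    and y: "y \<in> space param_measure" "y' \<in> space param_measure"
  shows "\<bar>coefficient a y x - coefficient a y' x\<bar> \<le> param_dist w y y'"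
proof -
  have s: "summable (\<lambda>j. z (Suc j) * a (Suc j) x)" if z: "z \<in> space param_measure" for z
  proof (rule summable_comparison_test'[OF w(1), of 0])
    fix j :: nat
    have "-1/2 \<le> z (Suc j)" "z (Suc j) \<le> 1/2" using z by (auto simp: space_param_measure PiE_iff)
    then have "\<bar>z (Suc j)\<bar> * \<bar>a (Suc j) x\<bar> \<le> 1 * w j" by (intro mult_mono a) auto
    then show "norm (z (Suc j) * a (Suc j) x) \<le> w j" by (simp add: abs_mult)
  qed
  have s': "summable (\<lambda>j. \<bar>(y (Suc j) - y' (Suc j)) * a (Suc j) x\<bar>)"
    by (rule summable_comparison_test'[OF param_dist_summable[OF w y], of 0])
      (auto simp: abs_mult intro!: mult_left_mono a)
  have "\<bar>coefficient a y x - coefficient a y' x\<bar> = \<bar>\<Sum>j. (y (Suc j) - y' (Suc j)) * a (Suc j) x\<bar>"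
    unfolding coefficient_def using suminf_diff[OF s[OF y(1)] s[OF y(2)]] by (simp add: left_diff_distrib)
  also have "\<dots> \<le> (\<Sum>j. \<bar>(y (Suc j) - y' (Suc j)) * a (Suc j) x\<bar>)"
    by (rule summable_rabs[OF s'])
  also have "\<dots> \<le> param_dist w y y'"
    unfolding param_dist_def
    by (intro suminf_le s' param_dist_summable w y) (auto simp: abs_mult intro!: mult_left_mono a)
  finally show ?thesis .
qed

lemma problem_data_elliptic_form:
  assumes pd: "problem_data D a b c amin amax" and y: "y \<in> space param_measure"
  shows "elliptic_form D c (coefficient a y) (coefficient b y) amin amax"
proof -
  have l: "Linf D (coefficient a y)" "Linf D (coefficient b y)" "Linf D c"
    and n: "Linf_norm D (coefficient a y) \<le> amax" "Linf_norm D (coefficient b y) \<le> amax" "Linf_norm D c \<le> amax"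
    using pd y unfolding problem_data_def by blast+
  have lo: "AE x in lebesgue_on D. amin \<le> coefficient a y x \<and> 0 \<le> coefficient b y x"
    using pd y unfolding problem_data_def by blast
  show ?thesis
  proof
    show "AE x in lebesgue_on D. amin \<le> coefficient a y x" "AE x in lebesgue_on D. 0 \<le> coefficient b y x"
      using lo by (auto elim: eventually_mono)
    show "AE x in lebesgue_on D. \<bar>coefficient a y x\<bar> \<le> amax" "AE x in lebesgue_on D. \<bar>coefficient b y x\<bar> \<le> amax"
      "AE x in lebesgue_on D. \<bar>c x\<bar> \<le> amax"
      by (intro Linf_AE_bound l n)+
    show "coefficient a y \<in> borel_measurable (lebesgue_on D)" "coefficient b y \<in> borel_measurable (lebesgue_on D)"
      "c \<in> borel_measurable (lebesgue_on D)"
      using l by (simp_all add: Linf_def)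
    show "open D" "bounded D" "0 < amin" "AE x in lebesgue_on D. amin \<le> c x"
      using pd unfolding problem_data_def by blast+
  qed
qed

lemma problem_data_weights:
  assumes pd: "problem_data D a b c amin amax"
  shows "summable (coeff_weight D a b)" "0 \<le> coeff_weight D a b j"
proof -
  have D: "open D" "D \<noteq> {}" and l: "\<And>j. Linf D (a j)"
    using pd unfolding problem_data_def by blast+
  show nn: "0 \<le> coeff_weight D a b j" for j
    using Linf_norm_nonneg[OF D l, of "Suc j"] by (simp add: coeff_weight_def max.coboundedI1)
  obtain p where p: "0 < p" "p < 1" "summable (\<lambda>j. coeff_weight D a b j powr p)"
    using pd unfolding problem_data_def coeff_weight_def by blast
  show "summable (coeff_weight D a b)" by (rule summable_of_summable_powr[OF nn p])
qed

lemma energy_param_diff_le: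
  assumes pd: "problem_data D a b c amin amax" and y: "y \<in> space param_measure" "y' \<in> space param_measure"
    and s: "square_integrable (lebesgue_on D) v" "square_integrable (lebesgue_on D) g"
  shows "energy D (coefficient a y') (coefficient b y') (v, g) \<le> energy D (coefficient a y) (coefficient b y) (v, g)
    + param_dist (coeff_weight D a b) y y' * (sqnorm (lebesgue_on D) g + sqnorm (lebesgue_on D) v)"
proof -
  define M where "M = lebesgue_on D"
  define d where "d = param_dist (coeff_weight D a b) y y'"
  note s = s[folded M_def]
  note w = problem_data_weights[OF pd]
  \<comment> \<open>Formulated for a general coefficient family and target space: it is used for
    \<open>a\<close> with the vector valued gradient and for \<open>b\<close> with the
    function.\<close>
  have bd: "(LINT x|M. coefficient f y' x * (norm (h x))\<^sup>2) \<le> (LINT x|M. coefficient f y x * (norm (h x))\<^sup>2) + d * sqnorm M h"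
    if f: "\<And>j. Linf D (f j)" "\<And>j. Linf_norm D (f (Suc j)) \<le> coeff_weight D a b j"
      and c: "\<And>z. z \<in> space param_measure \<Longrightarrow> Linf D (coefficient f z) \<and> Linf_norm D (coefficient f z) \<le> amax"
      and h: "square_integrable M h" for f :: "nat \<Rightarrow> 'a \<Rightarrow> real" and h :: "'a \<Rightarrow> 'b::euclidean_space"
  proof -
    have m: "coefficient f z \<in> borel_measurable M" "AE x in M. \<bar>coefficient f z x\<bar> \<le> amax"
      if z: "z \<in> space param_measure" for z
    proof -
      show "coefficient f z \<in> borel_measurable M" using c[OF z] by (simp add: Linf_def M_def)
      show "AE x in M. \<bar>coefficient f z x\<bar> \<le> amax" unfolding M_def using c[OF z] by (intro Linf_AE_bound) auto
    qed
    note i = integrable_weighted_square[OF h m[OF y(1)]] and i' = integrable_weighted_square[OF h m[OF y(2)]]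
    have ih: "integrable M (\<lambda>x. (norm (h x))\<^sup>2)" using h by (simp add: square_integrable_def)
    \<comment> \<open>There are countably many fluctuations, so almost every \<open>x\<close>
      satisfies all their bounds at once and the series can be estimated pointwise.\<close>
    have "AE x in M. \<forall>j. \<bar>f (Suc j) x\<bar> \<le> coeff_weight D a b j"
      unfolding AE_all_countable M_def by (intro allI Linf_AE_bound f)
    then have "AE x in M. coefficient f y' x * (norm (h x))\<^sup>2 \<le> coefficient f y x * (norm (h x))\<^sup>2 + d * (norm (h x))\<^sup>2"
    proof eventually_elim
      case (elim x)
      then have "\<bar>coefficient f y x - coefficient f y' x\<bar> \<le> d"
        unfolding d_def by (intro coefficient_diff_le w y) auto
      then have "coefficient f y' x * (norm (h x))\<^sup>2 \<le> (coefficient f y x + d) * (norm (h x))\<^sup>2"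
        by (intro mult_right_mono) auto
      then show ?case by (simp add: distrib_right)
    qed
    then have "(LINT x|M. coefficient f y' x * (norm (h x))\<^sup>2) \<le>
        (LINT x|M. coefficient f y x * (norm (h x))\<^sup>2 + d * (norm (h x))\<^sup>2)"
      using i i' ih by (intro integral_mono_AE) auto
    then show ?thesis using i ih by (simp add: sqnorm_def)
  qed
  have la: "\<And>j. Linf D (a j)" "\<And>j. Linf D (b j)"
    and ca: "\<And>z. z \<in> space param_measure \<Longrightarrow> Linf D (coefficient a z) \<and> Linf_norm D (coefficient a z) \<le> amax"
      "\<And>z. z \<in> space param_measure \<Longrightarrow> Linf D (coefficient b z) \<and> Linf_norm D (coefficient b z) \<le> amax"
    using pd unfolding problem_data_def by blast+
  have "(LINT x|M. coefficient a y' x * (norm (g x))\<^sup>2) \<le> (LINT x|M. coefficient a y x * (norm (g x))\<^sup>2) + d * sqnorm M g"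
    by (rule bd[OF la(1) _ ca(1) s(2)]) (simp_all add: coeff_weight_def)
  moreover have "(LINT x|M. coefficient b y' x * (norm (v x))\<^sup>2) \<le> (LINT x|M. coefficient b y x * (norm (v x))\<^sup>2) + d * sqnorm M v"
    by (rule bd[OF la(2) _ ca(2) s(1)]) (simp_all add: coeff_weight_def)
  ultimately show ?thesis
    unfolding energy_def M_def[symmetric] d_def[symmetric] by (simp add: distrib_left)
qed

definition param_eigenvalue ::
    "'a::euclidean_space set \<Rightarrow> ('a \<Rightarrow> real) set \<Rightarrow> ('a \<Rightarrow> real) \<Rightarrow> (nat \<Rightarrow> 'a \<Rightarrow> real) \<Rightarrow> (nat \<Rightarrow> 'a \<Rightarrow> real) \<Rightarrow> (nat \<Rightarrow> real) \<Rightarrow> real" where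
  "param_eigenvalue D V c a b y = rayleigh_inf D V c (coefficient a y) (coefficient b y)"

text \<open>The unit states do not depend on \<open>y\<close>, because \<open>c\<close> does not.
  The energy of one fixed state therefore bounds all the infima.\<close>

lemma param_eigenvalue_bounded:
  assumes pd: "problem_data D a b c amin amax" and ne: "unit_states D V c \<noteq> {}"
  obtains B where "\<And>y. y \<in> space param_measure \<Longrightarrow> 0 \<le> param_eigenvalue D V c a b y \<and> param_eigenvalue D V c a b y \<le> B"
proof -
  obtain v g where s: "(v, g) \<in> unit_states D V c" using ne by auto
  then have "H10_grad D v g" by (simp add: unit_states_def)
  note si = H10_grad_square_integrable[OF this]
  show ?thesis
  proof (rule that)
    fix y assume y: "y \<in> space param_measure"
    interpret elliptic_form D c "coefficient a y" "coefficient b y" amin amax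
      by (rule problem_data_elliptic_form[OF pd y])
    show "0 \<le> param_eigenvalue D V c a b y \<and>
      param_eigenvalue D V c a b y \<le> amax * (sqnorm (lebesgue_on D) g + sqnorm (lebesgue_on D) v)"
      unfolding param_eigenvalue_def
      using rayleigh_inf_nonneg[OF ne] order_trans[OF rayleigh_inf_le[OF s] energy_bounds(3)[OF si]] by simp
  qed
qed

text \<open>The minimiser for \<open>y\<close> is a trial state for \<open>y'\<close>. A one-sided
  estimate is enough, as the roles of the two parameters can be exchanged.\<close>

lemma param_eigenvalue_lipschitz:
  assumes pd: "problem_data D a b c amin amax" and V: "trial_space D V" and ne: "unit_states D V c \<noteq> {}"
  obtains C where "\<And>y y'. y \<in> space param_measure \<Longrightarrow> y' \<in> space param_measure \<Longrightarrow>
    param_eigenvalue D V c a b y' \<le> param_eigenvalue D V c a b y + C * param_dist (coeff_weight D a b) y y'"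
proof -
  obtain B where B: "\<And>y. y \<in> space param_measure \<Longrightarrow> 0 \<le> param_eigenvalue D V c a b y \<and> param_eigenvalue D V c a b y \<le> B"
    using param_eigenvalue_bounded[OF pd ne] by blast
  \<comment> \<open>For a minimiser, ellipticity bounds \<open>amin\<close> times the gradient norm
    by the energy, at most \<open>B\<close>, and \<open>amin\<close> times the function norm is at
    most the unit mass.\<close>
  define C where "C = (B + 1) / amin"
  show ?thesis
  proof (rule that)
    fix y y' assume y: "y \<in> space param_measure" "y' \<in> space param_measure"
    define d where "d = param_dist (coeff_weight D a b) y y'"
    note w = problem_data_weights[OF pd]
    have d0: "0 \<le> d"
      unfolding d_def param_dist_def by (intro suminf_nonneg param_dist_summable w y) (auto simp: w)
    interpret E: elliptic_form D c "coefficient a y" "coefficient b y" amin amax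
      by (rule problem_data_elliptic_form[OF pd y(1)])
    interpret E': elliptic_form D c "coefficient a y'" "coefficient b y'" amin amax
      by (rule problem_data_elliptic_form[OF pd y(2)])
    obtain s where s: "s \<in> unit_states D V c"
      "energy D (coefficient a y) (coefficient b y) s = param_eigenvalue D V c a b y"
      unfolding param_eigenvalue_def by (rule E.minimiser_exists[OF V ne])
    obtain v g where vg: "s = (v, g)" by (cases s)
    then have H: "H10_grad D v g" "mass D c v = 1" using s(1) by (auto simp: unit_states_def)
    note si = H10_grad_square_integrable[OF H(1)]
    have e1: "amin * sqnorm (lebesgue_on D) g \<le> B"
      using E.energy_bounds(1)[OF si] s(2) B[OF y(1)] vg by simp
    have e2: "amin * sqnorm (lebesgue_on D) v \<le> 1"
      using E.mass_bounds(1)[OF si(1)] H(2) by simp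
    have "sqnorm (lebesgue_on D) g + sqnorm (lebesgue_on D) v \<le> C"
      using e1 e2 E.k unfolding C_def by (simp add: pos_le_divide_eq algebra_simps)
    then have "d * (sqnorm (lebesgue_on D) g + sqnorm (lebesgue_on D) v) \<le> C * d"
      using d0 by (subst mult.commute) (intro mult_right_mono)
    moreover have "param_eigenvalue D V c a b y' \<le> energy D (coefficient a y') (coefficient b y') s"
      unfolding param_eigenvalue_def by (rule E'.rayleigh_inf_le[OF s(1)])
    ultimately show "param_eigenvalue D V c a b y' \<le> param_eigenvalue D V c a b y + C * param_dist (coeff_weight D a b) y y'"
      using energy_param_diff_le[OF pd y si] s(2) unfolding vg d_def[symmetric] by linarith
  qed
qed

theorem measurable_param_eigenvalue:
  assumes pd: "problem_data D a b c amin amax" and V: "trial_space D V" and ne: "unit_states D V c \<noteq> {}"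
  shows "param_eigenvalue D V c a b \<in> borel_measurable param_measure"
proof (rule borel_measurable_LIMSEQ_real)
  let ?\<Lambda> = "param_eigenvalue D V c a b" and ?w = "coeff_weight D a b"
  show "(\<lambda>y. ?\<Lambda> (grid_param n (grid_code n y))) \<in> borel_measurable param_measure" for n
    using measurable_compose[OF measurable_grid_code, of "\<lambda>ks. ?\<Lambda> (grid_param n ks)" borel] by simp
  obtain C where C: "\<And>y y'. y \<in> space param_measure \<Longrightarrow> y' \<in> space param_measure \<Longrightarrow>
    ?\<Lambda> y' \<le> ?\<Lambda> y + C * param_dist ?w y y'"
    using param_eigenvalue_lipschitz[OF pd V ne] by blast
  fix y assume y: "y \<in> space param_measure"
  let ?y = "\<lambda>n. grid_param n (grid_code n y)"
  have sym: "param_dist ?w (?y n) y = param_dist ?w y (?y n)" for n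
    unfolding param_dist_def by (simp add: abs_minus_commute)
  have le: "\<bar>?\<Lambda> (?y n) - ?\<Lambda> y\<bar> \<le> C * param_dist ?w y (?y n)" for n
    using C[OF y grid_param_approx(1)[OF y, of n]] C[OF grid_param_approx(1)[OF y, of n] y]
    unfolding sym by linarith
  have l: "(\<lambda>n. C * param_dist ?w y (?y n)) \<longlonglongrightarrow> 0"
    using tendsto_mult_right_zero[OF param_dist_grid_tendsto[OF problem_data_weights[OF pd] y]] .
  have "(\<lambda>n. ?\<Lambda> (?y n) - ?\<Lambda> y) \<longlonglongrightarrow> 0"
  proof (rule Lim_null_comparison[OF _ l])
    show "\<forall>\<^sub>F n in sequentially. norm (?\<Lambda> (?y n) - ?\<Lambda> y) \<le> C * param_dist ?w y (?y n)"
      unfolding real_norm_def by (intro always_eventually allI le)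
  qed
  then show "(\<lambda>n. ?\<Lambda> (?y n)) \<longlonglongrightarrow> ?\<Lambda> y" by (simp add: LIM_zero_iff)
qed

text \<open>The map \<open>\<tau>\<close> covers both problems: the identity for the exact
  eigenvalue, truncation for the discrete one. The eigenfunction at any single parameter shows that
  unit states exist.\<close>

theorem smallest_eigenvalue_measurable_bounded:
  assumes pd: "problem_data D a b c amin amax" and V: "trial_space D V"
    and \<tau>: "\<tau> \<in> measurable param_measure param_measure"
    and ev: "\<And>y. y \<in> space param_measure \<Longrightarrow>
      smallest_eigenpair D V (coefficient a (\<tau> y)) (coefficient b (\<tau> y)) c (\<mu> y) (u y)"
  shows "\<mu> \<in> borel_measurable param_measure" "\<exists>B. \<forall>y\<in>space param_measure. \<bar>\<mu> y\<bar> \<le> B"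
proof -
  have \<tau>s: "\<tau> y \<in> space param_measure" if "y \<in> space param_measure" for y
    using \<tau> that by (rule measurable_space)
  have eq: "\<mu> y = param_eigenvalue D V c a b (\<tau> y)" if y: "y \<in> space param_measure" for y
  proof -
    interpret elliptic_form D c "coefficient a (\<tau> y)" "coefficient b (\<tau> y)" amin amax
      by (rule problem_data_elliptic_form[OF pd \<tau>s[OF y]])
    show ?thesis
      unfolding param_eigenvalue_def by (rule smallest_eigenvalue_eq_rayleigh_inf[OF V ev[OF y]])
  qed
  obtain y where y: "y \<in> space param_measure"
    using prob_space.not_empty[OF prob_space_param] by blast
  have ne: "unit_states D V c \<noteq> {}"
  proof -
    interpret elliptic_form D c "coefficient a (\<tau> y)" "coefficient b (\<tau> y)" amin amax
      by (rule problem_data_elliptic_form[OF pd \<tau>s[OF y]])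
    have "eigenpair D V (coefficient a (\<tau> y)) (coefficient b (\<tau> y)) c (\<mu> y) (u y)"
      using ev[OF y] by (simp add: smallest_eigenpair_def)
    then show ?thesis using eigenpair_state by blast
  qed
  have "(\<lambda>y. param_eigenvalue D V c a b (\<tau> y)) \<in> borel_measurable param_measure"
    using \<tau> measurable_param_eigenvalue[OF pd V ne] by (rule measurable_compose)
  then show "\<mu> \<in> borel_measurable param_measure"
    using eq by (subst measurable_cong) auto
  obtain B where "\<And>y. y \<in> space param_measure \<Longrightarrow> 0 \<le> param_eigenvalue D V c a b y \<and> param_eigenvalue D V c a b y \<le> B"
    using param_eigenvalue_bounded[OF pd ne] by blast
  then show "\<exists>B. \<forall>y\<in>space param_measure. \<bar>\<mu> y\<bar> \<le> B" using eq \<tau>s by (auto intro!: exI[of _ B])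
qed

section \<open>The multilevel estimator\<close>

text \<open>The absent coordinates are padded with the constant 1, which integrates to 1. One
  coordinate gives the marginal law of a shift, two give independence.\<close>

lemma (in product_prob_space) integral_prod_components:
  fixes h :: "'i \<Rightarrow> 'a \<Rightarrow> real"
  assumes I: "finite I" and J: "J \<subseteq> I" and h: "\<And>i. i \<in> J \<Longrightarrow> integrable (M i) (h i)"
  shows "(LINT x|PiM I M. (\<Prod>i\<in>J. h i (x i))) = (\<Prod>i\<in>J. LINT x|M i. h i x)"
proof -
  define h' where "h' i = (if i \<in> J then h i else (\<lambda>_. 1))" for i
  have "(LINT x|PiM I M. (\<Prod>i\<in>I. h' i (x i))) = (\<Prod>i\<in>I. LINT x|M i. h' i x)"
    by (rule product_integral_prod) (use I h in \<open>auto simp: h'_def\<close>)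
  moreover have "(\<Prod>i\<in>I. h' i (x i)) = (\<Prod>i\<in>J. h i (x i))" for x
    using I J by (intro prod.mono_neutral_cong_right) (auto simp: h'_def)
  moreover have "(\<Prod>i\<in>I. LINT x|M i. h' i x) = (\<Prod>i\<in>J. LINT x|M i. h i x)"
    using I J by (intro prod.mono_neutral_cong_right) (auto simp: h'_def M.prob_space)
  ultimately show ?thesis by simp
qed

lemma (in prob_space) integrable_mult_bounded:
  fixes X Y :: "'a \<Rightarrow> real"
  assumes m: "X \<in> borel_measurable M" "Y \<in> borel_measurable M"
    and b: "\<And>x. x \<in> space M \<Longrightarrow> \<bar>X x\<bar> \<le> b" "\<And>x. x \<in> space M \<Longrightarrow> \<bar>Y x\<bar> \<le> c"
  shows "integrable M (\<lambda>x. X x * Y x)"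
proof (rule integrable_const_bound[where B = "b * c"])
  show "AE x in M. norm (X x * Y x) \<le> b * c"
  proof (rule AE_I2)
    fix x assume x: "x \<in> space M"
    have "\<bar>X x\<bar> * \<bar>Y x\<bar> \<le> b * c" using b(1)[OF x] b(2)[OF x] by (intro mult_mono) auto
    then show "norm (X x * Y x) \<le> b * c" by (simp add: abs_mult)
  qed
qed (use m in auto)

text \<open>Pythagoras with an added constant: boundedness makes all products integrable, the linear
  term vanishes by centring and the off-diagonal terms by orthogonality.\<close>

lemma (in prob_space) expectation_square_sum_orthogonal:
  fixes Z :: "'i \<Rightarrow> 'a \<Rightarrow> real"
  assumes I: "finite I"
    and m: "\<And>i. i \<in> I \<Longrightarrow> Z i \<in> borel_measurable M" and b: "\<And>i x. i \<in> I \<Longrightarrow> x \<in> space M \<Longrightarrow> \<bar>Z i x\<bar> \<le> B i"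
    and mean: "\<And>i. i \<in> I \<Longrightarrow> expectation (Z i) = 0"
    and orth: "\<And>i j. i \<in> I \<Longrightarrow> j \<in> I \<Longrightarrow> i \<noteq> j \<Longrightarrow> expectation (\<lambda>x. Z i x * Z j x) = 0"
  shows "expectation (\<lambda>x. (\<beta> + (\<Sum>i\<in>I. Z i x))\<^sup>2) = \<beta>\<^sup>2 + (\<Sum>i\<in>I. expectation (\<lambda>x. (Z i x)\<^sup>2))"
proof -
  have i1: "integrable M (Z i)" if "i \<in> I" for i
    using m[OF that] b[OF that] by (intro integrable_const_bound[where B = "B i"]) (auto intro: AE_I2)
  have i2: "integrable M (\<lambda>x. Z i x * Z j x)" if "i \<in> I" "j \<in> I" for i j
    by (rule integrable_mult_bounded[OF m[OF that(1)] m[OF that(2)] b[OF that(1)] b[OF that(2)]])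
  have "expectation (\<lambda>x. (\<beta> + (\<Sum>i\<in>I. Z i x))\<^sup>2) =
    expectation (\<lambda>x. (\<beta>\<^sup>2 + 2 * \<beta> * (\<Sum>i\<in>I. Z i x)) + (\<Sum>i\<in>I. \<Sum>j\<in>I. Z i x * Z j x))"
    by (simp add: power2_eq_square sum_product algebra_simps)
  also have "\<dots> = (\<beta>\<^sup>2 + 2 * \<beta> * (\<Sum>i\<in>I. expectation (Z i))) + (\<Sum>i\<in>I. \<Sum>j\<in>I. expectation (\<lambda>x. Z i x * Z j x))"
    using i1 i2 by (simp add: prob_space)
  also have "(\<Sum>i\<in>I. expectation (Z i)) = 0" using mean by simp
  also have "(\<Sum>i\<in>I. \<Sum>j\<in>I. expectation (\<lambda>x. Z i x * Z j x)) = (\<Sum>i\<in>I. expectation (\<lambda>x. (Z i x)\<^sup>2))"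
  proof (rule sum.cong[OF refl])
    fix i assume i: "i \<in> I"
    have "(\<Sum>j\<in>I. expectation (\<lambda>x. Z i x * Z j x)) = (\<Sum>j\<in>I. if j = i then expectation (\<lambda>x. (Z i x)\<^sup>2) else 0)"
      using orth i by (intro sum.cong) (auto simp: power2_eq_square)
    then show "(\<Sum>j\<in>I. expectation (\<lambda>x. Z i x * Z j x)) = expectation (\<lambda>x. (Z i x)\<^sup>2)"
      using I i by simp
  qed
  finally show ?thesis by simp
qed

definition level_shift_measure :: "nat \<Rightarrow> (nat \<Rightarrow> real) measure" where
  "level_shift_measure s = PiM {1..s} (\<lambda>_. restrict_space lborel {0..<1})"

lemma prob_space_level_shift: "prob_space (level_shift_measure s)"
proof -
  have "prob_space (restrict_space lborel {0..<1 :: real})"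
    by (rule prob_spaceI) (simp add: space_restrict_space emeasure_restrict_space)
  then show ?thesis unfolding level_shift_measure_def by (intro prob_space_PiM)
qed

text \<open>Each lattice point is a measurable function of the shift with values in the parameter
  domain: a fractional part minus 1/2 lies in the interval, and coordinates beyond \<open>s\<close>
  are zero.\<close>

lemma measurable_lattice_rule:
  assumes f: "f \<in> borel_measurable param_measure"
  shows "(\<lambda>\<delta>. lattice_rule s N z \<delta> f) \<in> borel_measurable (level_shift_measure s)"
proof -
  have "(\<lambda>\<delta>. \<lambda>j\<in>{1..}. if j \<le> s then frac (real k * real (z j) / real N + \<delta> j) - 1/2 else 0)
    \<in> measurable (level_shift_measure s) param_measure" for k
    unfolding param_measure_def
  proof (rule measurable_restrict)
    fix j :: nat assume j: "j \<in> {1..}"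
    show "(\<lambda>\<delta>. if j \<le> s then frac (real k * real (z j) / real N + \<delta> j) - 1/2 else 0)
      \<in> measurable (level_shift_measure s) (restrict_space lborel {-1/2..1/2})"
    proof (rule measurable_restrict_space2)
      show "(\<lambda>\<delta>. if j \<le> s then frac (real k * real (z j) / real N + \<delta> j) - 1/2 else 0)
        \<in> space (level_shift_measure s) \<rightarrow> {-1/2..1/2}"
        by (auto simp: less_imp_le[OF frac_lt_1])
      show "(\<lambda>\<delta>. if j \<le> s then frac (real k * real (z j) / real N + \<delta> j) - 1/2 else 0)
        \<in> measurable (level_shift_measure s) lborel"
      proof (cases "j \<le> s")
        case True
        have "(\<lambda>\<delta>. \<delta> j) \<in> measurable (level_shift_measure s) (restrict_space lborel {0..<1})"
          unfolding level_shift_measure_def using True j by (intro measurable_component_singleton) auto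
        moreover have "(\<lambda>t. t) \<in> borel_measurable (restrict_space lborel {0..<1 :: real})"
          by (intro measurable_restrict_space1) simp
        ultimately have c: "(\<lambda>\<delta>. \<delta> j) \<in> borel_measurable (level_shift_measure s)"
          using measurable_compose by blast
        have "(\<lambda>t. frac (d + t) - 1/2) \<in> borel_measurable borel" for d :: real
          unfolding frac_def by measurable
        from measurable_compose[OF c this] show ?thesis using True by simp
      qed simp
    qed
  qed
  from measurable_compose[OF this f] show ?thesis
    unfolding lattice_rule_def by (intro borel_measurable_times borel_measurable_const borel_measurable_sum)
qed

lemma lattice_rule_bound:
  assumes f: "\<And>y. y \<in> space param_measure \<Longrightarrow> \<bar>f y\<bar> \<le> B" and N: "1 \<le> N"
  shows "\<bar>lattice_rule s N z \<delta> f\<bar> \<le> B"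
proof -
  let ?p = "\<lambda>k. \<lambda>j\<in>{1..}. if j \<le> s then frac (real k * real (z j) / real N + \<delta> j) - 1/2 else 0"
  have p: "?p k \<in> space param_measure" for k
    unfolding space_param_measure by (auto simp: less_imp_le[OF frac_lt_1])
  have "\<bar>\<Sum>k<N. f (?p k)\<bar> \<le> (\<Sum>k<N. \<bar>f (?p k)\<bar>)" by (rule sum_abs)
  also have "\<dots> \<le> (\<Sum>k<N. B)" by (intro sum_mono f p)
  finally have "\<bar>\<Sum>k<N. f (?p k)\<bar> \<le> real N * B" by simp
  then show ?thesis unfolding lattice_rule_def using N by (simp add: abs_mult field_simps)
qed

text \<open>The level differences are abstracted to bounded measurable functions, with one bound per
  level, so that the probabilistic argument is separated from the eigenvalue problem.\<close>

locale multilevel =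
  fixes m :: ml_config and f :: "nat \<Rightarrow> (nat \<Rightarrow> real) \<Rightarrow> real" and B :: "nat \<Rightarrow> real"
  assumes reps: "1 \<le> reps m" and points: "\<And>l. l \<le> levels m \<Longrightarrow> 1 \<le> points m l"
    and fm: "\<And>l. l \<le> levels m \<Longrightarrow> f l \<in> borel_measurable param_measure"
    and fb: "\<And>l y. l \<le> levels m \<Longrightarrow> y \<in> space param_measure \<Longrightarrow> \<bar>f l y\<bar> \<le> B l"
    and unbiased: "\<And>l. l \<le> levels m \<Longrightarrow> E_shift m (\<lambda>\<Delta>. Q_level m l \<Delta> (f l)) = E_param (f l)"
begin

abbreviation "shift_index \<equiv> {0..levels m} \<times> {1..reps m}"
abbreviation "P \<equiv> shift_measure m"

definition rule :: "nat \<Rightarrow> (nat \<Rightarrow> real) \<Rightarrow> real" where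
  "rule l \<delta> = lattice_rule (trunc m l) (points m l) (genvec m l) \<delta> (f l)"

lemma shift_measure_PiM: "shift_measure m = PiM shift_index (\<lambda>i. level_shift_measure (trunc m (fst i)))"
  unfolding shift_measure_def level_shift_measure_def by (intro PiM_cong) auto

sublocale shifts: product_prob_space "\<lambda>i :: nat \<times> nat. level_shift_measure (trunc m (fst i))" shift_index
  by (rule product_prob_spaceI) (rule prob_space_level_shift)

sublocale prob_space P
  unfolding shift_measure_PiM by (intro prob_space_PiM prob_space_level_shift)

lemma rule_measurable: "l \<le> levels m \<Longrightarrow> rule l \<in> borel_measurable (level_shift_measure (trunc m l))"
  unfolding rule_def[abs_def] by (intro measurable_lattice_rule fm)

lemma rule_bound: "l \<le> levels m \<Longrightarrow> \<bar>rule l \<delta>\<bar> \<le> B l"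
  unfolding rule_def by (intro lattice_rule_bound fb points)

lemma rule_integrable:
  assumes "l \<le> levels m"
  shows "integrable (level_shift_measure (trunc m l)) (rule l)"
proof -
  interpret S: prob_space "level_shift_measure (trunc m l)" by (rule prob_space_level_shift)
  show ?thesis
    using rule_measurable[OF assms] rule_bound[OF assms]
    by (intro S.integrable_const_bound[where B = "B l"]) auto
qed

lemma rule_shift_measurable:
  assumes "(l, r) \<in> shift_index"
  shows "(\<lambda>\<Delta>. rule l (\<Delta> (l, r))) \<in> borel_measurable P"
proof -
  have "(\<lambda>\<Delta>. \<Delta> (l, r)) \<in> measurable P (level_shift_measure (trunc m (fst (l, r))))"
    unfolding shift_measure_PiM using assms by (intro measurable_component_singleton)
  then show ?thesis using rule_measurable[of l] assms by (auto intro: measurable_compose)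
qed

lemma rule_shift_integrable:
  assumes "(l, r) \<in> shift_index"
  shows "integrable P (\<lambda>\<Delta>. rule l (\<Delta> (l, r)))"
  using rule_shift_measurable[OF assms] rule_bound[of l] assms
  by (intro integrable_const_bound[where B = "B l"] AE_I2) auto

lemma rule_product_integrable:
  assumes "(l, r) \<in> shift_index" "(k, q) \<in> shift_index"
  shows "integrable P (\<lambda>\<Delta>. rule l (\<Delta> (l, r)) * rule k (\<Delta> (k, q)))"
  using assms rule_bound by (intro integrable_mult_bounded[of _ _ "B l" "B k"] rule_shift_measurable) auto

lemma Q_level_eq: "Q_level m l \<Delta> (f l) = (1 / real (reps m)) * (\<Sum>r=1..reps m. rule l (\<Delta> (l, r)))"
  by (simp add: Q_level_def rule_def)

lemma Q_level_measurable:
  assumes "l \<le> levels m"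
  shows "(\<lambda>\<Delta>. Q_level m l \<Delta> (f l)) \<in> borel_measurable P"
  unfolding Q_level_eq using assms
  by (intro borel_measurable_times borel_measurable_const borel_measurable_sum rule_shift_measurable) auto

lemma Q_level_bound:
  assumes l: "l \<le> levels m"
  shows "\<bar>Q_level m l \<Delta> (f l)\<bar> \<le> B l"
proof -
  have "\<bar>\<Sum>r=1..reps m. rule l (\<Delta> (l, r))\<bar> \<le> (\<Sum>r=1..reps m. \<bar>rule l (\<Delta> (l, r))\<bar>)" by (rule sum_abs)
  also have "\<dots> \<le> (\<Sum>r=1..reps m. B l)" using rule_bound[OF l] by (intro sum_mono)
  finally have "\<bar>\<Sum>r=1..reps m. rule l (\<Delta> (l, r))\<bar> \<le> real (reps m) * B l" by simp
  then show ?thesis unfolding Q_level_eq using reps by (simp add: abs_mult field_simps)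
qed

lemma Q_level_expectation:
  assumes "l \<le> levels m"
  shows "expectation (\<lambda>\<Delta>. Q_level m l \<Delta> (f l)) = E_param (f l)"
  using unbiased[OF assms] by (simp add: E_shift_def)

lemma Q_level_integrable: "l \<le> levels m \<Longrightarrow> integrable P (\<lambda>\<Delta>. Q_level m l \<Delta> (f l))"
  using Q_level_measurable Q_level_bound by (intro integrable_const_bound[where B = "B l"]) auto

text \<open>Shifts of different levels have different indices for every choice of replicas, so all
  products factorise. Correlations within one level stay inside \<open>V_shift\<close>.\<close>

lemma Q_level_product_expectation:
  assumes l: "l \<le> levels m" and k: "k \<le> levels m" and lk: "l \<noteq> k"
  shows "expectation (\<lambda>\<Delta>. Q_level m l \<Delta> (f l) * Q_level m k \<Delta> (f k)) = E_param (f l) * E_param (f k)"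
proof -
  define e where "e j = (LINT \<delta>|level_shift_measure (trunc m j). rule j \<delta>)" for j
  have one: "expectation (\<lambda>\<Delta>. rule j (\<Delta> (j, r))) = e j" if "(j, r) \<in> shift_index" for j r
    unfolding shift_measure_PiM e_def
    using shifts.integral_prod_components[of "{(j, r)}" "\<lambda>_. rule j"] that rule_integrable[of j] by simp
  \<comment> \<open>The replicas of a level are identically distributed, so unbiasedness of their
    average determines the mean of each single rule.\<close>
  have mean: "E_param (f j) = e j" if j: "j \<le> levels m" for j
  proof -
    have "E_param (f j) = expectation (\<lambda>\<Delta>. (1 / real (reps m)) * (\<Sum>r=1..reps m. rule j (\<Delta> (j, r))))"
      using Q_level_expectation[OF j] by (simp add: Q_level_eq)
    also have "\<dots> = (1 / real (reps m)) * (\<Sum>r=1..reps m. expectation (\<lambda>\<Delta>. rule j (\<Delta> (j, r))))"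
      using j rule_shift_integrable by (simp add: Bochner_Integration.integral_sum)
    also have "\<dots> = (1 / real (reps m)) * (\<Sum>r=1..reps m. e j)"
      using one j by simp
    finally show ?thesis using reps by simp
  qed
  have two: "expectation (\<lambda>\<Delta>. rule l (\<Delta> (l, r)) * rule k (\<Delta> (k, q))) = e l * e k"
    if "(l, r) \<in> shift_index" "(k, q) \<in> shift_index" for r q
  proof -
    have "integrable (level_shift_measure (trunc m (fst i))) (rule (fst i))" if "i \<in> {(l, r), (k, q)}" for i
      using that rule_integrable l k by auto
    from shifts.integral_prod_components[of "{(l, r), (k, q)}" "\<lambda>i. rule (fst i)", OF _ _ this] that lk show ?thesis
      unfolding shift_measure_PiM e_def by simp
  qed
  have "expectation (\<lambda>\<Delta>. Q_level m l \<Delta> (f l) * Q_level m k \<Delta> (f k)) =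
    expectation (\<lambda>\<Delta>. (1 / real (reps m))\<^sup>2 *
      (\<Sum>r=1..reps m. \<Sum>q=1..reps m. rule l (\<Delta> (l, r)) * rule k (\<Delta> (k, q))))"
    unfolding Q_level_eq by (simp add: power2_eq_square sum_product)
  also have "\<dots> = (1 / real (reps m))\<^sup>2 *
      (\<Sum>r=1..reps m. \<Sum>q=1..reps m. expectation (\<lambda>\<Delta>. rule l (\<Delta> (l, r)) * rule k (\<Delta> (k, q))))"
  proof -
    have i: "integrable P (\<lambda>\<Delta>. rule l (\<Delta> (l, r)) * rule k (\<Delta> (k, q)))"
      if "r \<in> {1..reps m}" "q \<in> {1..reps m}" for r q
      using that l k by (intro rule_product_integrable) auto
    have "expectation (\<lambda>\<Delta>. \<Sum>r=1..reps m. \<Sum>q=1..reps m. rule l (\<Delta> (l, r)) * rule k (\<Delta> (k, q))) =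
      (\<Sum>r=1..reps m. expectation (\<lambda>\<Delta>. \<Sum>q=1..reps m. rule l (\<Delta> (l, r)) * rule k (\<Delta> (k, q))))"
      using i by (intro Bochner_Integration.integral_sum Bochner_Integration.integrable_sum)
    also have "\<dots> = (\<Sum>r=1..reps m. \<Sum>q=1..reps m. expectation (\<lambda>\<Delta>. rule l (\<Delta> (l, r)) * rule k (\<Delta> (k, q))))"
      using i by (intro sum.cong refl Bochner_Integration.integral_sum)
    finally show ?thesis by simp
  qed
  also have "\<dots> = (1 / real (reps m))\<^sup>2 * (\<Sum>r=1..reps m. \<Sum>q=1..reps m. e l * e k)"
    using two l k by simp
  also have "\<dots> = e l * e k" using reps by (simp add: power2_eq_square)
  finally show ?thesis using mean l k by simp
qed

text \<open>An exact bias-variance identity: unbiasedness centres the level errors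
  \<open>Z l\<close>, the product formula removes their cross terms, and the mean square of
  \<open>Z l\<close> is \<open>V_shift\<close> by definition.\<close>

theorem multilevel_mean_square_error:
  "E_shift m (\<lambda>\<Delta>. (\<mu> - (\<Sum>l=0..levels m. Q_level m l \<Delta> (f l)))\<^sup>2) =
    (\<mu> - (\<Sum>l=0..levels m. E_param (f l)))\<^sup>2 + (\<Sum>l=0..levels m. V_shift m l (f l))"
proof -
  define Z where "Z l \<Delta> = E_param (f l) - Q_level m l \<Delta> (f l)" for l \<Delta>
  have "E_shift m (\<lambda>\<Delta>. (\<mu> - (\<Sum>l=0..levels m. Q_level m l \<Delta> (f l)))\<^sup>2) =
    expectation (\<lambda>\<Delta>. ((\<mu> - (\<Sum>l=0..levels m. E_param (f l))) + (\<Sum>l=0..levels m. Z l \<Delta>))\<^sup>2)"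
    unfolding E_shift_def Z_def by (simp add: sum_subtractf)
  also have "\<dots> = (\<mu> - (\<Sum>l=0..levels m. E_param (f l)))\<^sup>2 + (\<Sum>l=0..levels m. expectation (\<lambda>\<Delta>. (Z l \<Delta>)\<^sup>2))"
  proof (rule expectation_square_sum_orthogonal[where B = "\<lambda>l. \<bar>E_param (f l)\<bar> + B l"])
    fix l assume "l \<in> {0..levels m}"
    then have l: "l \<le> levels m" by simp
    show "Z l \<in> borel_measurable P"
      unfolding Z_def[abs_def] using Q_level_measurable[OF l] by simp
    show "\<bar>Z l \<Delta>\<bar> \<le> \<bar>E_param (f l)\<bar> + B l" for \<Delta>
      using Q_level_bound[OF l, of \<Delta>] unfolding Z_def by linarith
    show "expectation (Z l) = 0"
      unfolding Z_def[abs_def] using Q_level_integrable[OF l] by (simp add: Q_level_expectation[OF l] prob_space)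
    fix k assume "k \<in> {0..levels m}" and lk: "l \<noteq> k"
    then have k: "k \<le> levels m" by simp
    let ?l = "\<lambda>\<Delta>. Q_level m l \<Delta> (f l)" and ?k = "\<lambda>\<Delta>. Q_level m k \<Delta> (f k)"
    have i: "integrable P (\<lambda>\<Delta>. ?l \<Delta> * ?k \<Delta>)"
      by (rule integrable_mult_bounded[OF Q_level_measurable[OF l] Q_level_measurable[OF k]
        Q_level_bound[OF l] Q_level_bound[OF k]])
    have "expectation (\<lambda>\<Delta>. Z l \<Delta> * Z k \<Delta>) = expectation (\<lambda>\<Delta>.
      ((E_param (f l) * E_param (f k) - E_param (f l) * ?k \<Delta>) - E_param (f k) * ?l \<Delta>) + ?l \<Delta> * ?k \<Delta>)"
      unfolding Z_def by (simp add: algebra_simps)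
    also have "\<dots> = 0"
      using i Q_level_integrable[OF l] Q_level_integrable[OF k]
      by (simp add: Q_level_expectation l k Q_level_product_expectation[OF l k lk] prob_space)
    finally show "expectation (\<lambda>\<Delta>. Z l \<Delta> * Z k \<Delta>) = 0" .
  qed simp
  finally show ?thesis by (simp add: V_shift_def E_shift_def Z_def)
qed

end

lemma telescope_level_diff:
  "(\<Sum>l=0..n. level_diff lamh m l y) = lamh (mesh m n) (trunc m n) y"
  by (induction n) (simp_all add: level_diff_def)

theorem theorem3p1:
  fixes D :: "'a::euclidean_space set"
    and a b :: "nat \<Rightarrow> 'a \<Rightarrow> real" and c :: "'a \<Rightarrow> real"
    and lam :: "(nat \<Rightarrow> real) \<Rightarrow> real" and u :: "(nat \<Rightarrow> real) \<Rightarrow> 'a \<Rightarrow> real"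
    and H :: "real set" and V :: "real \<Rightarrow> ('a \<Rightarrow> real) set"
    and lamh :: "real \<Rightarrow> nat \<Rightarrow> (nat \<Rightarrow> real) \<Rightarrow> real"
    and uh :: "real \<Rightarrow> nat \<Rightarrow> (nat \<Rightarrow> real) \<Rightarrow> 'a \<Rightarrow> real"
    and K :: "ml_config set"
    and amin amax \<alpha> \<alpha>' \<beta> \<beta>' \<eta> :: real
  assumes data: "problem_data D a b c amin amax"
    and eigen: "\<forall>y\<in>space param_measure.
      smallest_eigenpair D (H10 D) (coefficient a y) (coefficient b y) c (lam y) (u y)"
    and fe: "\<forall>h\<in>H. fe_space D h (V h)"
    and eigen_h: "\<forall>h\<in>H. \<forall>s\<ge>1. \<forall>y\<in>space param_measure.
      smallest_eigenpair D (V h) (coefficient a (truncate_param s y))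
        (coefficient b (truncate_param s y)) c (lamh h s y) (uh h s y)"
    and configs: "\<forall>m\<in>K. admissible H m"
    and unbiased: "\<forall>m\<in>K. \<forall>l\<le>levels m.
      E_shift m (\<lambda>\<Delta>. Q_level m l \<Delta> (level_diff lamh m l)) = E_param (level_diff lamh m l)"
    and pos: "\<alpha> > 0" "\<alpha>' > 0" "\<beta> > 0" "\<beta>' > 0" "\<eta> > 0"
    and M1: "\<exists>C>0. \<forall>m\<in>K.
      \<bar>E_param (\<lambda>y. lam y - lamh (mesh m (levels m)) (trunc m (levels m)) y)\<bar>
        \<le> C * (mesh m (levels m) powr \<alpha> + real (trunc m (levels m)) powr (- \<alpha>'))"
    and M2: "\<exists>C>0. \<forall>m\<in>K. \<forall>l\<le>levels m.
      V_shift m l (level_diff lamh m l)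
        \<le> C * (1 / real (reps m) * real (points m l) powr (- \<eta>) *
               (prev_mesh m l powr \<beta> + real (prev_trunc m l) powr (- \<beta>')))"
  shows "\<exists>C>0. \<forall>m\<in>K.
      E_shift m (\<lambda>\<Delta>. \<bar>E_param lam - Q_ML lamh m \<Delta>\<bar>\<^sup>2)
        \<le> C * (mesh m (levels m) powr (2 * \<alpha>) + real (trunc m (levels m)) powr (- 2 * \<alpha>') +
               1 / real (reps m) *
                 (\<Sum>l=0..levels m. 1 / real (points m l) powr \<eta> *
                    (prev_mesh m l powr \<beta> + real (prev_trunc m l) powr (- \<beta>'))))"
proof -
  have D: "open D" "convex D" using data unfolding problem_data_def by blast+
  interpret Y: prob_space param_measure by (rule prob_space_param)
  have lam_m: "lam \<in> borel_measurable param_measure"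
    and lam_b: "\<exists>B. \<forall>y\<in>space param_measure. \<bar>lam y\<bar> \<le> B"
    using smallest_eigenvalue_measurable_bounded[OF data trial_space_H10[OF D(1)], of "\<lambda>y. y" lam u] eigen
    by simp_all
  have lamh_m: "lamh h s \<in> borel_measurable param_measure"
    and lamh_b: "\<exists>B. \<forall>y\<in>space param_measure. \<bar>lamh h s y\<bar> \<le> B" if hs: "h \<in> H" "1 \<le> s" for h s
    using smallest_eigenvalue_measurable_bounded[OF data trial_space_fe_space[OF D fe[rule_format, OF hs(1)]]
      measurable_truncate_param[of s], of "lamh h s" "uh h s"] eigen_h hs by simp_all
  have int: "integrable param_measure f"
    if f: "f \<in> borel_measurable param_measure" "\<exists>B. \<forall>y\<in>space param_measure. \<bar>f y\<bar> \<le> B" for f :: "(nat \<Rightarrow> real) \<Rightarrow> real"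
  proof -
    obtain B where "\<forall>y\<in>space param_measure. \<bar>f y\<bar> \<le> B" using f(2) by blast
    then show ?thesis using f(1) by (intro Y.integrable_const_bound[of _ B] AE_I2) auto
  qed
  obtain C1 where C1: "C1 > 0" "\<And>m. m \<in> K \<Longrightarrow>
      \<bar>E_param (\<lambda>y. lam y - lamh (mesh m (levels m)) (trunc m (levels m)) y)\<bar>
        \<le> C1 * (mesh m (levels m) powr \<alpha> + real (trunc m (levels m)) powr (- \<alpha>'))"
    using M1 by blast
  obtain C2 where C2: "C2 > 0" "\<And>m l. m \<in> K \<Longrightarrow> l \<le> levels m \<Longrightarrow>
      V_shift m l (level_diff lamh m l)
        \<le> C2 * (1 / real (reps m) * real (points m l) powr (- \<eta>) *
               (prev_mesh m l powr \<beta> + real (prev_trunc m l) powr (- \<beta>')))"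
    using M2 by blast
  \<comment> \<open>The first summand comes from squaring M1, the second from M2. Neither depends on
    the configuration, so the same \<open>C\<close> serves all members of \<open>K\<close>.\<close>
  define C where "C = 2 * C1\<^sup>2 + C2"
  have C: "C > 0" "2 * C1\<^sup>2 \<le> C" "C2 \<le> C" using C1(1) C2(1) by (auto simp: C_def add_nonneg_pos)
  show ?thesis
  proof (intro exI[of _ C] conjI ballI C(1))
    fix m assume m: "m \<in> K"
    have adm: "1 \<le> reps m" and lev: "\<And>l. l \<le> levels m \<Longrightarrow> mesh m l \<in> H \<and> 1 \<le> trunc m l \<and> 1 \<le> points m l"
      using configs m unfolding admissible_def by blast+
    let ?e = "\<lambda>l. lamh (mesh m l) (trunc m l)"
    have lm: "?e l \<in> borel_measurable param_measure" and lb: "\<exists>B. \<forall>y\<in>space param_measure. \<bar>?e l y\<bar> \<le> B"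
      if "l \<le> levels m" for l
      using lamh_m lamh_b lev[OF that] by auto
    have dm: "level_diff lamh m l \<in> borel_measurable param_measure" if "l \<le> levels m" for l
      using lm that unfolding level_diff_def[abs_def] by (cases l) auto
    have "\<exists>B. \<forall>y\<in>space param_measure. \<bar>level_diff lamh m l y\<bar> \<le> B" if l: "l \<le> levels m" for l
    proof (cases l)
      case 0
      then show ?thesis using lb[OF l] by (simp add: level_diff_def)
    next
      case (Suc k)
      obtain B where B: "\<forall>y\<in>space param_measure. \<bar>?e l y\<bar> \<le> B" using lb[OF l] by blast
      obtain B' where B': "\<forall>y\<in>space param_measure. \<bar>?e k y\<bar> \<le> B'" using lb[of k] l Suc by auto
      have "\<bar>level_diff lamh m l y\<bar> \<le> B + B'" if "y \<in> space param_measure" for y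
        using bspec[OF B that] bspec[OF B' that] Suc by (simp add: level_diff_def)
      then show ?thesis by blast
    qed
    then have "\<forall>l. \<exists>B. l \<le> levels m \<longrightarrow> (\<forall>y\<in>space param_measure. \<bar>level_diff lamh m l y\<bar> \<le> B)" by blast
    from choice[OF this] obtain B where
      B: "\<And>l y. l \<le> levels m \<Longrightarrow> y \<in> space param_measure \<Longrightarrow> \<bar>level_diff lamh m l y\<bar> \<le> B l" by blast
    \<comment> \<open>The bounds \<open>B\<close> may vary with \<open>m\<close>, because they serve
      integrability only and do not enter \<open>C\<close>.\<close>
    interpret multilevel m "level_diff lamh m" B
      by unfold_locales (use adm lev dm B unbiased m in auto)
    define x where "x = mesh m (levels m) powr \<alpha>"
    define z where "z = real (trunc m (levels m)) powr (- \<alpha>')"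
    define S where "S = 1 / real (reps m) * (\<Sum>l=0..levels m. 1 / real (points m l) powr \<eta> *
      (prev_mesh m l powr \<beta> + real (prev_trunc m l) powr (- \<beta>')))"
    have x2: "mesh m (levels m) powr (2 * \<alpha>) = x\<^sup>2" and z2: "real (trunc m (levels m)) powr (- 2 * \<alpha>') = z\<^sup>2"
      unfolding x_def z_def by (simp_all add: power2_eq_square powr_add[symmetric])
    have S0: "0 \<le> S" unfolding S_def by (intro mult_nonneg_nonneg sum_nonneg) auto
    \<comment> \<open>Linearity of the expectation rests on the integrability established above; the
      sum telescopes to the finest level because the term below level 0 is zero.\<close>
    have bias: "E_param lam - (\<Sum>l=0..levels m. E_param (level_diff lamh m l)) =
      E_param (\<lambda>y. lam y - ?e (levels m) y)"
    proof -
      have "(\<Sum>l=0..levels m. E_param (level_diff lamh m l)) = E_param (\<lambda>y. \<Sum>l=0..levels m. level_diff lamh m l y)"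
        unfolding E_param_def
        by (intro Bochner_Integration.integral_sum[symmetric] int dm) (auto intro: B)
      also have "\<dots> = E_param (?e (levels m))" by (simp add: telescope_level_diff)
      finally show ?thesis
        unfolding E_param_def using int[OF lam_m lam_b] int[OF lm lb, of "levels m"] by simp
    qed
    have "(E_param lam - (\<Sum>l=0..levels m. E_param (level_diff lamh m l)))\<^sup>2 \<le> (C1 * (x + z))\<^sup>2"
    proof -
      have "\<bar>E_param lam - (\<Sum>l=0..levels m. E_param (level_diff lamh m l))\<bar> \<le> C1 * (x + z)"
        unfolding bias x_def z_def by (rule C1(2)[OF m])
      then have "\<bar>E_param lam - (\<Sum>l=0..levels m. E_param (level_diff lamh m l))\<bar>\<^sup>2 \<le> (C1 * (x + z))\<^sup>2"
        by (rule power_mono) simp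
      then show ?thesis by simp
    qed
    also have "\<dots> \<le> C1\<^sup>2 * (2 * (x\<^sup>2 + z\<^sup>2))"
      unfolding power_mult_distrib
      using sum_squares_bound[of x z] by (intro mult_left_mono) (auto simp: power2_sum)
    also have "\<dots> = 2 * C1\<^sup>2 * (x\<^sup>2 + z\<^sup>2)" by simp
    also have "\<dots> \<le> C * (x\<^sup>2 + z\<^sup>2)" using C by (intro mult_right_mono) auto
    finally have 1: "(E_param lam - (\<Sum>l=0..levels m. E_param (level_diff lamh m l)))\<^sup>2 \<le> C * (x\<^sup>2 + z\<^sup>2)" .
    have "(\<Sum>l=0..levels m. V_shift m l (level_diff lamh m l)) \<le>
      (\<Sum>l=0..levels m. C2 * (1 / real (reps m) * real (points m l) powr (- \<eta>) *
               (prev_mesh m l powr \<beta> + real (prev_trunc m l) powr (- \<beta>'))))"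
      using m by (intro sum_mono C2) auto
    also have "\<dots> = C2 * S"
      unfolding S_def sum_distrib_left by (intro sum.cong refl) (simp add: powr_minus divide_inverse)
    also have "\<dots> \<le> C * S" using C S0 by (intro mult_right_mono)
    finally have 2: "(\<Sum>l=0..levels m. V_shift m l (level_diff lamh m l)) \<le> C * S" .
    have "E_shift m (\<lambda>\<Delta>. \<bar>E_param lam - Q_ML lamh m \<Delta>\<bar>\<^sup>2) =
      (E_param lam - (\<Sum>l=0..levels m. E_param (level_diff lamh m l)))\<^sup>2 +
      (\<Sum>l=0..levels m. V_shift m l (level_diff lamh m l))"
      using multilevel_mean_square_error[of "E_param lam"] by (simp add: Q_ML_def)
    also have "\<dots> \<le> C * (x\<^sup>2 + z\<^sup>2) + C * S" using 1 2 by (rule add_mono)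
    also have "\<dots> = C * (x\<^sup>2 + z\<^sup>2 + S)" by (simp only: distrib_left)
    finally show "E_shift m (\<lambda>\<Delta>. \<bar>E_param lam - Q_ML lamh m \<Delta>\<bar>\<^sup>2)
        \<le> C * (mesh m (levels m) powr (2 * \<alpha>) + real (trunc m (levels m)) powr (- 2 * \<alpha>') +
               1 / real (reps m) *
                 (\<Sum>l=0..levels m. 1 / real (points m l) powr \<eta> *
                    (prev_mesh m l powr \<beta> + real (prev_trunc m l) powr (- \<beta>'))))"
      unfolding x2 z2 S_def .
  qed
qed

end
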